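(* Let $R$ be an indecomposable commutative ring, let $(\Sigma,i,q)$ be a discrete $R$-twist over an ample Hausdorff groupoid $G$, let $A=A_R(G;\Sigma)$, and let $B=A_R(G^{(0)};q^{-1}(G^{(0)}))$. Let $\Sigma'$ be the groupoid of ultrafilters of $N(B)$. For each $x\in\Sigma^{(0)}$, let $U_x$ be the ultrafilter $\{e\in I(B):e(x)=1\}$ of $I(B)$. For $\sigma\in\Sigma$, let $X$ be a compact open bisection of $\Sigma$ containing $\sigma$, and let $$\Phi(\sigma)=(\tilde1_XU_{s(\sigma)})^{\uparrow}\in\Sigma'.$$ Then $\Phi(\sigma)$ does not depend on the choice of $X$. The map $\Phi\colon\Sigma\to\Sigma'$ is an $R^\times$-equivariant continuous open embedding of topological groupoids such that $\Phi(\Sigma^{(0)})=\Sigma'^{(0)}$.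
   Context: **Rings and groupoids.** A commutative ring $R$ with identity is indecomposable if $0\neq1$ and its only idempotents are $0$ and $1$. $R^\times$ is its group of units, with the discrete topology. Groupoids are locally compact topological groupoids with Hausdorff unit space $G^{(0)}$ and range/source maps $r,s$. A bisection is a subset $D$ contained in an open set $O$ such that $r|_O,s|_O$ are homeomorphisms onto open subsets of $G^{(0)}$. $G$ is étale if $r$ is a local homeomorphism, and ample if it is étale with a basis of compact open bisections. **Twists.** A discrete $R$-twist $(\Sigma,i,q)$ over an étale groupoid $G$ is a sequence $G^{(0)}\times R^\times\xrightarrow{i}\Sigma\xrightarrow{q}G$, where $G^{(0)}\times R^\times$ is the trivial group bundle, $\Sigma$ is a topological groupoid with $\Sigma^{(0)}=i(G^{(0)}\times\{1\})$ (identified with $G^{(0)}$), and $i,q$ are continuous groupoid homomorphisms restricting to homeomorphisms of unit spaces, such that: (DT1) $i(\{x\}\times R^\times)=q^{-1}(x)$ for $x\in G^{(0)}$, $i$ injective, $q$ surjective; (DT2) each $\alpha\in G$ has an open bisection $B_\alpha\ni\alpha$ and a continuous $P_\alpha\colon B_\alpha\to\Sigma$ with $q\circ P_\alpha=\mathrm{id}$ and $(\beta,t)\mapsto i(r(\beta),t)P_\alpha(\beta)$ a homeomorphism $B_\alpha\times R^\times\to q^{-1}(B_\alpha)$; (DT3) $i(r(\sigma),t)\sigma=\sigma i(s(\sigma),t)$. Write $t\cdot\sigma=i(r(\sigma),t)\sigma$; this is the $R^\times$-action on $\Sigma$. **Twisted Steinberg algebra.** $\operatorname{supp}(f)=\{f\neq0\}$,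 $\operatorname{supp}_G(f)=q(\operatorname{supp}(f))$. $A_R(G;\Sigma)$ is the set of locally constant $f\colon\Sigma\to R$ with $f(t\cdot\sigma)=t^{-1}f(\sigma)$ for $t\in R^\times$ and $q(\operatorname{supp}(f))$ compact; it is an $R$-algebra under pointwise operations and $(f*g)(\sigma)=\sum_{\alpha\in r^{-1}(r(\sigma))\cap\operatorname{supp}_G(f)}f(S(\alpha))g(S(\alpha)^{-1}\sigma)$, with $S\colon\operatorname{supp}_G(f)\to\operatorname{supp}(f)$ any section for $q$. $A_R(G^{(0)};q^{-1}(G^{(0)}))$ is the commutative subalgebra of those $f$ supported in $q^{-1}(G^{(0)})$. For a compact open bisection $X\subseteq\Sigma$, $\tilde1_X$ is the unique element of $A_R(G;\Sigma)$ with support contained in $R^\times\cdot X$ and equal to $1$ on $X$. **Normalisers and ultrafilters.** $I(B)$ is the set of idempotents of $B$ (a Boolean algebra under meet $ef$). $N(B)=\{n\in A:\exists k\in A,\ knk=k,\ nkn=n,\ kBn\cup nBk\subseteq B\}$; $k$ is unique, denoted $n^\dagger$; $N(B)$ is an inverse semigroup with idempotent set $I(B)$ and partial order $n\le m\iff n=nn^\dagger m$. $U^\uparrow=\{m\in N(B):n\le m\text{ for some }n\in U\}$. A filter is $U\subseteq N(B)\setminus\{0\}$ with $U=U^\uparrow$ in which any two elements have a common lower bound in $U$; an ultrafilter is a maximal (nonempty) filter. $\Sigma'$ is the set of ultrafilters of $N(B)$, with $U^{-1}=\{n^\dagger:n\in U\}$; $(U,V)$ is composable iff $mn\ne0$ for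 all $m\in U,n\in V$, and then $UV=\{mn:m\in U,n\in V\}^\uparrow$; $\Sigma'^{(0)}=\{U\in\Sigma':U\cap I(B)\neq\varnothing\}$; the topology has basis $\mathcal V_n=\{U:n\in U\}$, $n\in N(B)$; $R^\times$ acts by $tU=\{tm:m\in U\}$. $\tilde1_XU_{s(\sigma)}=\{\tilde1_Xe:e\in U_{s(\sigma)}\}$. *)

theory Defs
  imports "HOL-Analysis.Analysis"
begin

section \<open>Topological groupoids\<close>

text \<open>
  A groupoid is given by its set of composable pairs, its product and its inverse; range, source
  and units are derived.  The arrows are the points of the topology, and product and inverse carry
  no information outside the composable pairs and the arrows.
\<close>

record 'a tgroupoid =
  gtop :: "'a topology"
  comps :: "('a \<times> 'a) set"
  gmult :: "'a \<Rightarrow> 'a \<Rightarrow> 'a"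
  ginv :: "'a \<Rightarrow> 'a"

definition arrows :: "('a, 'b) tgroupoid_scheme \<Rightarrow> 'a set"
  where "arrows G = topspace (gtop G)"

definition rng :: "('a, 'b) tgroupoid_scheme \<Rightarrow> 'a \<Rightarrow> 'a"
  where "rng G a = gmult G a (ginv G a)"

definition src :: "('a, 'b) tgroupoid_scheme \<Rightarrow> 'a \<Rightarrow> 'a"
  where "src G a = gmult G (ginv G a) a"

definition units :: "('a, 'b) tgroupoid_scheme \<Rightarrow> 'a set"
  where "units G = src G ` arrows G"

definition unit_top :: "('a, 'b) tgroupoid_scheme \<Rightarrow> 'a topology"
  where "unit_top G = subtopology (gtop G) (units G)"

locale groupoid =
  fixes G :: "('a, 'b) tgroupoid_scheme"
  assumes comps_arrows: "comps G \<subseteq> arrows G \<times> arrows G"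
    and mult_closed: "(a, b) \<in> comps G \<Longrightarrow> gmult G a b \<in> arrows G"
    and inv_closed: "a \<in> arrows G \<Longrightarrow> ginv G a \<in> arrows G"
    and inv_inv: "a \<in> arrows G \<Longrightarrow> ginv G (ginv G a) = a"
    and comps_assoc: "\<lbrakk>(a, b) \<in> comps G; (b, c) \<in> comps G\<rbrakk> \<Longrightarrow>
          (gmult G a b, c) \<in> comps G \<and> (a, gmult G b c) \<in> comps G"
    and mult_assoc: "\<lbrakk>(a, b) \<in> comps G; (b, c) \<in> comps G\<rbrakk> \<Longrightarrow>
          gmult G (gmult G a b) c = gmult G a (gmult G b c)"
    and comps_inv: "a \<in> arrows G \<Longrightarrow> (a, ginv G a) \<in> comps G"
    and inv_left: "(a, b) \<in> comps G \<Longrightarrow> gmult G (ginv G a) (gmult G a b) = b"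
    and inv_right: "(a, b) \<in> comps G \<Longrightarrow> gmult G (gmult G a b) (ginv G b) = a"

text \<open>As a convention, all topological groupoids here are locally compact with Hausdorff unit space.\<close>

locale topological_groupoid = groupoid +
  assumes continuous_mult:
      "continuous_map (subtopology (prod_topology (gtop G) (gtop G)) (comps G)) (gtop G)
         (\<lambda>(a, b). gmult G a b)"
    and continuous_inv: "continuous_map (gtop G) (gtop G) (ginv G)"
    and locally_compact: "locally_compact_space (gtop G)"
    and Hausdorff_units: "Hausdorff_space (unit_top G)"

definition open_homeo_on :: "'a topology \<Rightarrow> 'b topology \<Rightarrow> ('a \<Rightarrow> 'b) \<Rightarrow> 'a set \<Rightarrow> bool"
  where "open_homeo_on X Y f W \<longleftrightarrow>
    openin X W \<and> openin Y (f ` W) \<and>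
    homeomorphic_map (subtopology X W) (subtopology Y (f ` W)) f"

definition local_homeomorphism :: "'a topology \<Rightarrow> 'b topology \<Rightarrow> ('a \<Rightarrow> 'b) \<Rightarrow> bool"
  where "local_homeomorphism X Y f \<longleftrightarrow>
    (\<forall>x\<in>topspace X. \<exists>W. x \<in> W \<and> open_homeo_on X Y f W)"

definition bisection :: "('a, 'b) tgroupoid_scheme \<Rightarrow> 'a set \<Rightarrow> bool"
  where "bisection G D \<longleftrightarrow>
    (\<exists>W. D \<subseteq> W \<and> open_homeo_on (gtop G) (unit_top G) (rng G) W
               \<and> open_homeo_on (gtop G) (unit_top G) (src G) W)"

definition compact_open_bisection :: "('a, 'b) tgroupoid_scheme \<Rightarrow> 'a set \<Rightarrow> bool"
  where "compact_open_bisection G D \<longleftrightarrow>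
    bisection G D \<and> openin (gtop G) D \<and> compactin (gtop G) D"

definition etale :: "('a, 'b) tgroupoid_scheme \<Rightarrow> bool"
  where "etale G \<longleftrightarrow>
    topological_groupoid G \<and> local_homeomorphism (gtop G) (unit_top G) (rng G)"

definition ample :: "('a, 'b) tgroupoid_scheme \<Rightarrow> bool"
  where "ample G \<longleftrightarrow> etale G \<and>
    (\<forall>W a. openin (gtop G) W \<and> a \<in> W \<longrightarrow>
       (\<exists>D. compact_open_bisection G D \<and> a \<in> D \<and> D \<subseteq> W))"

definition groupoid_hom ::
    "('a, 'c) tgroupoid_scheme \<Rightarrow> ('b, 'd) tgroupoid_scheme \<Rightarrow> ('a \<Rightarrow> 'b) \<Rightarrow> bool"
  where "groupoid_hom G H f \<longleftrightarrow>
    f \<in> arrows G \<rightarrow> arrows H \<and>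
    (\<forall>(a, b)\<in>comps G. (f a, f b) \<in> comps H \<and> f (gmult G a b) = gmult H (f a) (f b))"

text \<open>
  The last two clauses say that the image, with the operations of the target, is a copy of the
  domain.  They follow from the first two when the target is known to be a groupoid.
\<close>

definition groupoid_embedding ::
    "('a, 'c) tgroupoid_scheme \<Rightarrow> ('b, 'd) tgroupoid_scheme \<Rightarrow> ('a \<Rightarrow> 'b) \<Rightarrow> bool"
  where "groupoid_embedding G H f \<longleftrightarrow>
    groupoid_hom G H f \<and> inj_on f (arrows G) \<and>
    (\<forall>a\<in>arrows G. \<forall>b\<in>arrows G. (f a, f b) \<in> comps H \<longrightarrow> (a, b) \<in> comps G) \<and>
    (\<forall>a\<in>arrows G. f (ginv G a) = ginv H (f a))"

definition continuous_open_groupoid_embedding ::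
    "('a, 'c) tgroupoid_scheme \<Rightarrow> ('b, 'd) tgroupoid_scheme \<Rightarrow> ('a \<Rightarrow> 'b) \<Rightarrow> bool"
  where "continuous_open_groupoid_embedding G H f \<longleftrightarrow>
    groupoid_embedding G H f \<and> continuous_map (gtop G) (gtop H) f \<and>
    open_map (gtop G) (gtop H) f \<and> embedding_map (gtop G) (gtop H) f"


section \<open>Discrete twists\<close>

definition indecomposable_ring :: "'r::comm_ring_1 itself \<Rightarrow> bool"
  where "indecomposable_ring _ \<longleftrightarrow>
    (0::'r) \<noteq> 1 \<and> (\<forall>e::'r. e * e = e \<longrightarrow> e = 0 \<or> e = 1)"

definition runits :: "'r::comm_ring_1 set"
  where "runits = {t. t dvd 1}"

definition rinv :: "'r::comm_ring_1 \<Rightarrow> 'r"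
  where "rinv t = (THE u. t * u = 1)"

definition trivial_bundle ::
    "('g, 'b) tgroupoid_scheme \<Rightarrow> ('g \<times> 'r::comm_ring_1) tgroupoid"
  where "trivial_bundle G =
    \<lparr> gtop = prod_topology (unit_top G) (discrete_topology runits),
      comps = {((x, t), (y, u)) | x t y u. x \<in> units G \<and> x = y \<and> t \<in> runits \<and> u \<in> runits},
      gmult = (\<lambda>(x, t) (y, u). (x, t * u)),
      ginv = (\<lambda>(x, t). (x, rinv t)) \<rparr>"

text \<open>The twist \<open>(tot, inc, prj)\<close> over \<open>base\<close>.\<close>

record ('r, 'g, 'a) twist =
  base :: "'g tgroupoid"
  tot :: "'a tgroupoid"
  inc :: "'g \<times> 'r \<Rightarrow> 'a"
  prj :: "'a \<Rightarrow> 'g"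

definition fibre :: "('r, 'g, 'a) twist \<Rightarrow> 'g set \<Rightarrow> 'a set"
  where "fibre T D = {\<sigma> \<in> arrows (tot T). prj T \<sigma> \<in> D}"

text \<open>
  Here \<open>prj T (rng (tot T) \<sigma>)\<close> is the range of \<open>\<sigma>\<close>, a unit of the total groupoid, under the
  identification of its units with those of the base.
\<close>

definition act :: "('r, 'g, 'a) twist \<Rightarrow> 'r \<Rightarrow> 'a \<Rightarrow> 'a"
  where "act T t \<sigma> = gmult (tot T) (inc T (prj T (rng (tot T) \<sigma>), t)) \<sigma>"

locale discrete_twist =
  fixes T :: "('r::comm_ring_1, 'g, 'a) twist"
  assumes base_etale: "etale (base T)"
    and tot_groupoid: "topological_groupoid (tot T)"
    and tot_units: "units (tot T) = inc T ` (units (base T) \<times> {1})"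
    and inc_hom: "groupoid_hom (trivial_bundle (base T)) (tot T) (inc T)"
    and inc_continuous: "continuous_map (gtop (trivial_bundle (base T))) (gtop (tot T)) (inc T)"
    and inc_units: "homeomorphic_map (unit_top (trivial_bundle (base T))) (unit_top (tot T)) (inc T)"
    and prj_hom: "groupoid_hom (tot T) (base T) (prj T)"
    and prj_continuous: "continuous_map (gtop (tot T)) (gtop (base T)) (prj T)"
    and prj_units: "homeomorphic_map (unit_top (tot T)) (unit_top (base T)) (prj T)"
    and DT1_exact: "x \<in> units (base T) \<Longrightarrow> inc T ` ({x} \<times> runits) = fibre T {x}"
    and DT1_inj: "inj_on (inc T) (units (base T) \<times> runits)"
    and DT1_surj: "prj T ` arrows (tot T) = arrows (base T)"
    and DT2: "\<alpha> \<in> arrows (base T) \<Longrightarrow>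
          \<exists>D P. \<alpha> \<in> D \<and> openin (gtop (base T)) D \<and> bisection (base T) D \<and>
            continuous_map (subtopology (gtop (base T)) D) (gtop (tot T)) P \<and>
            (\<forall>\<beta>\<in>D. prj T (P \<beta>) = \<beta>) \<and>
            homeomorphic_map
              (prod_topology (subtopology (gtop (base T)) D) (discrete_topology runits))
              (subtopology (gtop (tot T)) (fibre T D))
              (\<lambda>(\<beta>, t). gmult (tot T) (inc T (rng (base T) \<beta>, t)) (P \<beta>))"
    and DT3: "\<lbrakk>\<sigma> \<in> arrows (tot T); t \<in> runits\<rbrakk> \<Longrightarrow>
          act T t \<sigma> = gmult (tot T) \<sigma> (inc T (prj T (src (tot T) \<sigma>), t))"


section \<open>The twisted Steinberg algebra\<close>

text \<open>
  Functions on the total groupoid are represented by functions on the whole type that vanish off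
  the arrows.
\<close>

definition supp :: "('a \<Rightarrow> 'r::comm_ring_1) \<Rightarrow> 'a set"
  where "supp f = {\<sigma>. f \<sigma> \<noteq> 0}"

definition locally_constant_map :: "'a topology \<Rightarrow> ('a \<Rightarrow> 'r) \<Rightarrow> bool"
  where "locally_constant_map X f \<longleftrightarrow>
    (\<forall>x\<in>topspace X. \<exists>W. openin X W \<and> x \<in> W \<and> (\<forall>y\<in>W. f y = f x))"

definition steinberg :: "('r::comm_ring_1, 'g, 'a) twist \<Rightarrow> ('a \<Rightarrow> 'r) set"
  where "steinberg T = {f.
    supp f \<subseteq> arrows (tot T) \<and>
    locally_constant_map (gtop (tot T)) f \<and>
    (\<forall>t\<in>runits. \<forall>\<sigma>\<in>arrows (tot T). f (act T t \<sigma>) = rinv t * f \<sigma>) \<and>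
    compactin (gtop (base T)) (prj T ` supp f)}"

text \<open>
  For \<open>f\<close> in the algebra the summand does not depend on the chosen preimage of \<open>\<alpha>\<close>, and the index
  set is finite.
\<close>

definition conv ::
    "('r::comm_ring_1, 'g, 'a) twist \<Rightarrow> ('a \<Rightarrow> 'r) \<Rightarrow> ('a \<Rightarrow> 'r) \<Rightarrow> 'a \<Rightarrow> 'r"
  where "conv T f g \<sigma> =
    (if \<sigma> \<in> arrows (tot T) then
       \<Sum>\<alpha>\<in>{\<alpha> \<in> prj T ` supp f. rng (base T) \<alpha> = prj T (rng (tot T) \<sigma>)}.
         let \<tau> = (SOME \<tau>. \<tau> \<in> supp f \<and> prj T \<tau> = \<alpha>)
         in f \<tau> * g (gmult (tot T) (ginv (tot T) \<tau>) \<sigma>)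
     else 0)"

definition diagonal :: "('r::comm_ring_1, 'g, 'a) twist \<Rightarrow> ('a \<Rightarrow> 'r) set"
  where "diagonal T = {f \<in> steinberg T. supp f \<subseteq> fibre T (units (base T))}"

definition tilde_one :: "('r::comm_ring_1, 'g, 'a) twist \<Rightarrow> 'a set \<Rightarrow> 'a \<Rightarrow> 'r"
  where "tilde_one T X = (THE f. f \<in> steinberg T \<and>
    supp f \<subseteq> {act T t \<sigma> | t \<sigma>. t \<in> runits \<and> \<sigma> \<in> X} \<and> (\<forall>\<sigma>\<in>X. f \<sigma> = 1))"


section \<open>Normalisers and the groupoid of ultrafilters\<close>

definition idems :: "('r::comm_ring_1, 'g, 'a) twist \<Rightarrow> ('a \<Rightarrow> 'r) set"
  where "idems T = {e \<in> diagonal T. conv T e e = e}"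

definition normalising_inverse ::
    "('r::comm_ring_1, 'g, 'a) twist \<Rightarrow> ('a \<Rightarrow> 'r) \<Rightarrow> ('a \<Rightarrow> 'r) \<Rightarrow> bool"
  where "normalising_inverse T n k \<longleftrightarrow>
    k \<in> steinberg T \<and>
    conv T (conv T k n) k = k \<and> conv T (conv T n k) n = n \<and>
    (\<forall>b\<in>diagonal T. conv T (conv T k b) n \<in> diagonal T \<and> conv T (conv T n b) k \<in> diagonal T)"

definition normalisers :: "('r::comm_ring_1, 'g, 'a) twist \<Rightarrow> ('a \<Rightarrow> 'r) set"
  where "normalisers T = {n \<in> steinberg T. \<exists>k. normalising_inverse T n k}"

definition dagger :: "('r::comm_ring_1, 'g, 'a) twist \<Rightarrow> ('a \<Rightarrow> 'r) \<Rightarrow> 'a \<Rightarrow> 'r"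
  where "dagger T n = (THE k. normalising_inverse T n k)"

definition nle :: "('r::comm_ring_1, 'g, 'a) twist \<Rightarrow> ('a \<Rightarrow> 'r) \<Rightarrow> ('a \<Rightarrow> 'r) \<Rightarrow> bool"
  where "nle T n m \<longleftrightarrow> n = conv T (conv T n (dagger T n)) m"

definition upset :: "('r::comm_ring_1, 'g, 'a) twist \<Rightarrow> ('a \<Rightarrow> 'r) set \<Rightarrow> ('a \<Rightarrow> 'r) set"
  where "upset T U = {m \<in> normalisers T. \<exists>n\<in>U. nle T n m}"

definition nfilter :: "('r::comm_ring_1, 'g, 'a) twist \<Rightarrow> ('a \<Rightarrow> 'r) set \<Rightarrow> bool"
  where "nfilter T U \<longleftrightarrow>
    U \<subseteq> normalisers T - {\<lambda>_. 0} \<and> U = upset T U \<and>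
    (\<forall>m\<in>U. \<forall>n\<in>U. \<exists>k\<in>U. nle T k m \<and> nle T k n)"

definition ultrafilters :: "('r::comm_ring_1, 'g, 'a) twist \<Rightarrow> ('a \<Rightarrow> 'r) set set"
  where "ultrafilters T =
    {U. U \<noteq> {} \<and> nfilter T U \<and> (\<forall>V. nfilter T V \<and> U \<subseteq> V \<longrightarrow> V = U)}"

text \<open>
  The generating sets of the topology form a base of it, since any two elements of an ultrafilter
  have a common lower bound in it.
\<close>

definition ultrafilter_groupoid ::
    "('r::comm_ring_1, 'g, 'a) twist \<Rightarrow> ('a \<Rightarrow> 'r) set tgroupoid"
  where "ultrafilter_groupoid T =
    \<lparr> gtop = topology_generated_by ((\<lambda>n. {U \<in> ultrafilters T. n \<in> U}) ` normalisers T),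
      comps = {(U, V). U \<in> ultrafilters T \<and> V \<in> ultrafilters T \<and>
                 (\<forall>m\<in>U. \<forall>n\<in>V. conv T m n \<noteq> (\<lambda>_. 0))},
      gmult = (\<lambda>U V. upset T {conv T m n | m n. m \<in> U \<and> n \<in> V}),
      ginv = (\<lambda>U. dagger T ` U) \<rparr>"

definition ultrafilter_units :: "('r::comm_ring_1, 'g, 'a) twist \<Rightarrow> ('a \<Rightarrow> 'r) set set"
  where "ultrafilter_units T = {U \<in> ultrafilters T. U \<inter> idems T \<noteq> {}}"

definition uact :: "'r::comm_ring_1 \<Rightarrow> ('a \<Rightarrow> 'r) set \<Rightarrow> ('a \<Rightarrow> 'r) set"
  where "uact t U = (\<lambda>m \<sigma>. t * m \<sigma>) ` U"

definition point_ultrafilter :: "('r::comm_ring_1, 'g, 'a) twist \<Rightarrow> 'a \<Rightarrow> ('a \<Rightarrow> 'r) set"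
  where "point_ultrafilter T x = {e \<in> idems T. e x = 1}"

definition Phi_at :: "('r::comm_ring_1, 'g, 'a) twist \<Rightarrow> 'a set \<Rightarrow> 'a \<Rightarrow> ('a \<Rightarrow> 'r) set"
  where "Phi_at T X \<sigma> =
    upset T (conv T (tilde_one T X) ` point_ultrafilter T (src (tot T) \<sigma>))"

definition Phi :: "('r::comm_ring_1, 'g, 'a) twist \<Rightarrow> 'a \<Rightarrow> ('a \<Rightarrow> 'r) set"
  where "Phi T \<sigma> = Phi_at T (SOME X. compact_open_bisection (tot T) X \<and> \<sigma> \<in> X) \<sigma>"

end

theory Submission
  imports Defs
begin

text \<open>
  The image of an arrow \<open>\<sigma>\<close> has an explicit description that does not mention any bisection. Along
  the range fibre \<open>r\<^sup>-\<^sup>1(r(\<sigma>))\<close>, the function \<open>tilde_one T X\<close> with \<open>\<sigma> \<in> X\<close> is the equivariant delta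
  function at \<open>\<sigma>\<close>: it is 1 at \<open>\<sigma>\<close> and vanishes off the orbit of \<open>\<sigma>\<close>. The filter attached to \<open>\<sigma>\<close>
  consists of all normalisers with this restriction (\<open>arrow_filter\<close>, \<open>Phi_at_eq_arrow_filter\<close>). In
  particular it does not depend on \<open>X\<close>.

  This works because the ranges at which an element of \<open>A\<close> is not identically zero form a compact
  open set of units (\<open>nonvanishing_ranges\<close>): the support is open with compact image in the base, the
  range map is open, and the unit space is Hausdorff. So two elements of \<open>A\<close> that agree along one
  range fibre agree along all nearby ones, hence after multiplication by an idempotent \<open>e\<close> with value
  1 at that range (\<open>agree_near\<close>). For normalisers the product with \<open>e\<close> is then a common lower bound
  (\<open>nle_restrict\<close>), which makes \<open>arrow_filter \<sigma>\<close> a filter. For maximality, suppose that \<open>m\<close> differs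
  along the range fibre of \<open>\<sigma>\<close> from an element \<open>n\<close> of the filter. Then \<open>m\<close> and \<open>n\<close> differ along all
  nearby range fibres, so \<open>m\<close> and a restriction \<open>e \<star> n\<close> have only 0 as a common lower bound
  (\<open>arrow_filter_maximal\<close>).

  The algebraic claims follow from one computation: if \<open>f\<close> is the delta function at \<open>\<sigma>\<close> along its
  range fibre, then left multiplication by \<open>f\<close> is translation by \<open>\<sigma>\<close> there (\<open>conv_delta\<close>). Thus delta
  functions multiply and invert like arrows (\<open>delta_at_conv\<close>, \<open>delta_at_inv\<close>), and the scalar \<open>t\<close>
  moves \<open>\<sigma>\<close> to \<open>t \<rhd> \<sigma>\<close>. Idempotents separate units, which gives injectivity and shows that arrows
  with composable images are composable.

  The map is continuous because being a delta function at \<open>\<sigma>\<close> is an open condition on \<open>\<sigma>\<close>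
  (\<open>openin_delta_at\<close>). It is open and maps units onto units because an ultrafilter \<open>U\<close>
  containing an element \<open>n\<close> that is zero or a delta function along every range fibre is the filter of
  an arrow (\<open>ultrafilter_with_monomial\<close>): by compactness some range supports every element of \<open>U\<close>,
  and along its fibre the elements of \<open>U\<close> all agree with \<open>n\<close>. Functions \<open>tilde_one T X\<close> and idempotents
  of \<open>B\<close> are such elements.

  All this takes place in an associative algebra, so it has to be shown that the convolution product
  of two elements of \<open>A\<close> is again locally constant with compact support, and that it is associative;
  both rest on the freedom to sum over arbitrary lifts of base arrows (\<open>conv_eq\<close>).
\<close>

section \<open>Groupoids\<close>

context groupoid
begin

lemma comps_inv_left: "a \<in> arrows G \<Longrightarrow> (ginv G a, a) \<in> comps G"
  using comps_inv[of "ginv G a"] inv_closed inv_inv by auto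

lemma comps_arrowsD: "(a, b) \<in> comps G \<Longrightarrow> a \<in> arrows G \<and> b \<in> arrows G"
  using comps_arrows by auto

lemma comps_iff:
  "(a, b) \<in> comps G \<longleftrightarrow> a \<in> arrows G \<and> b \<in> arrows G \<and> src G a = rng G b"
proof
  assume ab: "(a, b) \<in> comps G"
  then have arr: "a \<in> arrows G" "b \<in> arrows G"
    using comps_arrowsD by auto
  have "gmult G (ginv G a) (gmult G (gmult G a b) (ginv G b)) =
        gmult G (gmult G (ginv G a) (gmult G a b)) (ginv G b)"
    by (metis ab arr comps_assoc comps_inv comps_inv_left mult_assoc)
  then have "src G a = rng G b"
    using inv_left[OF ab] inv_right[OF ab] by (simp add: src_def rng_def)
  with arr show "a \<in> arrows G \<and> b \<in> arrows G \<and> src G a = rng G b" by simp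
next
  assume h: "a \<in> arrows G \<and> b \<in> arrows G \<and> src G a = rng G b"
  have 1: "(a, src G a) \<in> comps G"
    unfolding src_def using comps_assoc[OF comps_inv comps_inv_left] h by auto
  have 2: "(rng G b, b) \<in> comps G"
    unfolding rng_def using comps_assoc[OF comps_inv comps_inv_left] h by auto
  have "gmult G a (src G a) = a"
    unfolding src_def using h inv_right[OF comps_inv, of a] mult_assoc[OF comps_inv comps_inv_left, of a]
    by (simp add: inv_inv)
  moreover have "(gmult G a (src G a), b) \<in> comps G"
    using comps_assoc[of a "src G a" b] 1 2 h by auto
  ultimately show "(a, b) \<in> comps G" by simp
qed

lemma rng_arrow [simp]: "a \<in> arrows G \<Longrightarrow> rng G a \<in> arrows G"
  unfolding rng_def by (rule mult_closed[OF comps_inv])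

lemma src_arrow [simp]: "a \<in> arrows G \<Longrightarrow> src G a \<in> arrows G"
  unfolding src_def by (rule mult_closed[OF comps_inv_left])

lemma inv_arrow [simp]: "a \<in> arrows G \<Longrightarrow> ginv G a \<in> arrows G"
  by (rule inv_closed)

lemma inv_inv' [simp]: "a \<in> arrows G \<Longrightarrow> ginv G (ginv G a) = a"
  by (rule inv_inv)

lemma src_inv [simp]: "a \<in> arrows G \<Longrightarrow> src G (ginv G a) = rng G a"
  by (simp add: src_def rng_def)

lemma rng_inv [simp]: "a \<in> arrows G \<Longrightarrow> rng G (ginv G a) = src G a"
  by (simp add: src_def rng_def)

lemma comps_src: "a \<in> arrows G \<Longrightarrow> (a, src G a) \<in> comps G"
  unfolding src_def using comps_assoc[OF comps_inv comps_inv_left] by auto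

lemma comps_rng: "a \<in> arrows G \<Longrightarrow> (rng G a, a) \<in> comps G"
  unfolding rng_def using comps_assoc[OF comps_inv comps_inv_left] by auto

lemma rng_src [simp]: "a \<in> arrows G \<Longrightarrow> rng G (src G a) = src G a"
  using comps_src comps_iff by metis

lemma src_rng [simp]: "a \<in> arrows G \<Longrightarrow> src G (rng G a) = rng G a"
  using comps_rng comps_iff by metis

lemma mult_src [simp]: "a \<in> arrows G \<Longrightarrow> gmult G a (src G a) = a"
  unfolding src_def using inv_right[OF comps_inv, of a] mult_assoc[OF comps_inv comps_inv_left, of a]
  by (simp add: inv_inv)

lemma mult_rng [simp]: "a \<in> arrows G \<Longrightarrow> gmult G (rng G a) a = a"
  unfolding rng_def using inv_right[OF comps_inv, of a] by (simp add: inv_inv)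

lemma mult_arrow [simp]:
  "a \<in> arrows G \<Longrightarrow> b \<in> arrows G \<Longrightarrow> src G a = rng G b \<Longrightarrow> gmult G a b \<in> arrows G"
  using mult_closed comps_iff by blast

lemma src_mult [simp]:
  assumes "a \<in> arrows G" "b \<in> arrows G" "src G a = rng G b"
  shows "src G (gmult G a b) = src G b"
proof -
  have "(gmult G a b, ginv G b) \<in> comps G"
    using comps_assoc[of a b "ginv G b"] assms by (auto simp: comps_iff)
  then show ?thesis using assms by (auto simp: comps_iff)
qed

lemma rng_mult [simp]:
  assumes "a \<in> arrows G" "b \<in> arrows G" "src G a = rng G b"
  shows "rng G (gmult G a b) = rng G a"
proof -
  have "(ginv G a, gmult G a b) \<in> comps G"
    using comps_assoc[of "ginv G a" a b] assms by (auto simp: comps_iff)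
  then show ?thesis using assms by (auto simp: comps_iff)
qed

lemma assoc:
  assumes "a \<in> arrows G" "b \<in> arrows G" "c \<in> arrows G" "src G a = rng G b" "src G b = rng G c"
  shows "gmult G (gmult G a b) c = gmult G a (gmult G b c)"
  using assms by (intro mult_assoc) (auto simp: comps_iff)

lemma inv_mult_cancel [simp]:
  "a \<in> arrows G \<Longrightarrow> b \<in> arrows G \<Longrightarrow> src G a = rng G b \<Longrightarrow> gmult G (ginv G a) (gmult G a b) = b"
  by (intro inv_left) (auto simp: comps_iff)

lemma mult_inv_cancel [simp]:
  "a \<in> arrows G \<Longrightarrow> b \<in> arrows G \<Longrightarrow> rng G a = rng G b \<Longrightarrow> gmult G a (gmult G (ginv G a) b) = b"
  using inv_mult_cancel[of "ginv G a" b] by simp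

lemma mult_left_cancel:
  assumes "a \<in> arrows G" "b \<in> arrows G" "c \<in> arrows G" "src G a = rng G b" "src G a = rng G c"
    and "gmult G a b = gmult G a c"
  shows "b = c"
  using assms inv_mult_cancel by metis

lemma mult_right_cancel:
  assumes "a \<in> arrows G" "b \<in> arrows G" "c \<in> arrows G" "src G b = rng G a" "src G c = rng G a"
    and "gmult G b a = gmult G c a"
  shows "b = c"
proof -
  have "(b, a) \<in> comps G" "(c, a) \<in> comps G" using assms by (auto simp: comps_iff)
  then show ?thesis using inv_right assms(6) by metis
qed

lemma inv_unique:
  assumes "a \<in> arrows G" "b \<in> arrows G" "src G a = rng G b" "gmult G a b = rng G a"
  shows "b = ginv G a"
proof (rule mult_left_cancel[of a])
  show "gmult G a b = gmult G a (ginv G a)" using assms(4) by (simp add: rng_def)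
qed (use assms in auto)

lemma inv_mult:
  assumes "a \<in> arrows G" "b \<in> arrows G" "src G a = rng G b"
  shows "ginv G (gmult G a b) = gmult G (ginv G b) (ginv G a)"
proof (rule inv_unique[symmetric])
  have "gmult G (gmult G a b) (gmult G (ginv G b) (ginv G a)) =
    gmult G a (gmult G b (gmult G (ginv G b) (ginv G a)))"
    using assms by (intro assoc) auto
  then show "gmult G (gmult G a b) (gmult G (ginv G b) (ginv G a)) = rng G (gmult G a b)"
    using assms by (simp add: rng_def[of G a])
qed (use assms in auto)

lemma units_iff_rng: "x \<in> units G \<longleftrightarrow> x \<in> arrows G \<and> rng G x = x"
proof
  assume "x \<in> units G"
  then show "x \<in> arrows G \<and> rng G x = x" unfolding units_def by auto
next
  assume h: "x \<in> arrows G \<and> rng G x = x"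
  then have "src G x = x" using src_rng by metis
  then show "x \<in> units G" unfolding units_def using h by force
qed

lemma units_src: "x \<in> units G \<Longrightarrow> src G x = x"
  using units_iff_rng src_rng by metis

lemma units_rng: "x \<in> units G \<Longrightarrow> rng G x = x"
  using units_iff_rng by simp

lemma units_arrow: "x \<in> units G \<Longrightarrow> x \<in> arrows G"
  using units_iff_rng by simp

lemma rng_units [simp]: "a \<in> arrows G \<Longrightarrow> rng G a \<in> units G"
  using src_inv[of a] unfolding units_def by (metis image_eqI inv_arrow)

lemma src_units [simp]: "a \<in> arrows G \<Longrightarrow> src G a \<in> units G"
  unfolding units_def by auto

lemma units_inv:
  assumes "x \<in> units G" shows "ginv G x = x"
  by (metis assms inv_unique mult_rng units_arrow units_rng units_src)

lemma inv_mult_unit_imp_eq: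
  assumes "a \<in> arrows G" "b \<in> arrows G" "rng G a = rng G b" "gmult G (ginv G a) b \<in> units G"
  shows "a = b"
proof -
  have "gmult G (ginv G a) b = src G a"
    using assms units_rng[OF assms(4)] by simp
  then have "gmult G a (src G a) = b" using assms by (metis mult_inv_cancel)
  then show ?thesis using assms by simp
qed

end

lemma groupoid_hom_units:
  assumes G: "groupoid G" and H: "groupoid H" and f: "groupoid_hom G H f" and a: "a \<in> arrows G"
  shows groupoid_hom_inv: "f (ginv G a) = ginv H (f a)"
    and groupoid_hom_rng: "f (rng G a) = rng H (f a)"
    and groupoid_hom_src: "f (src G a) = src H (f a)"
proof -
  interpret G: groupoid G by (rule G)
  interpret H: groupoid H by (rule H)
  have hom: "(f x, f y) \<in> comps H \<and> f (gmult G x y) = gmult H (f x) (f y)" if "(x, y) \<in> comps G" for x y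
    using f that unfolding groupoid_hom_def by auto
  have arr: "f x \<in> arrows H" if "x \<in> arrows G" for x
    using f that unfolding groupoid_hom_def by auto
  \<comment> \<open>A unit is idempotent, and an idempotent of a groupoid is a unit.\<close>
  have r: "f (rng G x) = rng H (f x)" if x: "x \<in> arrows G" for x
    using hom[OF G.comps_rng[OF x]] arr x
    by (metis G.mult_rng G.rng_arrow H.comps_iff H.mult_right_cancel H.mult_rng H.rng_arrow H.src_rng)
  show "f (rng G a) = rng H (f a)" using r a .
  show i: "f (ginv G a) = ginv H (f a)"
    using hom[OF G.comps_inv[OF a]] arr a r[OF a]
    by (intro H.inv_unique) (auto simp: H.comps_iff rng_def)
  show "f (src G a) = src H (f a)"
    using r[of "ginv G a"] a i arr by simp
qed

section \<open>Topological and etale groupoids\<close>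

context topological_groupoid
begin

lemma continuous_mult_compose:
  assumes "continuous_map X (gtop G) f" "continuous_map X (gtop G) g"
    and "\<And>x. x \<in> topspace X \<Longrightarrow> src G (f x) = rng G (g x)"
  shows "continuous_map X (gtop G) (\<lambda>x. gmult G (f x) (g x))"
proof -
  have "continuous_map X (subtopology (prod_topology (gtop G) (gtop G)) (comps G)) (\<lambda>x. (f x, g x))"
    unfolding continuous_map_in_subtopology
  proof
    show "continuous_map X (prod_topology (gtop G) (gtop G)) (\<lambda>x. (f x, g x))"
      using assms by (simp add: continuous_map_pairedI)
    show "(\<lambda>x. (f x, g x)) \<in> topspace X \<rightarrow> comps G"
      using assms(3) continuous_map_funspace[OF assms(1)] continuous_map_funspace[OF assms(2)]
      by (auto simp: comps_iff arrows_def)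
  qed
  from continuous_map_compose[OF this continuous_mult] show ?thesis
    by (simp add: o_def)
qed

lemma continuous_rng: "continuous_map (gtop G) (gtop G) (rng G)"
proof -
  have "continuous_map (gtop G) (gtop G) (\<lambda>x. gmult G (id x) (ginv G x))"
    by (rule continuous_mult_compose[OF continuous_map_id continuous_inv]) (simp add: arrows_def[symmetric])
  then show ?thesis by (simp add: rng_def[abs_def])
qed

lemma continuous_src: "continuous_map (gtop G) (gtop G) (src G)"
proof -
  have "continuous_map (gtop G) (gtop G) (\<lambda>x. gmult G (ginv G x) (id x))"
    by (rule continuous_mult_compose[OF continuous_inv continuous_map_id]) (simp add: arrows_def[symmetric])
  then show ?thesis by (simp add: src_def[abs_def])
qed

lemma continuous_rng_unit_top: "continuous_map (gtop G) (unit_top G) (rng G)"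
  unfolding unit_top_def
  by (auto simp: continuous_map_in_subtopology continuous_rng arrows_def[symmetric])

lemma continuous_src_unit_top: "continuous_map (gtop G) (unit_top G) (src G)"
  unfolding unit_top_def
  by (auto simp: continuous_map_in_subtopology continuous_src arrows_def[symmetric])

lemma units_subset_arrows: "units G \<subseteq> arrows G"
  using units_arrow by auto

lemma topspace_unit_top: "topspace (unit_top G) = units G"
  using units_subset_arrows unfolding unit_top_def arrows_def by auto

end

lemma inj_on_open_map_open_homeo_on:
  assumes "continuous_map X Y f" "open_map X Y f" "openin X W" "inj_on f W"
  shows "open_homeo_on X Y f W"
  unfolding open_homeo_on_def
proof (intro conjI)
  show fW: "openin Y (f ` W)" using assms unfolding open_map_def by auto
  have W: "W \<subseteq> topspace X" using assms(3) openin_subset by auto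
  have fW': "f ` W \<subseteq> topspace Y" using fW openin_subset by auto
  show "homeomorphic_map (subtopology X W) (subtopology Y (f ` W)) f"
  proof (rule bijective_open_imp_homeomorphic_map)
    show "continuous_map (subtopology X W) (subtopology Y (f ` W)) f"
      using assms(1) by (auto simp: continuous_map_in_subtopology continuous_map_from_subtopology)
    show "open_map (subtopology X W) (subtopology Y (f ` W)) f"
      unfolding open_map_def
    proof (intro allI impI)
      fix U assume U: "openin (subtopology X W) U"
      then have UW: "openin X U \<and> U \<subseteq> W"
        using assms(3) by (simp add: openin_open_subtopology)
      then show "openin (subtopology Y (f ` W)) (f ` U)"
        using assms(2) fW UW by (simp add: openin_open_subtopology open_map_def image_mono)
    qed
    show "f ` topspace (subtopology X W) = topspace (subtopology Y (f ` W))"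
      using W fW' by auto
    show "inj_on f (topspace (subtopology X W))" using W assms(4) by (simp add: Int_absorb1)
  qed
qed (fact assms(3))

lemma local_homeomorphism_open_map:
  assumes "local_homeomorphism X Y f" shows "open_map X Y f"
  unfolding open_map_def
proof (intro allI impI)
  fix U assume U: "openin X U"
  show "openin Y (f ` U)"
  proof (subst openin_subopen, intro ballI)
    fix y assume "y \<in> f ` U"
    then obtain x where x: "x \<in> U" "y = f x" by auto
    then have "x \<in> topspace X" using U openin_subset by auto
    then obtain W where W: "x \<in> W" "open_homeo_on X Y f W"
      using assms unfolding local_homeomorphism_def by auto
    have "openin (subtopology X W) (U \<inter> W)" using U by (simp add: openin_subtopology_Int)
    then have "openin (subtopology Y (f ` W)) (f ` (U \<inter> W))"
      using W(2) unfolding open_homeo_on_def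
      by (meson homeomorphic_imp_open_map open_map_def)
    then have "openin Y (f ` (U \<inter> W))"
      using W(2) unfolding open_homeo_on_def by (meson openin_trans_full)
    then show "\<exists>T. openin Y T \<and> y \<in> T \<and> T \<subseteq> f ` U"
      using x W by blast
  qed
qed

section \<open>Algebra of a discrete twist\<close>

lemma runits_one [simp]: "1 \<in> runits"
  by (simp add: runits_def)

lemma runits_mult [simp]: "t \<in> runits \<Longrightarrow> u \<in> runits \<Longrightarrow> t * u \<in> runits"
  unfolding runits_def using mult_dvd_mono[of t 1 u 1] by simp

lemma rinv_right [simp]:
  fixes t :: "'r::comm_ring_1"
  assumes "t \<in> runits" shows "t * rinv t = 1"
proof -
  obtain u where u: "t * u = 1" using assms unfolding runits_def dvd_def by auto
  have "\<exists>!u. t * u = 1"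
  proof (rule ex1I[where a = u], rule u)
    fix v assume "t * v = 1"
    then have "u * (t * v) = u" by simp
    moreover have "u * (t * v) = (t * u) * v" by (simp add: ac_simps)
    ultimately show "v = u" using u by simp
  qed
  then show ?thesis unfolding rinv_def by (rule theI')
qed

lemma rinv_left [simp]: "t \<in> runits \<Longrightarrow> rinv t * t = 1"
  by (subst mult.commute) simp

lemma rinv_runits [simp]: "t \<in> runits \<Longrightarrow> rinv t \<in> runits"
  unfolding runits_def using rinv_left[of t] by (metis (mono_tags) dvdI mem_Collect_eq runits_def)

lemma rinv_unique: "t \<in> runits \<Longrightarrow> t * u = 1 \<Longrightarrow> rinv t = u"
  by (metis mult.left_commute mult.right_neutral rinv_right)

lemma rinv_rinv [simp]: "t \<in> runits \<Longrightarrow> rinv (rinv t) = t"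
  by (simp add: rinv_unique)

lemma rinv_one [simp]: "rinv 1 = 1"
  by (simp add: rinv_unique)

lemma rinv_mult: "t \<in> runits \<Longrightarrow> u \<in> runits \<Longrightarrow> rinv (t * u) = rinv t * rinv u"
proof (rule rinv_unique)
  assume tu: "t \<in> runits" "u \<in> runits"
  have "t * u * (rinv t * rinv u) = (t * rinv t) * (u * rinv u)" by (simp only: ac_simps)
  then show "t * u * (rinv t * rinv u) = 1" using tu by simp
qed auto

lemma rinv_mult_cancel [simp]:
  "t \<in> runits \<Longrightarrow> t * (rinv t * a) = a" "t \<in> runits \<Longrightarrow> rinv t * (t * a) = a"
  by (simp_all add: mult.assoc[symmetric])

lemma runits_mult_eq_0: "t \<in> runits \<Longrightarrow> t * a = 0 \<longleftrightarrow> a = 0"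
  using rinv_mult_cancel(2)[of t a] by fastforce

locale ample_twist = discrete_twist T for T :: "('r::comm_ring_1, 'g, 'a) twist" +
  assumes indecomposable: "indecomposable_ring TYPE('r)"
    and ample_base: "ample (base T)"
    and Hausdorff_base: "Hausdorff_space (gtop (base T))"

sublocale discrete_twist \<subseteq> S: topological_groupoid "tot T"
  by (rule tot_groupoid)

sublocale discrete_twist \<subseteq> G: topological_groupoid "base T"
  using base_etale unfolding etale_def by simp

context discrete_twist
begin

abbreviation S where "S \<equiv> tot T"
abbreviation G where "G \<equiv> base T"
abbreviation q where "q \<equiv> prj T"
abbreviation rr where "rr \<equiv> rng (tot T)"
abbreviation ss where "ss \<equiv> src (tot T)"
abbreviation iv where "iv \<equiv> ginv (tot T)"
abbreviation prod_S (infixl "\<odot>" 70) where "\<sigma> \<odot> \<tau> \<equiv> gmult (tot T) \<sigma> \<tau>"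
abbreviation act_S (infixr "\<rhd>" 75) where "t \<rhd> \<sigma> \<equiv> act T t \<sigma>"

lemma q_arrow [simp]: "\<sigma> \<in> arrows S \<Longrightarrow> q \<sigma> \<in> arrows G"
  using prj_hom unfolding groupoid_hom_def by auto

lemma q_inv [simp]: "\<sigma> \<in> arrows S \<Longrightarrow> q (iv \<sigma>) = ginv G (q \<sigma>)"
  by (rule groupoid_hom_inv[OF S.groupoid_axioms G.groupoid_axioms prj_hom])

lemma q_rng: "\<sigma> \<in> arrows S \<Longrightarrow> q (rr \<sigma>) = rng G (q \<sigma>)"
  by (rule groupoid_hom_rng[OF S.groupoid_axioms G.groupoid_axioms prj_hom])

lemma q_src: "\<sigma> \<in> arrows S \<Longrightarrow> q (ss \<sigma>) = src G (q \<sigma>)"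
  by (rule groupoid_hom_src[OF S.groupoid_axioms G.groupoid_axioms prj_hom])

lemma q_mult [simp]:
  "\<sigma> \<in> arrows S \<Longrightarrow> \<tau> \<in> arrows S \<Longrightarrow> ss \<sigma> = rr \<tau> \<Longrightarrow> q (\<sigma> \<odot> \<tau>) = gmult G (q \<sigma>) (q \<tau>)"
  using prj_hom S.comps_iff unfolding groupoid_hom_def by auto

lemma q_units: "x \<in> units S \<Longrightarrow> q x \<in> units G"
  by (metis G.rng_units S.units_arrow S.units_rng q_arrow q_rng)

lemma q_inj_units: "x \<in> units S \<Longrightarrow> y \<in> units S \<Longrightarrow> q x = q y \<Longrightarrow> x = y"
  using homeomorphic_imp_injective_map[OF prj_units] S.topspace_unit_top
  by (auto simp: inj_on_def)

lemma fibre_same_ends: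
  assumes "\<sigma> \<in> arrows S" "\<tau> \<in> arrows S" "q \<sigma> = q \<tau>"
  shows "rr \<sigma> = rr \<tau>" "ss \<sigma> = ss \<tau>"
  using assms by (auto intro!: q_inj_units simp: q_rng q_src)

lemma inc_in_fibre:
  assumes "u \<in> units G" "t \<in> runits"
  shows inc_arrow [simp]: "inc T (u, t) \<in> arrows S" and q_inc [simp]: "q (inc T (u, t)) = u"
  using DT1_exact[OF assms(1)] assms(2) unfolding fibre_def by auto

lemma inc_one_unit: "u \<in> units G \<Longrightarrow> inc T (u, 1) \<in> units S"
  using tot_units by auto

lemma inc_comps:
  assumes "u \<in> units G" "t \<in> runits" "t' \<in> runits"
  shows "(inc T (u, t), inc T (u, t')) \<in> comps S \<and> inc T (u, t) \<odot> inc T (u, t') = inc T (u, t * t')"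
proof -
  have "((u, t), (u, t')) \<in> comps (trivial_bundle G)"
    using assms unfolding trivial_bundle_def by auto
  moreover have "gmult (trivial_bundle G) (u, t) (u, t') = (u, t * t')"
    by (simp add: trivial_bundle_def)
  ultimately show ?thesis using inc_hom unfolding groupoid_hom_def by force
qed

lemma inc_rng_src [simp]:
  assumes "u \<in> units G" "t \<in> runits"
  shows "rr (inc T (u, t)) = inc T (u, 1)" "ss (inc T (u, t)) = inc T (u, 1)"
  using inc_comps[OF assms runits_one] inc_comps[OF assms(1) runits_one assms(2)]
    S.units_rng[OF inc_one_unit[OF assms(1)]] S.units_src[OF inc_one_unit[OF assms(1)]]
  unfolding S.comps_iff by auto

lemma inc_one_q [simp]: "x \<in> units S \<Longrightarrow> inc T (q x, 1) = x"
  by (intro q_inj_units inc_one_unit q_units) (auto simp: q_units)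

lemma act_ends:
  assumes "t \<in> runits" "\<sigma> \<in> arrows S"
  shows act_arrow [simp]: "t \<rhd> \<sigma> \<in> arrows S"
    and act_rng [simp]: "rr (t \<rhd> \<sigma>) = rr \<sigma>"
    and act_src [simp]: "ss (t \<rhd> \<sigma>) = ss \<sigma>"
    and q_act [simp]: "q (t \<rhd> \<sigma>) = q \<sigma>"
proof -
  have u: "q (rr \<sigma>) \<in> units G" using assms q_units by simp
  show "t \<rhd> \<sigma> \<in> arrows S" "rr (t \<rhd> \<sigma>) = rr \<sigma>" "ss (t \<rhd> \<sigma>) = ss \<sigma>"
    unfolding act_def using u assms by auto
  show "q (t \<rhd> \<sigma>) = q \<sigma>"
  proof -
    have "q (inc T (q (rr \<sigma>), t) \<odot> \<sigma>) = gmult G (q (rr \<sigma>)) (q \<sigma>)" using u assms by simp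
    also have "\<dots> = q \<sigma>" using assms by (simp add: q_rng)
    finally show ?thesis unfolding act_def .
  qed
qed

lemma act_one [simp]: "\<sigma> \<in> arrows S \<Longrightarrow> 1 \<rhd> \<sigma> = \<sigma>"
  unfolding act_def by simp

lemma act_act:
  assumes "t \<in> runits" "t' \<in> runits" "\<sigma> \<in> arrows S"
  shows "t \<rhd> t' \<rhd> \<sigma> = (t * t') \<rhd> \<sigma>"
proof -
  have u: "q (rr \<sigma>) \<in> units G" using assms q_units by simp
  have "t \<rhd> t' \<rhd> \<sigma> = inc T (q (rr \<sigma>), t) \<odot> (inc T (q (rr \<sigma>), t') \<odot> \<sigma>)"
    using act_rng[OF assms(2,3)] unfolding act_def by simp
  also have "\<dots> = (inc T (q (rr \<sigma>), t) \<odot> inc T (q (rr \<sigma>), t')) \<odot> \<sigma>"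
    using u assms by (intro S.assoc[symmetric]) auto
  finally show ?thesis using inc_comps[OF u assms(1,2)] unfolding act_def by simp
qed

lemma act_rinv [simp]:
  assumes "t \<in> runits" "\<sigma> \<in> arrows S"
  shows "t \<rhd> rinv t \<rhd> \<sigma> = \<sigma>" "rinv t \<rhd> t \<rhd> \<sigma> = \<sigma>"
  using assms by (auto simp: act_act)

lemma act_mult_left:
  assumes "t \<in> runits" "\<sigma> \<in> arrows S" "\<tau> \<in> arrows S" "ss \<sigma> = rr \<tau>"
  shows "(t \<rhd> \<sigma>) \<odot> \<tau> = t \<rhd> (\<sigma> \<odot> \<tau>)"
proof -
  have u: "q (rr \<sigma>) \<in> units G" using assms q_units by simp
  have "(inc T (q (rr \<sigma>), t) \<odot> \<sigma>) \<odot> \<tau> = inc T (q (rr \<sigma>), t) \<odot> (\<sigma> \<odot> \<tau>)"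
    using u assms by (intro S.assoc) auto
  then show ?thesis unfolding act_def using assms by simp
qed

lemma act_mult_right:
  assumes "t \<in> runits" "\<sigma> \<in> arrows S" "\<tau> \<in> arrows S" "ss \<sigma> = rr \<tau>"
  shows "\<sigma> \<odot> (t \<rhd> \<tau>) = t \<rhd> (\<sigma> \<odot> \<tau>)"
proof -
  have u: "q (rr \<tau>) \<in> units G" "q (ss \<sigma>) \<in> units G" using assms q_units by simp_all
  have "\<sigma> \<odot> (t \<rhd> \<tau>) = (\<sigma> \<odot> inc T (q (ss \<sigma>), t)) \<odot> \<tau>"
    unfolding act_def using u assms by (subst S.assoc) auto
  also have "\<dots> = (t \<rhd> \<sigma>) \<odot> \<tau>" using DT3[OF assms(2,1)] by simp
  finally show ?thesis using act_mult_left assms by simp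
qed

lemma inv_act:
  assumes "t \<in> runits" "\<sigma> \<in> arrows S"
  shows "iv (t \<rhd> \<sigma>) = rinv t \<rhd> iv \<sigma>"
proof (rule S.inv_unique[symmetric])
  have "(t \<rhd> \<sigma>) \<odot> (rinv t \<rhd> iv \<sigma>) = t \<rhd> rinv t \<rhd> (\<sigma> \<odot> iv \<sigma>)"
    using assms by (simp add: act_mult_left act_mult_right)
  then show "(t \<rhd> \<sigma>) \<odot> (rinv t \<rhd> iv \<sigma>) = rr (t \<rhd> \<sigma>)"
    using assms by (simp add: rng_def[of "tot T" \<sigma>])
qed (use assms in auto)

lemma act_free:
  assumes "t \<in> runits" "t' \<in> runits" "\<sigma> \<in> arrows S" "t \<rhd> \<sigma> = t' \<rhd> \<sigma>"
  shows "t = t'"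
proof -
  have u: "q (rr \<sigma>) \<in> units G" using assms q_units by simp
  have "inc T (q (rr \<sigma>), t) = inc T (q (rr \<sigma>), t')"
  proof (rule S.mult_right_cancel[of \<sigma>])
    show "inc T (q (rr \<sigma>), t) \<odot> \<sigma> = inc T (q (rr \<sigma>), t') \<odot> \<sigma>"
      using assms(4) unfolding act_def .
  qed (use u assms(1-3) in simp_all)
  then show ?thesis using DT1_inj u assms unfolding inj_on_def by blast
qed

text \<open>The fibres of \<open>q\<close> are the orbits: \<open>\<tau>\<sigma>\<^sup>-\<^sup>1\<close> lies over a unit, where (DT1) applies.\<close>

lemma act_transitive:
  assumes "\<sigma> \<in> arrows S" "\<tau> \<in> arrows S" "q \<sigma> = q \<tau>"
  obtains t where "t \<in> runits" "\<tau> = t \<rhd> \<sigma>"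
proof -
  have e: "rr \<tau> = rr \<sigma>" "ss \<tau> = ss \<sigma>" using fibre_same_ends[of \<tau> \<sigma>] assms by auto
  have u: "q (rr \<sigma>) \<in> units G" using assms q_units by simp
  have "q (\<tau> \<odot> iv \<sigma>) = gmult G (q \<sigma>) (ginv G (q \<sigma>))" using assms e by simp
  then have "q (\<tau> \<odot> iv \<sigma>) = q (rr \<sigma>)" using assms by (simp add: q_rng) (simp add: rng_def)
  then have "\<tau> \<odot> iv \<sigma> \<in> fibre T {q (rr \<sigma>)}" using assms e unfolding fibre_def by simp
  then obtain t where t: "t \<in> runits" "\<tau> \<odot> iv \<sigma> = inc T (q (rr \<sigma>), t)"
    using DT1_exact[OF u] by auto
  have "t \<rhd> \<sigma> = (\<tau> \<odot> iv \<sigma>) \<odot> \<sigma>" using t unfolding act_def by simp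
  also have "\<dots> = \<tau> \<odot> (iv \<sigma> \<odot> \<sigma>)" using assms e by (intro S.assoc) auto
  also have "\<dots> = \<tau>" using e(2) assms S.mult_src[of \<tau>] by (simp add: src_def)
  finally show ?thesis using that t by simp
qed

lemma q_unit_iff_act_unit:
  assumes "\<sigma> \<in> arrows S" "q \<sigma> \<in> units G"
  obtains t where "t \<in> runits" "\<sigma> = t \<rhd> rr \<sigma>"
proof -
  have "q (rr \<sigma>) = q \<sigma>" using assms by (simp add: q_rng G.units_rng)
  then show ?thesis using act_transitive[of "rr \<sigma>" \<sigma>] assms that by auto
qed

lemma inv_mult_over_unit:
  assumes "\<sigma> \<in> arrows S" "\<tau> \<in> arrows S" "rr \<sigma> = rr \<tau>" "q (iv \<sigma> \<odot> \<tau>) \<in> units G"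
  shows "q \<sigma> = q \<tau>"
proof (rule G.inv_mult_unit_imp_eq)
  show "gmult G (ginv G (q \<sigma>)) (q \<tau>) \<in> units G" using assms by simp
  show "rng G (q \<sigma>) = rng G (q \<tau>)" using assms by (metis q_rng)
qed (use assms in auto)

end

section \<open>Topology of a twist over an ample Hausdorff groupoid\<close>

lemma open_homeo_on_inj_on: "open_homeo_on X Y f W \<Longrightarrow> inj_on f W"
  unfolding open_homeo_on_def
  by (metis Int_absorb1 homeomorphic_imp_injective_map openin_subset topspace_subtopology)

lemma bisection_inj_on:
  assumes "bisection H D"
  shows bisection_inj_on_rng: "inj_on (rng H) D" and bisection_inj_on_src: "inj_on (src H) D"
  using assms open_homeo_on_inj_on unfolding bisection_def by (metis inj_on_subset)+

context discrete_twist
begin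

lemma openin_S_subset: "openin (gtop S) W \<Longrightarrow> \<sigma> \<in> W \<Longrightarrow> \<sigma> \<in> arrows S"
  unfolding arrows_def using openin_subset by auto

lemma open_map_rng_G: "open_map (gtop G) (unit_top G) (rng G)"
  using base_etale local_homeomorphism_open_map unfolding etale_def by auto

text \<open>
  A local trivialisation of the twist at \<open>q \<sigma>\<close>, restricted to the unit of the ring for which its
  value at \<open>q \<sigma>\<close> is \<open>\<sigma>\<close>; it is open because \<open>R\<^sup>\<times>\<close> is discrete.
\<close>

lemma open_local_section:
  assumes \<sigma>: "\<sigma> \<in> arrows S"
  obtains D c where "q \<sigma> \<in> D" "openin (gtop G) D" "bisection G D" "c (q \<sigma>) = \<sigma>"
    and "continuous_map (subtopology (gtop G) D) (gtop S) c"
    and "open_map (subtopology (gtop G) D) (gtop S) c"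
    and "\<forall>\<beta>\<in>D. q (c \<beta>) = \<beta>"
proof -
  obtain D P where D: "q \<sigma> \<in> D" "openin (gtop G) D" "bisection G D"
    and P: "continuous_map (subtopology (gtop G) D) (gtop S) P" "\<forall>\<beta>\<in>D. q (P \<beta>) = \<beta>"
    and h: "homeomorphic_map (prod_topology (subtopology (gtop G) D) (discrete_topology runits))
        (subtopology (gtop S) (fibre T D)) (\<lambda>(\<beta>, t). inc T (rng G \<beta>, t) \<odot> P \<beta>)"
      (is "homeomorphic_map ?X ?Y ?h")
    using DT2[OF q_arrow[OF \<sigma>]] by auto
  have D_arr: "D \<subseteq> topspace (gtop G)" using D(2) openin_subset by auto
  have P_arr: "P \<beta> \<in> arrows S" if "\<beta> \<in> D" for \<beta>
    using continuous_map_funspace[OF P(1)] that D_arr unfolding arrows_def by auto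
  have h_act: "?h (\<beta>, t) = t \<rhd> P \<beta>" if "\<beta> \<in> D" for \<beta> t
    using P(2) that P_arr[OF that] by (simp add: act_def q_rng)
  have fibre_sub: "fibre T D \<subseteq> topspace (gtop S)" unfolding fibre_def arrows_def by auto
  have "fibre T D = {\<sigma> \<in> topspace (gtop S). q \<sigma> \<in> D}" unfolding fibre_def arrows_def by simp
  then have fibre_open: "openin (gtop S) (fibre T D)"
    using D(2) prj_continuous unfolding continuous_map_def by auto
  have "\<sigma> \<in> ?h ` topspace ?X"
    using homeomorphic_imp_surjective_map[OF h] fibre_sub D(1) \<sigma> unfolding fibre_def by auto
  then obtain \<beta> t where \<beta>: "\<beta> \<in> D" "t \<in> runits" "\<sigma> = ?h (\<beta>, t)" by auto
  have t: "q (t \<rhd> P \<beta>') = \<beta>'" if "\<beta>' \<in> D" for \<beta>'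
    using that P(2) P_arr \<beta>(2) by simp
  have \<sigma>_eq: "\<sigma> = t \<rhd> P \<beta>" using \<beta>(3) h_act[OF \<beta>(1)] by (rule trans)
  then have "\<beta> = q \<sigma>" using t \<beta>(1) by simp
  let ?c = "\<lambda>\<beta>. ?h (\<beta>, t)"
  have cont: "continuous_map (subtopology (gtop G) D) (gtop S) ?c"
  proof -
    have "continuous_map (subtopology (gtop G) D) ?X (\<lambda>\<beta>. (\<beta>, t))"
      using \<beta>(2) by (intro continuous_map_pairedI) auto
    from continuous_map_compose[OF this homeomorphic_imp_continuous_map[OF h]]
    show ?thesis by (simp add: o_def continuous_map_in_subtopology)
  qed
  have op: "open_map (subtopology (gtop G) D) (gtop S) ?c"
    unfolding open_map_def
  proof (intro allI impI)
    fix U assume U: "openin (subtopology (gtop G) D) U"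
    have "openin ?X (U \<times> {t})"
      using U \<beta>(2) by (simp add: openin_prod_Times_iff)
    then have a: "openin ?Y (?h ` (U \<times> {t}))"
      using homeomorphic_imp_open_map[OF h] unfolding open_map_def by blast
    have "?h ` (U \<times> {t}) = ?c ` U" by force
    then show "openin (gtop S) (?c ` U)"
      using openin_trans_full[OF a fibre_open] by (rule subst)
  qed
  show ?thesis
  proof (rule that[OF D _ cont op])
    have "?c \<beta> = \<sigma>" using \<beta>(3) by (rule sym)
    then show "?c (q \<sigma>) = \<sigma>" by (simp only: \<open>\<beta> = q \<sigma>\<close>)
    show "\<forall>\<beta>\<in>D. q (?c \<beta>) = \<beta>"
    proof
      fix \<beta> assume "\<beta> \<in> D"
      then show "q (?c \<beta>) = \<beta>" using t unfolding h_act[OF \<open>\<beta> \<in> D\<close>] by blast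
    qed
  qed
qed

lemma open_map_q: "open_map (gtop S) (gtop G) q"
  unfolding open_map_def
proof (intro allI impI)
  fix W assume W: "openin (gtop S) W"
  show "openin (gtop G) (q ` W)"
  proof (subst openin_subopen, intro ballI)
    fix \<alpha> assume "\<alpha> \<in> q ` W"
    then obtain \<sigma> where \<sigma>: "\<sigma> \<in> W" "\<alpha> = q \<sigma>" by auto
    then have "\<sigma> \<in> arrows S" using W openin_S_subset by auto
    then obtain D c where D: "q \<sigma> \<in> D" "openin (gtop G) D" "bisection G D" "c (q \<sigma>) = \<sigma>"
      "continuous_map (subtopology (gtop G) D) (gtop S) c"
      "open_map (subtopology (gtop G) D) (gtop S) c" "\<forall>\<beta>\<in>D. q (c \<beta>) = \<beta>"
      by (rule open_local_section)
    let ?E = "{\<beta> \<in> topspace (subtopology (gtop G) D). c \<beta> \<in> W}"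
    have DG: "D \<subseteq> topspace (gtop G)" using D(2) openin_subset by auto
    have "openin (subtopology (gtop G) D) ?E"
      using D(5) W by (rule openin_continuous_map_preimage)
    then have "openin (gtop G) ?E" using D(2) openin_trans_full by blast
    moreover have "\<alpha> \<in> ?E" using \<sigma> D DG by auto
    moreover have "?E \<subseteq> q ` W" using D(7) by (auto intro: rev_image_eqI)
    ultimately show "\<exists>E. openin (gtop G) E \<and> \<alpha> \<in> E \<and> E \<subseteq> q ` W" by blast
  qed
qed

lemma open_map_rng: "open_map (gtop S) (unit_top S) rr"
  unfolding open_map_def
proof (intro allI impI)
  fix W assume W: "openin (gtop S) W"
  have arr: "\<sigma> \<in> arrows S" if "\<sigma> \<in> W" for \<sigma> using W that openin_S_subset by auto
  have "openin (unit_top G) (rng G ` q ` W)"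
    using W open_map_q open_map_rng_G unfolding open_map_def by auto
  then have "openin (unit_top S) {x \<in> topspace (unit_top S). q x \<in> rng G ` q ` W}"
    using homeomorphic_imp_continuous_map[OF prj_units] openin_continuous_map_preimage by fast
  also have "{x \<in> topspace (unit_top S). q x \<in> rng G ` q ` W} = rr ` W"
  proof (intro equalityI subsetI)
    fix x assume "x \<in> {x \<in> topspace (unit_top S). q x \<in> rng G ` q ` W}"
    then obtain \<sigma> where "x \<in> units S" "\<sigma> \<in> W" "q x = q (rr \<sigma>)"
      using arr S.topspace_unit_top by (auto simp: q_rng)
    then show "x \<in> rr ` W" using q_inj_units[of x "rr \<sigma>"] arr by auto
  next
    fix x assume "x \<in> rr ` W"
    then show "x \<in> {x \<in> topspace (unit_top S). q x \<in> rng G ` q ` W}"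
      using arr S.topspace_unit_top by (auto simp: q_rng)
  qed
  finally show "openin (unit_top S) (rr ` W)" .
qed

lemma open_map_src: "open_map (gtop S) (unit_top S) ss"
  unfolding open_map_def
proof (intro allI impI)
  fix W assume W: "openin (gtop S) W"
  have arr: "\<sigma> \<in> arrows S" if "\<sigma> \<in> W" for \<sigma> using W that openin_S_subset by auto
  have "openin (gtop S) {\<sigma> \<in> topspace (gtop S). iv \<sigma> \<in> W}"
    using S.continuous_inv W by (rule openin_continuous_map_preimage)
  then have "openin (unit_top S) (rr ` {\<sigma> \<in> topspace (gtop S). iv \<sigma> \<in> W})"
    using open_map_rng unfolding open_map_def by blast
  also have "rr ` {\<sigma> \<in> topspace (gtop S). iv \<sigma> \<in> W} = ss ` W"
    unfolding arrows_def[symmetric]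
  proof (intro equalityI subsetI)
    fix x assume "x \<in> rr ` {\<sigma> \<in> arrows S. iv \<sigma> \<in> W}"
    then obtain \<sigma> where "\<sigma> \<in> arrows S" "iv \<sigma> \<in> W" "x = rr \<sigma>" by auto
    then show "x \<in> ss ` W" by (intro image_eqI[of _ _ "iv \<sigma>"]) auto
  next
    fix x assume "x \<in> ss ` W"
    then obtain \<sigma> where "\<sigma> \<in> W" "x = ss \<sigma>" by auto
    then show "x \<in> rr ` {\<sigma> \<in> arrows S. iv \<sigma> \<in> W}"
      using arr[of \<sigma>] by (intro image_eqI[of _ _ "iv \<sigma>"]) auto
  qed
  finally show "openin (unit_top S) (ss ` W)" .
qed

lemma bisectionI:
  assumes "openin (gtop S) W" "inj_on rr W" "inj_on ss W"
  shows "bisection S W"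
  unfolding bisection_def
  using assms inj_on_open_map_open_homeo_on[OF S.continuous_rng_unit_top open_map_rng]
    inj_on_open_map_open_homeo_on[OF S.continuous_src_unit_top open_map_src] by blast

lemma bisection_q_eq:
  assumes "bisection S X" "\<sigma> \<in> X" "\<tau> \<in> X" "X \<subseteq> arrows S" "q \<sigma> = q \<tau>"
  shows "\<sigma> = \<tau>"
  using assms bisection_inj_on_rng[OF assms(1)] fibre_same_ends(1)[of \<sigma> \<tau>] by (auto simp: inj_on_def)

lemma continuous_act:
  assumes t: "t \<in> runits"
  shows "continuous_map (gtop S) (gtop S) (act T t)"
proof -
  have "continuous_map (gtop S) (unit_top G) (\<lambda>\<sigma>. q (rr \<sigma>))"
    using continuous_map_compose[OF S.continuous_rng_unit_top homeomorphic_imp_continuous_map[OF prj_units]]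
    by (simp add: o_def)
  then have "continuous_map (gtop S) (prod_topology (unit_top G) (discrete_topology runits)) (\<lambda>\<sigma>. (q (rr \<sigma>), t))"
    using t by (intro continuous_map_pairedI) auto
  then have "continuous_map (gtop S) (gtop (trivial_bundle G)) (\<lambda>\<sigma>. (q (rr \<sigma>), t))"
    by (simp add: trivial_bundle_def)
  from continuous_map_compose[OF this inc_continuous]
  have "continuous_map (gtop S) (gtop S) (\<lambda>\<sigma>. inc T (q (rr \<sigma>), t))" by (simp add: o_def)
  then have "continuous_map (gtop S) (gtop S) (\<lambda>\<sigma>. inc T (q (rr \<sigma>), t) \<odot> id \<sigma>)"
    by (rule S.continuous_mult_compose[OF _ continuous_map_id])
      (use t in \<open>auto simp: arrows_def[symmetric] q_units\<close>)
  then show ?thesis by (simp add: act_def[abs_def])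
qed

lemma openin_act_image:
  assumes t: "t \<in> runits" and W: "openin (gtop S) W"
  shows "openin (gtop S) (act T t ` W)"
proof -
  have "openin (gtop S) {\<sigma> \<in> topspace (gtop S). rinv t \<rhd> \<sigma> \<in> W}"
    using continuous_act[OF rinv_runits[OF t]] W by (rule openin_continuous_map_preimage)
  also have "{\<sigma> \<in> topspace (gtop S). rinv t \<rhd> \<sigma> \<in> W} = act T t ` W"
  proof (intro equalityI subsetI)
    fix \<sigma> assume "\<sigma> \<in> {\<sigma> \<in> topspace (gtop S). rinv t \<rhd> \<sigma> \<in> W}"
    then show "\<sigma> \<in> act T t ` W"
      using t by (intro image_eqI[of _ _ "rinv t \<rhd> \<sigma>"]) (auto simp: arrows_def[symmetric])
  next
    fix \<sigma> assume "\<sigma> \<in> act T t ` W"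
    then show "\<sigma> \<in> {\<sigma> \<in> topspace (gtop S). rinv t \<rhd> \<sigma> \<in> W}"
      using t W openin_S_subset by (auto simp: arrows_def[symmetric])
  qed
  finally show ?thesis .
qed

text \<open>An open set on which the range map is injective contains at most one arrow with a given range.\<close>

lemma finite_compact_row:
  assumes "compactin (gtop G) K"
  shows "finite {\<alpha> \<in> K. rng G \<alpha> = u}"
proof -
  let ?W = "{W. open_homeo_on (gtop G) (unit_top G) (rng G) W}"
  have "\<forall>W\<in>?W. openin (gtop G) W" unfolding open_homeo_on_def by auto
  moreover have "K \<subseteq> \<Union>?W"
    using compactin_subset_topspace[OF assms] base_etale
    unfolding etale_def local_homeomorphism_def by auto
  ultimately obtain F where F: "finite F" "F \<subseteq> ?W" "K \<subseteq> \<Union>F"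
    using assms unfolding compactin_def by meson
  have "finite {\<alpha> \<in> W. rng G \<alpha> = u}" if "W \<in> F" for W
  proof -
    have "inj_on (rng G) W" using F(2) that by (auto intro: open_homeo_on_inj_on)
    then have "inj_on (rng G) {\<alpha> \<in> W. rng G \<alpha> = u}" by (rule inj_on_subset) auto
    moreover have "finite (rng G ` {\<alpha> \<in> W. rng G \<alpha> = u})"
      by (rule finite_subset[of _ "{u}"]) auto
    ultimately show ?thesis by (rule finite_imageD[rotated])
  qed
  then have "finite (\<Union>W\<in>F. {\<alpha> \<in> W. rng G \<alpha> = u})" using F(1) by auto
  then show ?thesis by (rule finite_subset[rotated]) (use F(3) in auto)
qed

lemma compactin_q_units:
  assumes "K \<subseteq> units S"
  shows "compactin (unit_top S) K \<longleftrightarrow> compactin (unit_top G) (q ` K)"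
  using homeomorphic_map_compactness[OF prj_units, of K] assms S.topspace_unit_top by simp

end

context ample_twist
begin

text \<open>Open local sections carry small compact open bisections of the base to the total groupoid.\<close>

lemma compact_open_bisection_basis:
  assumes W: "openin (gtop S) W" and \<sigma>W: "\<sigma> \<in> W"
  obtains X where "compact_open_bisection S X" "\<sigma> \<in> X" "X \<subseteq> W"
proof -
  have \<sigma>: "\<sigma> \<in> arrows S" using assms openin_S_subset by auto
  obtain D c where D: "q \<sigma> \<in> D" "openin (gtop G) D" "bisection G D" "c (q \<sigma>) = \<sigma>"
    and cont: "continuous_map (subtopology (gtop G) D) (gtop S) c"
    and op: "open_map (subtopology (gtop G) D) (gtop S) c"
    and qc: "\<forall>\<beta>\<in>D. q (c \<beta>) = \<beta>"
    by (rule open_local_section[OF \<sigma>])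
  have DG: "D \<subseteq> topspace (gtop G)" using D(2) openin_subset by auto
  have c_arr: "c \<beta> \<in> arrows S" if "\<beta> \<in> D" for \<beta>
    using continuous_map_funspace[OF cont] that DG unfolding arrows_def by auto
  let ?E = "{\<beta> \<in> topspace (subtopology (gtop G) D). c \<beta> \<in> W}"
  have "openin (subtopology (gtop G) D) ?E"
    using cont W by (rule openin_continuous_map_preimage)
  then have "openin (gtop G) ?E" using D(2) openin_trans_full by blast
  moreover have "q \<sigma> \<in> ?E" using \<sigma>W D DG by auto
  ultimately obtain C where C: "compact_open_bisection G C" "q \<sigma> \<in> C" "C \<subseteq> ?E"
    using ample_base unfolding ample_def by meson
  have CD: "C \<subseteq> D" using C(3) by auto
  have C': "bisection G C" "openin (gtop G) C" "compactin (gtop G) C"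
    using C(1) unfolding compact_open_bisection_def by auto
  let ?X = "c ` C"
  have "openin (subtopology (gtop G) D) C"
    using C'(2) CD by (simp add: D(2) openin_open_subtopology)
  then have X_open: "openin (gtop S) ?X" using op unfolding open_map_def by blast
  have "compactin (subtopology (gtop G) D) C" using C'(3) CD by (simp add: compactin_subtopology)
  then have X_compact: "compactin (gtop S) ?X" using image_compactin cont by blast
  have ends: "q (rr (c \<beta>)) = rng G \<beta>" "q (ss (c \<beta>)) = src G \<beta>" if "\<beta> \<in> C" for \<beta>
    using that c_arr qc CD by (auto simp: q_rng q_src)
  have "inj_on (rr \<circ> c) C"
  proof (rule inj_onI)
    fix \<beta> \<gamma> assume h: "\<beta> \<in> C" "\<gamma> \<in> C" "(rr \<circ> c) \<beta> = (rr \<circ> c) \<gamma>"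
    then have "rng G \<beta> = rng G \<gamma>" using ends(1)[OF h(1)] ends(1)[OF h(2)] by simp
    then show "\<beta> = \<gamma>" by (rule inj_onD[OF bisection_inj_on_rng[OF C'(1)] _ h(1,2)])
  qed
  then have "inj_on rr ?X" by (rule inj_on_imageI)
  moreover have "inj_on (ss \<circ> c) C"
  proof (rule inj_onI)
    fix \<beta> \<gamma> assume h: "\<beta> \<in> C" "\<gamma> \<in> C" "(ss \<circ> c) \<beta> = (ss \<circ> c) \<gamma>"
    then have "src G \<beta> = src G \<gamma>" using ends(2)[OF h(1)] ends(2)[OF h(2)] by simp
    then show "\<beta> = \<gamma>" by (rule inj_onD[OF bisection_inj_on_src[OF C'(1)] _ h(1,2)])
  qed
  then have "inj_on ss ?X" by (rule inj_on_imageI)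
  ultimately have "bisection S ?X" using X_open bisectionI by auto
  then have "compact_open_bisection S ?X"
    unfolding compact_open_bisection_def using X_open X_compact by auto
  moreover have "\<sigma> \<in> ?X" using C(2) D(4) by force
  moreover have "?X \<subseteq> W" using C(3) by auto
  ultimately show ?thesis by (rule that)
qed

lemma compact_open_bisectionD:
  assumes "compact_open_bisection S X"
  shows "bisection S X" "openin (gtop S) X" "compactin (gtop S) X" "X \<subseteq> arrows S"
    and "inj_on rr X" "inj_on ss X"
  using assms bisection_inj_on[of S X] openin_subset[of "gtop S" X]
  unfolding compact_open_bisection_def arrows_def by auto

text \<open>
  On a bisection \<open>X\<close> around a unit, an arrow whose range also lies in \<open>X\<close> has the same range as
  its own range, hence equals it.
\<close>

lemma openin_units: "openin (gtop S) (units S)"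
proof (subst openin_subopen, intro ballI)
  fix x assume x: "x \<in> units S"
  then have "openin (gtop S) (topspace (gtop S))" "x \<in> topspace (gtop S)"
    using S.units_arrow by (auto simp: arrows_def)
  then obtain X where X: "compact_open_bisection S X" "x \<in> X"
    by (rule compact_open_bisection_basis)
  note XD = compact_open_bisectionD[OF X(1)]
  let ?W = "X \<inter> {\<sigma> \<in> topspace (gtop S). rr \<sigma> \<in> X}"
  have "openin (gtop S) ?W"
    using XD(2) openin_continuous_map_preimage[OF S.continuous_rng XD(2)] by (rule openin_Int)
  moreover have "x \<in> ?W" using X x S.units_rng S.units_arrow by (auto simp: arrows_def)
  moreover have "?W \<subseteq> units S"
  proof
    fix \<sigma> assume \<sigma>: "\<sigma> \<in> ?W"
    then have "\<sigma> \<in> arrows S" using XD by auto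
    moreover have "rr \<sigma> = \<sigma>"
      by (rule inj_onD[OF XD(5)]) (use \<sigma> \<open>\<sigma> \<in> arrows S\<close> S.rng_units S.units_rng in auto)
    ultimately show "\<sigma> \<in> units S" using S.rng_units[of \<sigma>] by simp
  qed
  ultimately show "\<exists>W. openin (gtop S) W \<and> x \<in> W \<and> W \<subseteq> units S" by blast
qed

lemma openin_unit_top_iff: "openin (unit_top S) W \<longleftrightarrow> openin (gtop S) W \<and> W \<subseteq> units S"
  unfolding unit_top_def using openin_units by (simp add: openin_open_subtopology)

text \<open>The product is continuous and the composable pairs are closed, as the base is Hausdorff.\<close>

lemma compactin_product:
  assumes "compactin (gtop G) K" "compactin (gtop G) L"
  shows "compactin (gtop G) {gmult G a b | a b. a \<in> K \<and> b \<in> L \<and> src G a = rng G b}"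
proof -
  let ?P = "prod_topology (gtop G) (gtop G)"
  have KL: "compactin ?P (K \<times> L)" using assms by (simp add: compactin_Times)
  have sub: "K \<subseteq> arrows G" "L \<subseteq> arrows G"
    using assms compactin_subset_topspace unfolding arrows_def by auto
  have "closedin ?P {p \<in> topspace ?P. (src G \<circ> fst) p = (rng G \<circ> snd) p}"
    using continuous_map_compose[OF continuous_map_fst G.continuous_src]
      continuous_map_compose[OF continuous_map_snd G.continuous_rng]
    by (rule closedin_continuous_maps_eq[OF Hausdorff_base])
  also have "{p \<in> topspace ?P. (src G \<circ> fst) p = (rng G \<circ> snd) p} = comps G"
    using G.comps_arrows by (auto simp: G.comps_iff arrows_def[symmetric])
  finally have "compactin ?P (K \<times> L \<inter> comps G)"
    using KL by (metis Int_commute closed_Int_compactin)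
  then have "compactin (subtopology ?P (comps G)) (K \<times> L \<inter> comps G)"
    by (simp add: compactin_subtopology)
  then have "compactin (gtop G) ((\<lambda>(a, b). gmult G a b) ` (K \<times> L \<inter> comps G))"
    using G.continuous_mult by (rule image_compactin)
  also have "(\<lambda>(a, b). gmult G a b) ` (K \<times> L \<inter> comps G) =
      {gmult G a b | a b. a \<in> K \<and> b \<in> L \<and> src G a = rng G b}"
    using sub by (force simp: G.comps_iff image_def)
  finally show ?thesis .
qed

lemma compactin_rng_image:
  assumes "W \<subseteq> arrows S" "compactin (gtop G) (q ` W)"
  shows "compactin (unit_top S) (rr ` W)"
proof -
  have "compactin (unit_top G) (rng G ` q ` W)"
    using assms(2) G.continuous_rng_unit_top by (rule image_compactin)
  also have "rng G ` q ` W = q ` rr ` W"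
    unfolding image_image using assms(1) by (intro image_cong) (auto simp: q_rng)
  finally show ?thesis using assms(1) by (subst compactin_q_units) auto
qed

lemma closedin_unit_top: "compactin (unit_top S) K \<Longrightarrow> closedin (unit_top S) K"
  using S.Hausdorff_units compactin_imp_closedin by blast

end

section \<open>Functions in the twisted Steinberg algebra\<close>

lemma locally_constant_mapI:
  assumes "\<And>x. x \<in> topspace X \<Longrightarrow> \<exists>W. openin X W \<and> x \<in> W \<and> (\<forall>y\<in>W. f y = f x)"
  shows "locally_constant_map X f"
  using assms unfolding locally_constant_map_def by blast

lemma locally_constant_map_combine:
  assumes "locally_constant_map X f" "locally_constant_map X g"
  shows "locally_constant_map X (\<lambda>x. h (f x) (g x))"
proof (rule locally_constant_mapI)
  fix x assume x: "x \<in> topspace X"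
  obtain V where V: "openin X V" "x \<in> V" "\<forall>y\<in>V. f y = f x"
    using assms(1) x unfolding locally_constant_map_def by blast
  obtain W where W: "openin X W" "x \<in> W" "\<forall>y\<in>W. g y = g x"
    using assms(2) x unfolding locally_constant_map_def by blast
  have "h (f y) (g y) = h (f x) (g x)" if "y \<in> V \<inter> W" for y
  proof -
    have "f y = f x" "g y = g x" using V(3) W(3) that by blast+
    then show ?thesis by (rule arg_cong2)
  qed
  moreover have "openin X (V \<inter> W)" "x \<in> V \<inter> W" using V W by auto
  ultimately show "\<exists>W. openin X W \<and> x \<in> W \<and> (\<forall>y\<in>W. h (f y) (g y) = h (f x) (g x))" by blast
qed

lemma locally_constant_map_const: "locally_constant_map X (\<lambda>_. c)"
  unfolding locally_constant_map_def using openin_topspace by blast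

lemma openin_locally_constant_level:
  assumes "locally_constant_map X f" shows "openin X {x \<in> topspace X. f x \<in> C}"
proof (subst openin_subopen, intro ballI)
  fix x assume x: "x \<in> {x \<in> topspace X. f x \<in> C}"
  then obtain W where W: "openin X W" "x \<in> W" "\<forall>y\<in>W. f y = f x"
    using assms unfolding locally_constant_map_def by blast
  have "W \<subseteq> {x \<in> topspace X. f x \<in> C}"
  proof
    fix y assume y: "y \<in> W"
    then have "f y = f x" using W(3) by blast
    then show "y \<in> {x \<in> topspace X. f x \<in> C}" using x y openin_subset[OF W(1)] by auto
  qed
  then show "\<exists>W. openin X W \<and> x \<in> W \<and> W \<subseteq> {x \<in> topspace X. f x \<in> C}" using W by blast
qed

context discrete_twist
begin

abbreviation A where "A \<equiv> steinberg T"
abbreviation B where "B \<equiv> diagonal T"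
abbreviation prod_A (infixl "\<star>" 70) where "f \<star> g \<equiv> conv T f g"

text \<open>
  By equivariance, the convolution at an arrow with range \<open>x\<close> can be summed over any finite choice of
  lifts of base arrows that meets all fibres on which the first factor is nonzero.
\<close>

definition transversal :: "'a set \<Rightarrow> 'a \<Rightarrow> bool"
  where "transversal F x \<longleftrightarrow>
    finite F \<and> F \<subseteq> arrows S \<and> (\<forall>\<tau>\<in>F. rr \<tau> = x) \<and> inj_on q F"

definition covers :: "'a set \<Rightarrow> ('a \<Rightarrow> 'r) \<Rightarrow> 'a \<Rightarrow> bool"
  where "covers F f x \<longleftrightarrow> (\<forall>\<tau>\<in>arrows S. rr \<tau> = x \<and> f \<tau> \<noteq> 0 \<longrightarrow> q \<tau> \<in> q ` F)"

text \<open>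
  For an equivariant \<open>f\<close> this determines the restriction of \<open>f\<close> to the arrows with the range of \<open>\<sigma>\<close>:
  it is the matrix row with a single entry 1, in the column of \<open>\<sigma>\<close>.
\<close>

definition delta_at :: "('a \<Rightarrow> 'r) \<Rightarrow> 'a \<Rightarrow> bool"
  where "delta_at f \<sigma> \<longleftrightarrow>
    \<sigma> \<in> arrows S \<and> f \<sigma> = 1 \<and> (\<forall>\<tau>\<in>arrows S. rr \<tau> = rr \<sigma> \<and> f \<tau> \<noteq> 0 \<longrightarrow> q \<tau> = q \<sigma>)"

lemma delta_at_arrow: "delta_at f \<sigma> \<Longrightarrow> \<sigma> \<in> arrows S"
  and delta_at_one: "delta_at f \<sigma> \<Longrightarrow> f \<sigma> = 1"
  and delta_at_nonzero:
    "delta_at f \<sigma> \<Longrightarrow> \<tau> \<in> arrows S \<Longrightarrow> rr \<tau> = rr \<sigma> \<Longrightarrow> f \<tau> \<noteq> 0 \<Longrightarrow> q \<tau> = q \<sigma>"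
  unfolding delta_at_def by blast+

lemma A_off: "f \<in> A \<Longrightarrow> \<sigma> \<notin> arrows S \<Longrightarrow> f \<sigma> = 0"
  unfolding steinberg_def supp_def by auto

lemma A_nonzero_arrow: "f \<in> A \<Longrightarrow> f \<sigma> \<noteq> 0 \<Longrightarrow> \<sigma> \<in> arrows S"
  using A_off by blast

lemma A_supp: "f \<in> A \<Longrightarrow> supp f \<subseteq> arrows S"
  unfolding steinberg_def by auto

lemma A_act: "f \<in> A \<Longrightarrow> t \<in> runits \<Longrightarrow> \<sigma> \<in> arrows S \<Longrightarrow> f (t \<rhd> \<sigma>) = rinv t * f \<sigma>"
  unfolding steinberg_def by auto

lemma A_locally_constant: "f \<in> A \<Longrightarrow> locally_constant_map (gtop S) f"
  unfolding steinberg_def by auto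

lemma A_compact: "f \<in> A \<Longrightarrow> compactin (gtop G) (q ` supp f)"
  unfolding steinberg_def by auto

lemma A_ext:
  assumes "f \<in> A" "g \<in> A" "\<And>\<sigma>. \<sigma> \<in> arrows S \<Longrightarrow> f \<sigma> = g \<sigma>"
  shows "f = g"
  by (rule ext) (metis A_off assms)

lemma A_zero_fibre:
  assumes "f \<in> A" "\<sigma> \<in> arrows S" "\<tau> \<in> arrows S" "q \<sigma> = q \<tau>"
  shows "f \<sigma> = 0 \<longleftrightarrow> f \<tau> = 0"
proof -
  obtain t where t: "t \<in> runits" "\<tau> = t \<rhd> \<sigma>" using act_transitive assms by metis
  then show ?thesis using A_act[OF assms(1) t(1) assms(2)] by (simp add: runits_mult_eq_0)
qed

lemma openin_supp:
  assumes "locally_constant_map (gtop S) f" "supp f \<subseteq> arrows S"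
  shows "openin (gtop S) (supp f)"
proof -
  have "supp f = {\<sigma> \<in> topspace (gtop S). f \<sigma> \<in> - {0}}"
    using assms(2) unfolding supp_def arrows_def by auto
  then show ?thesis using openin_locally_constant_level[OF assms(1), of "- {0}"] by simp
qed

text \<open>
  Membership in the algebra needs a compact set that merely contains the support: supports of
  locally constant equivariant functions are closed in the base, since \<open>q\<close> is an open map.
\<close>

lemma steinbergI:
  assumes sub: "supp f \<subseteq> arrows S"
    and lc: "locally_constant_map (gtop S) f"
    and eq: "\<And>t \<sigma>. t \<in> runits \<Longrightarrow> \<sigma> \<in> arrows S \<Longrightarrow> f (t \<rhd> \<sigma>) = rinv t * f \<sigma>"
    and K: "compactin (gtop G) K" "q ` supp f \<subseteq> K"
  shows "f \<in> A"
proof -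
  let ?Z = "{\<sigma> \<in> topspace (gtop S). f \<sigma> \<in> {0}}"
  have "openin (gtop G) (q ` ?Z)"
    using open_map_q openin_locally_constant_level[OF lc, of "{0}"] unfolding open_map_def by blast
  moreover have "q ` ?Z = topspace (gtop G) - q ` supp f"
  proof (intro equalityI subsetI)
    fix \<alpha> assume "\<alpha> \<in> q ` ?Z"
    then obtain \<sigma> where \<sigma>: "\<sigma> \<in> arrows S" "f \<sigma> = 0" "\<alpha> = q \<sigma>" unfolding arrows_def by auto
    have "\<alpha> \<notin> q ` supp f"
    proof
      assume "\<alpha> \<in> q ` supp f"
      then obtain \<tau> where \<tau>: "\<tau> \<in> supp f" "q \<sigma> = q \<tau>" using \<sigma> by auto
      then have "\<tau> \<in> arrows S" using sub by auto
      then obtain t where t: "t \<in> runits" "\<tau> = t \<rhd> \<sigma>"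
        using act_transitive[OF \<sigma>(1), of \<tau>] \<tau>(2) by auto
      then have "f \<tau> = 0" using eq[OF t(1) \<sigma>(1)] \<sigma>(2) by simp
      then show False using \<tau>(1) by (simp add: supp_def)
    qed
    then show "\<alpha> \<in> topspace (gtop G) - q ` supp f" using \<sigma> q_arrow unfolding arrows_def by auto
  next
    fix \<alpha> assume \<alpha>: "\<alpha> \<in> topspace (gtop G) - q ` supp f"
    then obtain \<sigma> where "\<sigma> \<in> arrows S" "\<alpha> = q \<sigma>" using DT1_surj unfolding arrows_def by auto
    then show "\<alpha> \<in> q ` ?Z" using \<alpha> unfolding supp_def arrows_def by auto
  qed
  moreover have "q ` supp f \<subseteq> topspace (gtop G)"
    using sub q_arrow unfolding arrows_def by blast
  ultimately have "closedin (gtop G) (q ` supp f)"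
    unfolding closedin_def by simp
  then have "compactin (gtop G) (q ` supp f)" using K closed_compactin by blast
  then show ?thesis unfolding steinberg_def using sub lc eq by auto
qed

lemma zero_A: "(\<lambda>_. 0) \<in> A"
  by (rule steinbergI[where K = "{}"]) (auto simp: supp_def locally_constant_map_const)

lemma lin_A:
  assumes f: "f \<in> A" and g: "g \<in> A"
  shows "(\<lambda>\<sigma>. f \<sigma> + c * g \<sigma>) \<in> A"
proof (rule steinbergI)
  show "supp (\<lambda>\<sigma>. f \<sigma> + c * g \<sigma>) \<subseteq> arrows S"
    unfolding supp_def using A_off[OF f] A_off[OF g] by force
  show "locally_constant_map (gtop S) (\<lambda>\<sigma>. f \<sigma> + c * g \<sigma>)"
    using locally_constant_map_combine[OF A_locally_constant[OF f] A_locally_constant[OF g]] .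
  show "compactin (gtop G) (q ` supp f \<union> q ` supp g)"
    using A_compact[OF f] A_compact[OF g] by (rule compactin_Un)
  show "q ` supp (\<lambda>\<sigma>. f \<sigma> + c * g \<sigma>) \<subseteq> q ` supp f \<union> q ` supp g"
    unfolding supp_def by (auto simp: image_iff) force
qed (simp add: A_act[OF f] A_act[OF g] algebra_simps)

lemma diff_A: "f \<in> A \<Longrightarrow> g \<in> A \<Longrightarrow> (\<lambda>\<sigma>. f \<sigma> - g \<sigma>) \<in> A"
  using lin_A[of f g "-1"] by simp

lemma scale_A: "f \<in> A \<Longrightarrow> (\<lambda>\<sigma>. c * f \<sigma>) \<in> A"
  using lin_A[OF zero_A, of f c] by simp

lemma sum_A:
  assumes "finite I" "\<And>i. i \<in> I \<Longrightarrow> f i \<in> A"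
  shows "(\<lambda>\<sigma>. \<Sum>i\<in>I. c i * f i \<sigma>) \<in> A"
  using assms
proof (induction I rule: finite_induct)
  case empty
  then show ?case using zero_A by simp
next
  case (insert i I)
  then have "(\<lambda>\<sigma>. (\<Sum>i\<in>I. c i * f i \<sigma>) + c i * f i \<sigma>) \<in> A" by (intro lin_A) auto
  then show ?case using insert by (simp add: add.commute)
qed

lemma transversal_exists:
  assumes x: "x \<in> units S" and Q: "finite Q" "Q \<subseteq> arrows G" "\<And>\<alpha>. \<alpha> \<in> Q \<Longrightarrow> rng G \<alpha> = q x"
    and \<rho>: "\<rho> \<in> arrows S" "rr \<rho> = x"
  shows "\<exists>F. transversal F x \<and> q ` F = insert (q \<rho>) Q \<and> \<rho> \<in> F"
proof -
  define c where "c \<alpha> = (if \<alpha> = q \<rho> then \<rho> else SOME \<sigma>. \<sigma> \<in> arrows S \<and> q \<sigma> = \<alpha>)" for \<alpha>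
  have c: "c \<alpha> \<in> arrows S \<and> q (c \<alpha>) = \<alpha>" if "\<alpha> \<in> insert (q \<rho>) Q" for \<alpha>
  proof (cases "\<alpha> = q \<rho>")
    case False
    then have "\<alpha> \<in> q ` arrows S" using that Q(2) unfolding DT1_surj by auto
    then have "\<exists>\<sigma>. \<sigma> \<in> arrows S \<and> q \<sigma> = \<alpha>" by auto
    from someI_ex[OF this] show ?thesis using False unfolding c_def by auto
  qed (simp add: c_def \<rho>)
  let ?F = "c ` insert (q \<rho>) Q"
  have rngQ: "rng G \<alpha> = q x" if "\<alpha> \<in> insert (q \<rho>) Q" for \<alpha>
    using that Q(3) \<rho> q_rng[OF \<rho>(1)] by auto
  have "rr (c \<alpha>) = x" if "\<alpha> \<in> insert (q \<rho>) Q" for \<alpha>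
    using c[OF that] rngQ[OF that] x by (intro q_inj_units) (auto simp: q_rng)
  then have "transversal ?F x"
    unfolding transversal_def using c Q(1) by (auto intro!: inj_onI)
  moreover have "q ` ?F = insert (q \<rho>) Q" using c by force
  moreover have "\<rho> \<in> ?F" by (rule image_eqI[of _ _ "q \<rho>"]) (auto simp: c_def)
  ultimately show ?thesis by blast
qed

lemma finite_row:
  assumes "f \<in> A" shows "finite {\<alpha> \<in> q ` supp f. rng G \<alpha> = u}"
  using finite_compact_row[OF A_compact[OF assms]] .

lemma covering_transversal:
  assumes f: "f \<in> A" and \<rho>: "\<rho> \<in> arrows S"
  obtains F where "transversal F (rr \<rho>)" "covers F f (rr \<rho>)" "\<rho> \<in> F"
proof -
  let ?Q = "{\<alpha> \<in> q ` supp f. rng G \<alpha> = q (rr \<rho>)}"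
  have "?Q \<subseteq> arrows G" using A_supp[OF f] q_arrow by blast
  moreover have "rng G \<alpha> = q (rr \<rho>)" if "\<alpha> \<in> ?Q" for \<alpha> using that by simp
  ultimately have "\<exists>F. transversal F (rr \<rho>) \<and> q ` F = insert (q \<rho>) ?Q \<and> \<rho> \<in> F"
    by (rule transversal_exists[OF S.rng_units[OF \<rho>] finite_row[OF f] _ _ \<rho> refl])
  then obtain F where F: "transversal F (rr \<rho>)" "q ` F = insert (q \<rho>) ?Q" "\<rho> \<in> F" by blast
  moreover have "covers F f (rr \<rho>)"
    unfolding covers_def
  proof (intro ballI impI)
    fix \<tau> assume \<tau>: "\<tau> \<in> arrows S" "rr \<tau> = rr \<rho> \<and> f \<tau> \<noteq> 0"
    have "q \<tau> \<in> q ` supp f" using \<tau>(2) by (simp add: supp_def)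
    moreover have "rng G (q \<tau>) = q (rr \<rho>)" using \<tau>(2) q_rng[OF \<tau>(1)] by metis
    ultimately have "q \<tau> \<in> ?Q" by blast
    then show "q \<tau> \<in> q ` F" using F(2) by auto
  qed
  ultimately show ?thesis using that by blast
qed

lemma conv_off: "\<sigma> \<notin> arrows S \<Longrightarrow> (f \<star> g) \<sigma> = 0"
  unfolding conv_def by simp

lemma conv_term_fibre:
  assumes f: "f \<in> A" and g: "g \<in> A" and \<tau>: "\<tau> \<in> arrows S" "\<tau>' \<in> arrows S" "q \<tau> = q \<tau>'"
    and \<sigma>: "\<sigma> \<in> arrows S" "rr \<sigma> = rr \<tau>"
  shows "f \<tau> * g (iv \<tau> \<odot> \<sigma>) = f \<tau>' * g (iv \<tau>' \<odot> \<sigma>)"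
proof -
  obtain t where t: "t \<in> runits" "\<tau>' = t \<rhd> \<tau>" using act_transitive \<tau> by metis
  have "iv \<tau>' \<odot> \<sigma> = rinv t \<rhd> (iv \<tau> \<odot> \<sigma>)"
    using t \<tau> \<sigma> by (simp add: inv_act act_mult_left)
  then have "g (iv \<tau>' \<odot> \<sigma>) = t * g (iv \<tau> \<odot> \<sigma>)" using A_act[OF g, of "rinv t"] t \<tau> \<sigma> by simp
  moreover have "f \<tau>' = rinv t * f \<tau>" using A_act[OF f] t \<tau> by simp
  ultimately have "f \<tau>' * g (iv \<tau>' \<odot> \<sigma>) = (rinv t * t) * (f \<tau> * g (iv \<tau> \<odot> \<sigma>))"
    by (simp only: ac_simps)
  then show ?thesis using t by simp
qed

lemma conv_eq:
  assumes f: "f \<in> A" and g: "g \<in> A" and \<sigma>: "\<sigma> \<in> arrows S"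
    and F: "transversal F (rr \<sigma>)" "covers F f (rr \<sigma>)"
  shows "(f \<star> g) \<sigma> = (\<Sum>\<tau>\<in>F. f \<tau> * g (iv \<tau> \<odot> \<sigma>))"
proof -
  let ?Q = "{\<alpha> \<in> q ` supp f. rng G \<alpha> = q (rr \<sigma>)}"
  let ?F = "{\<tau> \<in> F. f \<tau> \<noteq> 0}"
  let ?s = "\<lambda>\<alpha>. SOME \<tau>. \<tau> \<in> supp f \<and> q \<tau> = \<alpha>"
  have Fin: "finite F" "F \<subseteq> arrows S" "\<And>\<tau>. \<tau> \<in> F \<Longrightarrow> rr \<tau> = rr \<sigma>" "inj_on q F"
    using F(1) unfolding transversal_def by auto
  have bij: "bij_betw q ?F ?Q"
    unfolding bij_betw_def
  proof
    show "inj_on q ?F" using Fin(4) by (rule inj_on_subset) auto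
    show "q ` ?F = ?Q"
    proof (intro equalityI subsetI)
      fix \<alpha> assume "\<alpha> \<in> q ` ?F"
      then obtain \<tau> where \<tau>: "\<tau> \<in> F" "f \<tau> \<noteq> 0" "\<alpha> = q \<tau>" by auto
      then have "rng G \<alpha> = q (rr \<sigma>)" using Fin q_rng[of \<tau>] by auto
      then show "\<alpha> \<in> ?Q" using \<tau> by (auto simp: supp_def)
    next
      fix \<alpha> assume "\<alpha> \<in> ?Q"
      then obtain \<tau> where \<tau>: "f \<tau> \<noteq> 0" "\<alpha> = q \<tau>" "rng G (q \<tau>) = q (rr \<sigma>)" by (auto simp: supp_def)
      have \<tau>_arr: "\<tau> \<in> arrows S" using A_nonzero_arrow[OF f \<tau>(1)] .
      have "rr \<tau> = rr \<sigma>" using \<tau>(3) \<tau>_arr \<sigma> by (intro q_inj_units) (auto simp: q_rng)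
      then obtain \<tau>' where \<tau>': "\<tau>' \<in> F" "q \<tau> = q \<tau>'"
        using F(2) \<tau> \<tau>_arr unfolding covers_def by blast
      then have "f \<tau>' \<noteq> 0" using A_zero_fibre[OF f \<tau>_arr, of \<tau>'] Fin(2) \<tau>(1) by auto
      then show "\<alpha> \<in> q ` ?F" using \<tau>' \<tau>(2) by auto
    qed
  qed
  have "(f \<star> g) \<sigma> = (\<Sum>\<alpha>\<in>?Q. f (?s \<alpha>) * g (iv (?s \<alpha>) \<odot> \<sigma>))"
    unfolding conv_def Let_def using \<sigma> by simp
  also have "\<dots> = (\<Sum>\<tau>\<in>?F. f (?s (q \<tau>)) * g (iv (?s (q \<tau>)) \<odot> \<sigma>))"
    by (rule sum.reindex_bij_betw[OF bij, symmetric])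
  also have "\<dots> = (\<Sum>\<tau>\<in>?F. f \<tau> * g (iv \<tau> \<odot> \<sigma>))"
  proof (rule sum.cong[OF refl])
    fix \<tau> assume \<tau>: "\<tau> \<in> ?F"
    then have "\<exists>\<tau>'. \<tau>' \<in> supp f \<and> q \<tau>' = q \<tau>" by (auto simp: supp_def)
    from someI_ex[OF this] have s: "?s (q \<tau>) \<in> supp f" "q (?s (q \<tau>)) = q \<tau>" by auto
    have sa: "?s (q \<tau>) \<in> arrows S" using s(1) A_supp[OF f] by blast
    have \<tau>a: "\<tau> \<in> arrows S" "rr \<sigma> = rr \<tau>" using \<tau> Fin(2,3)[of] by auto
    show "f (?s (q \<tau>)) * g (iv (?s (q \<tau>)) \<odot> \<sigma>) = f \<tau> * g (iv \<tau> \<odot> \<sigma>)"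
      using conv_term_fibre[OF f g \<tau>a(1) sa s(2)[symmetric] \<sigma> \<tau>a(2)] by (rule sym)
  qed
  also have "\<dots> = (\<Sum>\<tau>\<in>F. f \<tau> * g (iv \<tau> \<odot> \<sigma>))"
    by (rule sum.mono_neutral_left) (use Fin in auto)
  finally show ?thesis .
qed

text \<open>The transversal \<open>{\<sigma>}\<close> suffices.\<close>

lemma conv_delta:
  assumes "f \<in> A" "g \<in> A" "delta_at f \<sigma>" "\<rho> \<in> arrows S" "rr \<rho> = rr \<sigma>"
  shows "(f \<star> g) \<rho> = g (iv \<sigma> \<odot> \<rho>)"
proof -
  have "transversal {\<sigma>} (rr \<rho>)"
    unfolding transversal_def using assms(5) delta_at_arrow[OF assms(3)] by simp
  moreover have "covers {\<sigma>} f (rr \<rho>)"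
    unfolding covers_def assms(5) using delta_at_nonzero[OF assms(3)] by blast
  ultimately show ?thesis using conv_eq[OF assms(1,2,4)] delta_at_one[OF assms(3)] by simp
qed

lemma conv_zero_row:
  assumes "f \<in> A" "g \<in> A" "\<rho> \<in> arrows S" "\<And>\<tau>. \<tau> \<in> arrows S \<Longrightarrow> rr \<tau> = rr \<rho> \<Longrightarrow> f \<tau> = 0"
  shows "(f \<star> g) \<rho> = 0"
proof -
  have "transversal {} (rr \<rho>)" "covers {} f (rr \<rho>)"
    using assms(4) unfolding transversal_def covers_def by auto
  from conv_eq[OF assms(1-3) this] show ?thesis by simp
qed

lemma conv_row_cong:
  assumes "f \<in> A" "f' \<in> A" "g \<in> A" "\<rho> \<in> arrows S"
    and "\<And>\<tau>. \<tau> \<in> arrows S \<Longrightarrow> rr \<tau> = rr \<rho> \<Longrightarrow> f \<tau> = f' \<tau>"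
  shows "(f \<star> g) \<rho> = (f' \<star> g) \<rho>"
proof -
  obtain F where F: "transversal F (rr \<rho>)" "covers F f (rr \<rho>)"
    using covering_transversal[OF assms(1,4)] by metis
  have "covers F f' (rr \<rho>)" using F(2) assms(5) unfolding covers_def by auto
  then have "(f' \<star> g) \<rho> = (\<Sum>\<tau>\<in>F. f' \<tau> * g (iv \<tau> \<odot> \<rho>))" using assms F conv_eq by blast
  also have "\<dots> = (\<Sum>\<tau>\<in>F. f \<tau> * g (iv \<tau> \<odot> \<rho>))"
    using F(1) assms(5) unfolding transversal_def by (intro sum.cong) auto
  finally show ?thesis using conv_eq[OF assms(1,3,4) F] by simp
qed

lemma conv_scale_right:
  assumes "f \<in> A" "g \<in> A"
  shows "f \<star> (\<lambda>\<sigma>. c * g \<sigma>) = (\<lambda>\<sigma>. c * (f \<star> g) \<sigma>)"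
proof
  fix \<rho>
  show "(f \<star> (\<lambda>\<sigma>. c * g \<sigma>)) \<rho> = c * (f \<star> g) \<rho>"
  proof (cases "\<rho> \<in> arrows S")
    case True
    obtain F where F: "transversal F (rr \<rho>)" "covers F f (rr \<rho>)"
      using covering_transversal[OF assms(1) True] by metis
    from conv_eq[OF assms(1) scale_A[OF assms(2)] True F] conv_eq[OF assms True F]
    show ?thesis by (simp add: sum_distrib_left mult.left_commute)
  qed (simp add: conv_off)
qed

end

context ample_twist
begin

text \<open>
  Supports are open with compact image in the base, and the range map is open. As the unit space is
  Hausdorff, vanishing along a range fibre is therefore a clopen condition on the range, and
  equalities between elements of the algebra along one range fibre persist near it.
\<close>

lemma nonvanishing_ranges:
  assumes "f \<in> A"
  shows "openin (unit_top S) (rr ` supp f)" "compactin (unit_top S) (rr ` supp f)"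
    "closedin (unit_top S) (rr ` supp f)"
proof -
  show "openin (unit_top S) (rr ` supp f)"
    using openin_supp[OF A_locally_constant A_supp] assms open_map_rng unfolding open_map_def by blast
  show "compactin (unit_top S) (rr ` supp f)"
    using A_supp[OF assms] A_compact[OF assms] by (rule compactin_rng_image)
  then show "closedin (unit_top S) (rr ` supp f)" by (rule closedin_unit_top)
qed

abbreviation orbits :: "'a set \<Rightarrow> 'a set"
  where "orbits X \<equiv> {t \<rhd> \<sigma> | t \<sigma>. t \<in> runits \<and> \<sigma> \<in> X}"

lemma orbits_arrows:
  assumes "X \<subseteq> arrows S" shows "orbits X \<subseteq> arrows S"
proof
  fix \<sigma> assume "\<sigma> \<in> orbits X"
  then obtain t \<tau> where "t \<in> runits" "\<tau> \<in> X" "\<sigma> = t \<rhd> \<tau>" by blast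
  then show "\<sigma> \<in> arrows S" using assms by (simp add: subset_iff)
qed

lemma orbits_iff:
  assumes "X \<subseteq> arrows S" "\<sigma> \<in> arrows S"
  shows "\<sigma> \<in> orbits X \<longleftrightarrow> q \<sigma> \<in> q ` X"
proof
  assume "\<sigma> \<in> orbits X"
  then obtain t \<tau> where t: "t \<in> runits" "\<tau> \<in> X" "\<sigma> = t \<rhd> \<tau>" by blast
  then have "q \<sigma> = q \<tau>" using assms(1) by (simp add: subset_iff)
  then show "q \<sigma> \<in> q ` X" using t(2) by simp
next
  assume "q \<sigma> \<in> q ` X"
  then obtain \<tau> where \<tau>: "\<tau> \<in> X" "q \<tau> = q \<sigma>" by (metis imageE)
  then obtain t where "t \<in> runits" "\<sigma> = t \<rhd> \<tau>"
    using act_transitive[of \<tau> \<sigma>] assms by (auto simp: subset_iff)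
  then show "\<sigma> \<in> orbits X" using \<tau>(1) by blast
qed

lemma orbit_coordinates_unique:
  assumes X: "compact_open_bisection S X" and "\<sigma> \<in> X" "\<tau> \<in> X" "t \<in> runits" "u \<in> runits"
    and eq: "t \<rhd> \<sigma> = u \<rhd> \<tau>"
  shows "\<sigma> = \<tau>" "t = u"
proof -
  note XD = compact_open_bisectionD[OF X]
  have arr: "\<sigma> \<in> arrows S" "\<tau> \<in> arrows S" using assms XD(4) by auto
  have "q \<sigma> = q \<tau>" using q_act[OF assms(4) arr(1)] q_act[OF assms(5) arr(2)] eq by simp
  then show "\<sigma> = \<tau>" using bisection_q_eq[OF XD(1) assms(2,3) XD(4)] by simp
  then show "t = u" using act_free[OF assms(4,5) arr(1)] eq by simp
qed

text \<open>
  Equivariance forces the value \<open>t\<^sup>-\<^sup>1\<close> at \<open>t \<rhd> \<sigma>\<close> for \<open>\<sigma> \<in> X\<close>. The resulting function is locally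
  constant on its support because the translates of \<open>X\<close> are open, and off its support because \<open>q ` X\<close>
  is compact in a Hausdorff space, hence closed.
\<close>

lemma tilde_one_properties:
  assumes X: "compact_open_bisection S X"
  shows tilde_one_A: "tilde_one T X \<in> A"
    and tilde_one_supp: "supp (tilde_one T X) \<subseteq> orbits X"
    and tilde_one_eq_1: "\<sigma> \<in> X \<Longrightarrow> tilde_one T X \<sigma> = 1"
proof -
  note XD = compact_open_bisectionD[OF X]
  let ?P = "\<lambda>f. f \<in> A \<and> supp f \<subseteq> orbits X \<and> (\<forall>\<sigma>\<in>X. f \<sigma> = 1)"
  define g where "g \<sigma> = (if \<sigma> \<in> orbits X then rinv (THE t. t \<in> runits \<and> (\<exists>\<tau>\<in>X. \<sigma> = t \<rhd> \<tau>)) else (0::'r))" for \<sigma>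
  have g_orb: "g (t \<rhd> \<sigma>) = rinv t" if "t \<in> runits" "\<sigma> \<in> X" for t \<sigma>
  proof -
    have "(THE u. u \<in> runits \<and> (\<exists>\<tau>\<in>X. t \<rhd> \<sigma> = u \<rhd> \<tau>)) = t"
      using that orbit_coordinates_unique[OF X] by (intro the_equality) blast+
    moreover have "t \<rhd> \<sigma> \<in> orbits X" using that by blast
    ultimately show ?thesis unfolding g_def by simp
  qed
  have g_supp: "supp g \<subseteq> orbits X"
  proof
    fix \<sigma> assume \<sigma>: "\<sigma> \<in> supp g"
    show "\<sigma> \<in> orbits X"
    proof (rule ccontr)
      assume "\<sigma> \<notin> orbits X"
      then have "g \<sigma> = 0" unfolding g_def by (rule if_not_P)
      then show False using \<sigma> unfolding supp_def by blast
    qed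
  qed
  have qX: "compactin (gtop G) (q ` X)" using XD(3) prj_continuous by (rule image_compactin)
  have gA: "g \<in> A"
  proof (rule steinbergI)
    show "supp g \<subseteq> arrows S" using g_supp orbits_arrows[OF XD(4)] by (rule subset_trans)
    show "compactin (gtop G) (q ` X)" by (rule qX)
    show "q ` supp g \<subseteq> q ` X"
    proof
      fix \<alpha> assume "\<alpha> \<in> q ` supp g"
      then obtain \<sigma> where \<sigma>: "\<sigma> \<in> orbits X" "\<alpha> = q \<sigma>" using g_supp by blast
      then have "\<sigma> \<in> arrows S" using orbits_arrows[OF XD(4)] by blast
      then show "\<alpha> \<in> q ` X" using \<sigma> orbits_iff[OF XD(4)] by blast
    qed
    show "g (t \<rhd> \<sigma>) = rinv t * g \<sigma>" if t: "t \<in> runits" and \<sigma>: "\<sigma> \<in> arrows S" for t \<sigma>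
    proof (cases "\<sigma> \<in> orbits X")
      case True
      then obtain u \<tau> where u: "u \<in> runits" "\<tau> \<in> X" "\<sigma> = u \<rhd> \<tau>" by blast
      have "\<tau> \<in> arrows S" using u(2) XD(4) by blast
      then have tu: "t \<rhd> \<sigma> = (t * u) \<rhd> \<tau>" unfolding u(3) using t u(1) by (simp only: act_act)
      have "g (t \<rhd> \<sigma>) = rinv (t * u)" unfolding tu using t u by (intro g_orb) auto
      moreover have "g \<sigma> = rinv u" unfolding u(3) using u by (intro g_orb) auto
      ultimately show ?thesis using rinv_mult[OF t u(1)] by simp
    next
      case False
      then have "t \<rhd> \<sigma> \<notin> orbits X"
        using orbits_iff[OF XD(4) \<sigma>] orbits_iff[OF XD(4) act_arrow[OF t \<sigma>]] q_act[OF t \<sigma>] by metis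
      then have "g (t \<rhd> \<sigma>) = 0" "g \<sigma> = 0" using False g_supp unfolding supp_def by blast+
      then show ?thesis by simp
    qed
    show "locally_constant_map (gtop S) g"
    proof (rule locally_constant_mapI)
      fix \<sigma> assume \<sigma>: "\<sigma> \<in> topspace (gtop S)"
      show "\<exists>W. openin (gtop S) W \<and> \<sigma> \<in> W \<and> (\<forall>y\<in>W. g y = g \<sigma>)"
      proof (cases "\<sigma> \<in> orbits X")
        case True
        then obtain u \<tau> where u: "u \<in> runits" "\<tau> \<in> X" "\<sigma> = u \<rhd> \<tau>" by blast
        have "openin (gtop S) (act T u ` X)" using u(1) XD(2) by (rule openin_act_image)
        moreover have "\<sigma> \<in> act T u ` X" using u by blast
        moreover have "\<forall>y\<in>act T u ` X. g y = g \<sigma>"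
        proof
          fix y assume "y \<in> act T u ` X"
          then obtain \<rho> where \<rho>: "\<rho> \<in> X" "y = u \<rhd> \<rho>" by blast
          show "g y = g \<sigma>" unfolding u(3) \<rho>(2) using u \<rho> by (simp only: g_orb)
        qed
        ultimately show ?thesis by blast
      next
        case False
        let ?W = "{\<sigma> \<in> topspace (gtop S). q \<sigma> \<in> topspace (gtop G) - q ` X}"
        have "openin (gtop G) (topspace (gtop G) - q ` X)"
          using compactin_imp_closedin[OF Hausdorff_base qX] by blast
        then have "openin (gtop S) ?W" using prj_continuous openin_continuous_map_preimage by blast
        moreover have W: "\<tau> \<in> ?W \<longleftrightarrow> \<tau> \<notin> orbits X" if "\<tau> \<in> topspace (gtop S)" for \<tau>
        proof -
          have \<tau>: "\<tau> \<in> arrows S" using that unfolding arrows_def .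
          have "q \<tau> \<in> topspace (gtop G)" using q_arrow[OF \<tau>] unfolding arrows_def .
          then show ?thesis using that orbits_iff[OF XD(4) \<tau>] by blast
        qed
        moreover have g0: "g y = 0" if "y \<notin> orbits X" for y
          using that g_supp unfolding supp_def by blast
        moreover have "g y = g \<sigma>" if "y \<in> ?W" for y
        proof -
          have "y \<notin> orbits X" using W[of y] that by blast
          then show ?thesis using g0 False by simp
        qed
        moreover have "\<sigma> \<in> ?W" using W[OF \<sigma>] False by (rule iffD2)
        ultimately show ?thesis by (intro exI[of _ ?W] conjI ballI)
      qed
    qed
  qed
  have g_one: "\<forall>\<sigma>\<in>X. g \<sigma> = 1"
  proof
    fix \<sigma> assume \<sigma>: "\<sigma> \<in> X"
    then have "1 \<rhd> \<sigma> = \<sigma>" using XD(4) by (intro act_one) blast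
    then show "g \<sigma> = 1" using g_orb[OF runits_one \<sigma>] by simp
  qed
  have Pg: "?P g" by (intro conjI gA g_supp g_one)
  have uniq: "f = g" if "?P f" for f
  proof (rule A_ext)
    note f = that[THEN conjunct1] that[THEN conjunct2, THEN conjunct1] that[THEN conjunct2, THEN conjunct2]
    show "f \<in> A" by (rule f(1))
    show "g \<in> A" by (rule gA)
    fix \<sigma> assume \<sigma>: "\<sigma> \<in> arrows S"
    show "f \<sigma> = g \<sigma>"
    proof (cases "\<sigma> \<in> orbits X")
      case True
      then obtain u \<tau> where u: "u \<in> runits" "\<tau> \<in> X" "\<sigma> = u \<rhd> \<tau>" by blast
      have \<tau>: "\<tau> \<in> arrows S" using u(2) XD(4) by blast
      show ?thesis
        unfolding u(3) A_act[OF f(1) u(1) \<tau>] A_act[OF gA u(1) \<tau>]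
        using bspec[OF f(3) u(2)] bspec[OF g_one u(2)] by simp
    next
      case False
      have "f \<sigma> = 0" using False f(2) unfolding supp_def by blast
      moreover have "g \<sigma> = 0" using False g_supp unfolding supp_def by blast
      ultimately show ?thesis by simp
    qed
  qed
  have "tilde_one T X = g"
    unfolding tilde_one_def using Pg uniq by (rule the_equality)
  then show "tilde_one T X \<in> A" "supp (tilde_one T X) \<subseteq> orbits X"
    "\<sigma> \<in> X \<Longrightarrow> tilde_one T X \<sigma> = 1"
    using gA g_supp bspec[OF g_one] by simp_all
qed

lemma tilde_one_act:
  assumes "compact_open_bisection S X" "\<sigma> \<in> X" "t \<in> runits"
  shows "tilde_one T X (t \<rhd> \<sigma>) = rinv t"
  using A_act[OF tilde_one_A[OF assms(1)] assms(3), of \<sigma>] tilde_one_eq_1[OF assms(1,2)]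
    compact_open_bisectionD(4)[OF assms(1)] assms(2) by auto

lemma tilde_one_nonzero:
  assumes "compact_open_bisection S X" "tilde_one T X \<sigma> \<noteq> 0"
  obtains t \<tau> where "t \<in> runits" "\<tau> \<in> X" "\<sigma> = t \<rhd> \<tau>"
  using tilde_one_supp[OF assms(1)] assms(2) unfolding supp_def by blast

lemma tilde_one_delta:
  assumes X: "compact_open_bisection S X" and \<sigma>: "\<sigma> \<in> X"
  shows "delta_at (tilde_one T X) \<sigma>"
  unfolding delta_at_def
proof (intro conjI ballI impI)
  note XD = compact_open_bisectionD[OF X]
  show "\<sigma> \<in> arrows S" using \<sigma> XD(4) by auto
  show "tilde_one T X \<sigma> = 1" using tilde_one_eq_1[OF X \<sigma>] .
  fix \<tau> assume \<tau>: "\<tau> \<in> arrows S" "rr \<tau> = rr \<sigma> \<and> tilde_one T X \<tau> \<noteq> 0"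
  then obtain t \<rho> where t: "t \<in> runits" "\<rho> \<in> X" "\<tau> = t \<rhd> \<rho>" using tilde_one_nonzero[OF X] by blast
  then have "\<rho> \<in> arrows S" using XD(4) by auto
  then have "rr \<rho> = rr \<sigma>" "q \<tau> = q \<rho>" using \<tau> t by auto
  then show "q \<tau> = q \<sigma>" using inj_onD[OF XD(5), of \<rho> \<sigma>] t \<sigma> by simp
qed

lemma tilde_one_zero_row:
  assumes X: "compact_open_bisection S X" and \<tau>: "\<tau> \<in> arrows S" "rr \<tau> \<notin> rr ` X"
  shows "tilde_one T X \<tau> = 0"
proof (rule ccontr)
  assume "tilde_one T X \<tau> \<noteq> 0"
  then obtain t \<rho> where t: "t \<in> runits" "\<rho> \<in> X" "\<tau> = t \<rhd> \<rho>" using tilde_one_nonzero[OF X] by blast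
  then show False using \<tau> compact_open_bisectionD(4)[OF X] by auto
qed

end

section \<open>The convolution algebra and its diagonal\<close>

context ample_twist
begin

text \<open>
  Convolution with \<open>tilde_one T X\<close> on the left is translation along \<open>X\<close>, by the arrow of \<open>X\<close> with
  the given range, and this arrow depends continuously on the range.
\<close>

lemma tilde_one_conv_locally_constant:
  assumes X: "compact_open_bisection S X" and g: "g \<in> A"
  shows "locally_constant_map (gtop S) (tilde_one T X \<star> g)"
proof (rule locally_constant_mapI)
  note XD = compact_open_bisectionD[OF X]
  fix \<sigma> assume "\<sigma> \<in> topspace (gtop S)"
  then have \<sigma>: "\<sigma> \<in> arrows S" unfolding arrows_def .
  have rX: "openin (unit_top S) (rr ` X)" using open_map_rng XD(2) unfolding open_map_def by blast
  show "\<exists>W. openin (gtop S) W \<and> \<sigma> \<in> W \<and> (\<forall>y\<in>W. (tilde_one T X \<star> g) y = (tilde_one T X \<star> g) \<sigma>)"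
  proof (cases "rr \<sigma> \<in> rr ` X")
    case False
    have "compactin (unit_top S) (rr ` X)"
      using XD(3) S.continuous_rng_unit_top by (rule image_compactin)
    then have "openin (unit_top S) (units S - rr ` X)"
      using closedin_unit_top S.topspace_unit_top by (metis openin_diff openin_topspace)
    then have "openin (gtop S) {\<sigma> \<in> topspace (gtop S). rr \<sigma> \<in> units S - rr ` X}" (is "openin _ ?W")
      using S.continuous_rng_unit_top openin_continuous_map_preimage by blast
    moreover have zero: "(tilde_one T X \<star> g) y = 0" if "y \<in> arrows S" "rr y \<notin> rr ` X" for y
    proof (rule conv_zero_row[OF tilde_one_A[OF X] g that(1)])
      fix \<tau> assume "\<tau> \<in> arrows S" "rr \<tau> = rr y"
      then show "tilde_one T X \<tau> = 0" using tilde_one_zero_row[OF X, of \<tau>] that(2) by simp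
    qed
    moreover have "(tilde_one T X \<star> g) y = (tilde_one T X \<star> g) \<sigma>" if "y \<in> ?W" for y
      using zero[of y] zero[OF \<sigma> False] that unfolding arrows_def by simp
    moreover have "\<sigma> \<in> ?W" using False \<sigma> S.rng_units[OF \<sigma>] unfolding arrows_def by simp
    ultimately show ?thesis by (intro exI[of _ ?W]) blast
  next
    case True
    have "homeomorphic_map (subtopology (gtop S) X) (subtopology (unit_top S) (rr ` X)) rr"
      using inj_on_open_map_open_homeo_on[OF S.continuous_rng_unit_top open_map_rng XD(2,5)]
      unfolding open_homeo_on_def by blast
    then obtain \<xi> where \<xi>: "homeomorphic_maps (subtopology (gtop S) X) (subtopology (unit_top S) (rr ` X)) rr \<xi>"
      unfolding homeomorphic_map_maps by blast
    have \<xi>_cont: "continuous_map (subtopology (unit_top S) (rr ` X)) (gtop S) \<xi>"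
      using \<xi> unfolding homeomorphic_maps_def continuous_map_in_subtopology by blast
    have \<xi>_eq: "\<xi> (rr \<tau>) = \<tau>" if "\<tau> \<in> X" for \<tau>
    proof -
      have "\<tau> \<in> topspace (subtopology (gtop S) X)" using that XD(4) by (auto simp: arrows_def)
      then show ?thesis using \<xi> unfolding homeomorphic_maps_def by blast
    qed
    define V where "V = {\<sigma> \<in> topspace (gtop S). rr \<sigma> \<in> rr ` X}"
    have V: "openin (gtop S) V"
      unfolding V_def using S.continuous_rng_unit_top rX by (rule openin_continuous_map_preimage)
    have V_arr: "y \<in> arrows S" if "y \<in> V" for y using that unfolding V_def arrows_def by blast
    have V_top: "topspace (subtopology (gtop S) V) = V"
      using openin_subset[OF V] by auto
    have \<xi>_V: "\<xi> (rr y) \<in> X \<and> rr (\<xi> (rr y)) = rr y" if "y \<in> V" for y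
    proof -
      have "rr y \<in> rr ` X" using that unfolding V_def by blast
      then obtain \<tau> where "\<tau> \<in> X" "rr y = rr \<tau>" by (rule imageE)
      then show ?thesis using \<xi>_eq by simp
    qed
    have \<xi>_arr: "\<xi> (rr y) \<in> arrows S" if "y \<in> V" for y using \<xi>_V[OF that] XD(4) by blast
    have "continuous_map (subtopology (gtop S) V) (subtopology (unit_top S) (rr ` X)) rr"
      unfolding continuous_map_in_subtopology
      using continuous_map_from_subtopology[OF S.continuous_rng_unit_top] V_top
      by (auto simp: V_def)
    from continuous_map_compose[OF this \<xi>_cont]
    have "continuous_map (subtopology (gtop S) V) (gtop S) (\<lambda>y. \<xi> (rr y))" by (simp add: o_def)
    from continuous_map_compose[OF this S.continuous_inv]
    have c: "continuous_map (subtopology (gtop S) V) (gtop S) (\<lambda>y. iv (\<xi> (rr y)))" by (simp add: o_def)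
    have "continuous_map (subtopology (gtop S) V) (gtop S) (\<lambda>y. iv (\<xi> (rr y)) \<odot> id y)"
      using c continuous_map_from_subtopology[OF continuous_map_id]
      by (rule S.continuous_mult_compose) (use \<xi>_V \<xi>_arr V_top in simp)
    then have c: "continuous_map (subtopology (gtop S) V) (gtop S) (\<lambda>y. iv (\<xi> (rr y)) \<odot> y)" by simp
    have conv: "(tilde_one T X \<star> g) y = g (iv (\<xi> (rr y)) \<odot> y)" if "y \<in> V" for y
      using conv_delta[OF tilde_one_A[OF X] g tilde_one_delta[OF X] V_arr[OF that]] \<xi>_V[OF that] by simp
    have \<sigma>V: "\<sigma> \<in> V" using True \<sigma> unfolding V_def arrows_def by simp
    have "iv (\<xi> (rr \<sigma>)) \<odot> \<sigma> \<in> topspace (gtop S)"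
      using continuous_map_funspace[OF c] V_top \<sigma>V by blast
    then obtain O1 where O1: "openin (gtop S) O1" "iv (\<xi> (rr \<sigma>)) \<odot> \<sigma> \<in> O1"
      "\<forall>y\<in>O1. g y = g (iv (\<xi> (rr \<sigma>)) \<odot> \<sigma>)"
      using A_locally_constant[OF g] unfolding locally_constant_map_def by blast
    let ?W = "{y \<in> topspace (subtopology (gtop S) V). iv (\<xi> (rr y)) \<odot> y \<in> O1}"
    have "openin (subtopology (gtop S) V) ?W" using c O1(1) by (rule openin_continuous_map_preimage)
    then have "openin (gtop S) ?W" using V by (rule openin_trans_full)
    moreover have "\<sigma> \<in> ?W" using \<sigma>V V_top O1(2) by blast
    moreover have "(tilde_one T X \<star> g) y = (tilde_one T X \<star> g) \<sigma>" if "y \<in> ?W" for y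
    proof -
      have "y \<in> V" using that V_top by blast
      moreover have "g (iv (\<xi> (rr y)) \<odot> y) = g (iv (\<xi> (rr \<sigma>)) \<odot> \<sigma>)" using that O1(3) by blast
      ultimately show ?thesis using conv \<sigma>V by simp
    qed
    ultimately show ?thesis by blast
  qed
qed

lemma arrow_basis:
  assumes "\<sigma> \<in> arrows S"
  obtains X where "compact_open_bisection S X" "\<sigma> \<in> X"
  using compact_open_bisection_basis[OF openin_topspace, of \<sigma>] assms unfolding arrows_def by blast

lemma conv_sum_left:
  assumes I: "finite I" and f: "\<And>i. i \<in> I \<Longrightarrow> f i \<in> A" and g: "g \<in> A" and \<rho>: "\<rho> \<in> arrows S"
  shows "((\<lambda>\<sigma>. \<Sum>i\<in>I. c i * f i \<sigma>) \<star> g) \<rho> = (\<Sum>i\<in>I. c i * (f i \<star> g) \<rho>)"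
proof -
  let ?Q = "\<Union>i\<in>I. {\<alpha> \<in> q ` supp (f i). rng G \<alpha> = q (rr \<rho>)}"
  have fin: "finite ?Q" using I f finite_row by blast
  have sub: "?Q \<subseteq> arrows G"
  proof
    fix \<alpha> assume "\<alpha> \<in> ?Q"
    then obtain i \<sigma> where "i \<in> I" "\<sigma> \<in> supp (f i)" "\<alpha> = q \<sigma>" by blast
    then show "\<alpha> \<in> arrows G" using A_supp[OF f] q_arrow by blast
  qed
  have rQ: "rng G \<alpha> = q (rr \<rho>)" if "\<alpha> \<in> ?Q" for \<alpha> using that by blast
  obtain F where F: "transversal F (rr \<rho>)" "q ` F = insert (q \<rho>) ?Q"
    using transversal_exists[OF S.rng_units[OF \<rho>] fin sub rQ \<rho> refl] by blast
  have in_Q: "q \<tau> \<in> q ` F" if "\<tau> \<in> arrows S" "rr \<tau> = rr \<rho>" "i \<in> I" "f i \<tau> \<noteq> 0" for \<tau> i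
  proof -
    have "rng G (q \<tau>) = q (rr \<rho>)" using q_rng[OF that(1)] that(2) by simp
    moreover have "q \<tau> \<in> q ` supp (f i)" using that(4) unfolding supp_def by blast
    ultimately show ?thesis unfolding F(2) using that(3) by blast
  qed
  have cov: "covers F (f i) (rr \<rho>)" if "i \<in> I" for i
    unfolding covers_def using in_Q that by blast
  have "covers F (\<lambda>\<sigma>. \<Sum>i\<in>I. c i * f i \<sigma>) (rr \<rho>)"
    unfolding covers_def
  proof (intro ballI impI)
    fix \<tau> assume \<tau>: "\<tau> \<in> arrows S" "rr \<tau> = rr \<rho> \<and> (\<Sum>i\<in>I. c i * f i \<tau>) \<noteq> 0"
    then obtain i where i: "i \<in> I" "c i * f i \<tau> \<noteq> 0" by (meson sum.neutral)
    then have "f i \<tau> \<noteq> 0" by auto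
    then show "q \<tau> \<in> q ` F" using in_Q \<tau> i(1) by blast
  qed
  from conv_eq[OF sum_A[OF I f] g \<rho> F(1) this]
  have "((\<lambda>\<sigma>. \<Sum>i\<in>I. c i * f i \<sigma>) \<star> g) \<rho> = (\<Sum>\<tau>\<in>F. \<Sum>i\<in>I. c i * (f i \<tau> * g (iv \<tau> \<odot> \<rho>)))"
    by (simp add: sum_distrib_right mult.assoc)
  also have "\<dots> = (\<Sum>i\<in>I. \<Sum>\<tau>\<in>F. c i * (f i \<tau> * g (iv \<tau> \<odot> \<rho>)))" by (rule sum.swap)
  also have "\<dots> = (\<Sum>i\<in>I. c i * (f i \<star> g) \<rho>)"
  proof (rule sum.cong[OF refl])
    fix i assume "i \<in> I"
    then show "(\<Sum>\<tau>\<in>F. c i * (f i \<tau> * g (iv \<tau> \<odot> \<rho>))) = c i * (f i \<star> g) \<rho>"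
      using conv_eq[OF f g \<rho> F(1) cov] by (simp add: sum_distrib_left)
  qed
  finally show ?thesis .
qed

lemma conv_scale_left:
  assumes "f \<in> A" "g \<in> A"
  shows "(\<lambda>\<sigma>. c * f \<sigma>) \<star> g = (\<lambda>\<sigma>. c * (f \<star> g) \<sigma>)"
proof
  fix \<rho>
  show "((\<lambda>\<sigma>. c * f \<sigma>) \<star> g) \<rho> = c * (f \<star> g) \<rho>"
  proof (cases "\<rho> \<in> arrows S")
    case True
    then show ?thesis using conv_sum_left[of "{()}" "\<lambda>_. f" g \<rho> "\<lambda>_. c"] assms by simp
  qed (simp add: conv_off)
qed

text \<open>
  Along one range fibre, hence near it, \<open>f\<close> is a finite combination of functions \<open>tilde_one T X\<close>.
  This reduces local constancy of a product to the case of translation along a bisection.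
\<close>

lemma conv_locally_constant:
  assumes f: "f \<in> A" and g: "g \<in> A"
  shows "locally_constant_map (gtop S) (f \<star> g)"
proof (rule locally_constant_mapI)
  fix \<sigma> assume "\<sigma> \<in> topspace (gtop S)"
  then have \<sigma>: "\<sigma> \<in> arrows S" unfolding arrows_def .
  obtain F where F: "transversal F (rr \<sigma>)" "covers F f (rr \<sigma>)"
    using covering_transversal[OF f \<sigma>] by blast
  have Fin: "finite F" "F \<subseteq> arrows S" "\<And>\<tau>. \<tau> \<in> F \<Longrightarrow> rr \<tau> = rr \<sigma>" "inj_on q F"
    using F(1) unfolding transversal_def by blast+
  have "\<forall>\<tau>\<in>F. \<exists>X. compact_open_bisection S X \<and> \<tau> \<in> X" using arrow_basis Fin(2) by blast
  then obtain X where X: "\<And>\<tau>. \<tau> \<in> F \<Longrightarrow> compact_open_bisection S (X \<tau>)" "\<And>\<tau>. \<tau> \<in> F \<Longrightarrow> \<tau> \<in> X \<tau>"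
    by metis
  have delta: "delta_at (tilde_one T (X \<tau>)) \<tau>" if "\<tau> \<in> F" for \<tau>
    using tilde_one_delta X that by blast
  define h where "h \<rho> = (\<Sum>\<tau>\<in>F. f \<tau> * tilde_one T (X \<tau>) \<rho>)" for \<rho>
  have hA: "h \<in> A" unfolding h_def[abs_def] using Fin(1) X(1) by (intro sum_A tilde_one_A) auto
  have d: "(\<lambda>\<rho>. f \<rho> - h \<rho>) \<in> A" (is "?d \<in> A") using f hA by (rule diff_A)
  have row: "f \<rho> = h \<rho>" if \<rho>: "\<rho> \<in> arrows S" "rr \<rho> = rr \<sigma>" for \<rho>
  proof (cases "q \<rho> \<in> q ` F")
    case False
    have "f \<rho> = 0" using F(2) \<rho> False unfolding covers_def by blast
    moreover have "tilde_one T (X \<tau>) \<rho> = 0" if \<tau>: "\<tau> \<in> F" for \<tau>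
      using delta_at_nonzero[OF delta[OF \<tau>] \<rho>(1)] Fin(3)[OF \<tau>] \<rho>(2) False \<tau> by force
    ultimately show ?thesis unfolding h_def by simp
  next
    case True
    then obtain \<tau> where \<tau>: "\<tau> \<in> F" "q \<rho> = q \<tau>" by blast
    have \<tau>a: "\<tau> \<in> arrows S" using \<tau> Fin(2) by blast
    obtain t where t: "t \<in> runits" "\<rho> = t \<rhd> \<tau>" using act_transitive[OF \<tau>a \<rho>(1)] \<tau>(2) by metis
    have "tilde_one T (X \<omega>) \<rho> = (if \<omega> = \<tau> then rinv t else 0)" if \<omega>: "\<omega> \<in> F" for \<omega>
    proof (cases "\<omega> = \<tau>")
      case True
      then show ?thesis
        using A_act[OF tilde_one_A[OF X(1)[OF \<omega>]] t(1) \<tau>a] delta_at_one[OF delta[OF \<omega>]] t(2) by simp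
    next
      case False
      then have "q \<rho> \<noteq> q \<omega>" using inj_onD[OF Fin(4)] \<tau> \<omega> by metis
      then show ?thesis
        using delta_at_nonzero[OF delta[OF \<omega>] \<rho>(1)] Fin(3)[OF \<omega>] \<rho>(2) False by auto
    qed
    then have "h \<rho> = (\<Sum>\<omega>\<in>F. if \<omega> = \<tau> then f \<omega> * rinv t else 0)"
      unfolding h_def by (intro sum.cong) auto
    also have "\<dots> = f \<tau> * rinv t" using \<tau>(1) Fin(1) by simp
    also have "\<dots> = f \<rho>" using A_act[OF f t(1) \<tau>a] t(2) by (simp add: mult.commute)
    finally show ?thesis by simp
  qed
  have "rr \<sigma> \<notin> rr ` supp ?d"
  proof
    assume "rr \<sigma> \<in> rr ` supp ?d"
    then obtain \<rho> where "\<rho> \<in> supp ?d" "rr \<rho> = rr \<sigma>" by force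
    moreover then have "\<rho> \<in> arrows S" using A_supp[OF d] by blast
    ultimately show False using row unfolding supp_def by simp
  qed
  define V where "V = {y \<in> topspace (gtop S). rr y \<in> units S - rr ` supp ?d}"
  have "openin (unit_top S) (units S - rr ` supp ?d)"
    using nonvanishing_ranges(3)[OF d] S.topspace_unit_top by (metis openin_diff openin_topspace)
  then have V: "openin (gtop S) V"
    unfolding V_def using S.continuous_rng_unit_top openin_continuous_map_preimage by blast
  have \<sigma>V: "\<sigma> \<in> V"
    unfolding V_def using \<sigma> \<open>rr \<sigma> \<notin> rr ` supp ?d\<close> S.rng_units[OF \<sigma>] unfolding arrows_def by blast
  have on_V: "(f \<star> g) y = (\<Sum>\<tau>\<in>F. f \<tau> * (tilde_one T (X \<tau>) \<star> g) y)" if y: "y \<in> V" for y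
  proof -
    have ya: "y \<in> arrows S" using y unfolding V_def arrows_def by blast
    have "f \<tau> = h \<tau>" if "rr \<tau> = rr y" for \<tau>
    proof -
      have "rr y \<notin> rr ` supp ?d" using y unfolding V_def by blast
      then have "\<tau> \<notin> supp ?d" using that[symmetric] image_eqI[of "rr y" rr \<tau>] by blast
      then show ?thesis unfolding supp_def by simp
    qed
    then have "(f \<star> g) y = (h \<star> g) y" using conv_row_cong[OF f hA g ya] by blast
    also have "\<dots> = (\<Sum>\<tau>\<in>F. f \<tau> * (tilde_one T (X \<tau>) \<star> g) y)"
      unfolding h_def[abs_def] using Fin(1) tilde_one_A[OF X(1)] g ya by (rule conv_sum_left)
    finally show ?thesis .
  qed
  have "\<exists>W. openin (gtop S) W \<and> \<sigma> \<in> W \<and> (\<forall>y\<in>W. (tilde_one T (X \<tau>) \<star> g) y = (tilde_one T (X \<tau>) \<star> g) \<sigma>)"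
    if "\<tau> \<in> F" for \<tau>
    using tilde_one_conv_locally_constant[OF X(1)[OF that] g] \<sigma>
    unfolding locally_constant_map_def arrows_def by blast
  then obtain W where W: "\<And>\<tau>. \<tau> \<in> F \<Longrightarrow> openin (gtop S) (W \<tau>)" "\<And>\<tau>. \<tau> \<in> F \<Longrightarrow> \<sigma> \<in> W \<tau>"
    "\<And>\<tau> y. \<tau> \<in> F \<Longrightarrow> y \<in> W \<tau> \<Longrightarrow> (tilde_one T (X \<tau>) \<star> g) y = (tilde_one T (X \<tau>) \<star> g) \<sigma>"
    by metis
  let ?W = "V \<inter> (\<Inter>\<tau>\<in>F. W \<tau>)"
  have "openin (gtop S) (\<Inter> (insert V (W ` F)))"
    using Fin(1) V W(1) by (intro openin_Inter) auto
  then have "openin (gtop S) ?W" by simp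
  moreover have "\<sigma> \<in> ?W" using \<sigma>V W(2) by blast
  moreover have "(f \<star> g) y = (f \<star> g) \<sigma>" if y: "y \<in> ?W" for y
  proof -
    have "(\<Sum>\<tau>\<in>F. f \<tau> * (tilde_one T (X \<tau>) \<star> g) y) = (\<Sum>\<tau>\<in>F. f \<tau> * (tilde_one T (X \<tau>) \<star> g) \<sigma>)"
    proof (rule sum.cong[OF refl])
      fix \<tau> assume \<tau>: "\<tau> \<in> F"
      then have "y \<in> W \<tau>" using y by blast
      then show "f \<tau> * (tilde_one T (X \<tau>) \<star> g) y = f \<tau> * (tilde_one T (X \<tau>) \<star> g) \<sigma>"
        using W(3)[OF \<tau>] by metis
    qed
    moreover have "y \<in> V" using y by blast
    ultimately show ?thesis using on_V \<sigma>V by simp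
  qed
  ultimately show "\<exists>W. openin (gtop S) W \<and> \<sigma> \<in> W \<and> (\<forall>y\<in>W. (f \<star> g) y = (f \<star> g) \<sigma>)"
    by blast
qed

lemma conv_nonzero:
  assumes f: "f \<in> A" and g: "g \<in> A" and nz: "(f \<star> g) \<sigma> \<noteq> 0"
  obtains \<tau> where "\<sigma> \<in> arrows S" "\<tau> \<in> arrows S" "rr \<tau> = rr \<sigma>" "f \<tau> \<noteq> 0" "g (iv \<tau> \<odot> \<sigma>) \<noteq> 0"
proof -
  have \<sigma>: "\<sigma> \<in> arrows S" using nz conv_off by blast
  obtain F where F: "transversal F (rr \<sigma>)" "covers F f (rr \<sigma>)"
    using covering_transversal[OF f \<sigma>] by blast
  have "(\<Sum>\<tau>\<in>F. f \<tau> * g (iv \<tau> \<odot> \<sigma>)) \<noteq> 0" using nz conv_eq[OF f g \<sigma> F] by simp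
  then obtain \<tau> where \<tau>: "\<tau> \<in> F" "f \<tau> * g (iv \<tau> \<odot> \<sigma>) \<noteq> 0" by (meson sum.neutral)
  then have "f \<tau> \<noteq> 0" "g (iv \<tau> \<odot> \<sigma>) \<noteq> 0" by auto
  moreover have "\<tau> \<in> arrows S" "rr \<tau> = rr \<sigma>" using F(1) \<tau>(1) unfolding transversal_def by blast+
  ultimately show ?thesis using that \<sigma> by blast
qed

lemma conv_A:
  assumes f: "f \<in> A" and g: "g \<in> A"
  shows "f \<star> g \<in> A"
proof (rule steinbergI)
  show "supp (f \<star> g) \<subseteq> arrows S" unfolding supp_def using conv_off by blast
  show "locally_constant_map (gtop S) (f \<star> g)" using f g by (rule conv_locally_constant)
  show "(f \<star> g) (t \<rhd> \<sigma>) = rinv t * (f \<star> g) \<sigma>" if t: "t \<in> runits" and \<sigma>: "\<sigma> \<in> arrows S" for t \<sigma>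
  proof -
    obtain F where F: "transversal F (rr \<sigma>)" "covers F f (rr \<sigma>)"
      using covering_transversal[OF f \<sigma>] by blast
    have "g (iv \<tau> \<odot> (t \<rhd> \<sigma>)) = rinv t * g (iv \<tau> \<odot> \<sigma>)" if "\<tau> \<in> F" for \<tau>
    proof -
      have \<tau>: "\<tau> \<in> arrows S" "rr \<tau> = rr \<sigma>" using F(1) that unfolding transversal_def by blast+
      then have "iv \<tau> \<odot> (t \<rhd> \<sigma>) = t \<rhd> (iv \<tau> \<odot> \<sigma>)" using t \<sigma> by (intro act_mult_right) auto
      then show ?thesis using A_act[OF g t, of "iv \<tau> \<odot> \<sigma>"] \<tau> \<sigma> by simp
    qed
    moreover have "(f \<star> g) (t \<rhd> \<sigma>) = (\<Sum>\<tau>\<in>F. f \<tau> * g (iv \<tau> \<odot> (t \<rhd> \<sigma>)))"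
      using F t \<sigma> by (intro conv_eq[OF f g]) auto
    ultimately show ?thesis
      using conv_eq[OF f g \<sigma> F] by (simp add: sum_distrib_left mult.left_commute)
  qed
  let ?K = "{gmult G a b | a b. a \<in> q ` supp f \<and> b \<in> q ` supp g \<and> src G a = rng G b}"
  show "compactin (gtop G) ?K" using A_compact[OF f] A_compact[OF g] by (rule compactin_product)
  show "q ` supp (f \<star> g) \<subseteq> ?K"
  proof
    fix \<alpha> assume "\<alpha> \<in> q ` supp (f \<star> g)"
    then obtain \<sigma> where \<sigma>: "(f \<star> g) \<sigma> \<noteq> 0" "\<alpha> = q \<sigma>" unfolding supp_def by blast
    then obtain \<tau> where \<tau>: "\<sigma> \<in> arrows S" "\<tau> \<in> arrows S" "rr \<tau> = rr \<sigma>" "f \<tau> \<noteq> 0" "g (iv \<tau> \<odot> \<sigma>) \<noteq> 0"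
      using conv_nonzero[OF f g] by blast
    then have "\<tau> \<odot> (iv \<tau> \<odot> \<sigma>) = \<sigma>" by simp
    then have "\<alpha> = gmult G (q \<tau>) (q (iv \<tau> \<odot> \<sigma>))"
      using q_mult[of \<tau> "iv \<tau> \<odot> \<sigma>"] \<tau>(1-3) \<sigma>(2) by simp
    moreover have "src G (q \<tau>) = rng G (q (iv \<tau> \<odot> \<sigma>))"
      using q_src[OF \<tau>(2)] q_rng[of "iv \<tau> \<odot> \<sigma>"] \<tau>(1-3) by simp
    moreover have "q \<tau> \<in> q ` supp f" "q (iv \<tau> \<odot> \<sigma>) \<in> q ` supp g"
      using \<tau>(4,5) unfolding supp_def by blast+
    ultimately show "\<alpha> \<in> ?K" by blast
  qed
qed

text \<open>
  Both bracketings are double sums over one transversal at the range of \<open>\<sigma>\<close>; left translation by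
  \<open>\<tau>\<^sup>-\<^sup>1\<close> turns it into a transversal at the source of \<open>\<tau>\<close>.
\<close>

lemma conv_assoc:
  assumes f: "f \<in> A" and g: "g \<in> A" and h: "h \<in> A"
  shows "(f \<star> g) \<star> h = f \<star> (g \<star> h)"
proof (rule A_ext)
  show fg_h: "(f \<star> g) \<star> h \<in> A" "f \<star> (g \<star> h) \<in> A" using assms conv_A by blast+
  fix \<sigma> assume \<sigma>: "\<sigma> \<in> arrows S"
  have fg: "f \<star> g \<in> A" and gh: "g \<star> h \<in> A" using assms conv_A by blast+
  obtain F where F: "transversal F (rr \<sigma>)" "covers F f (rr \<sigma>)"
    using covering_transversal[OF f \<sigma>] by blast
  have Fin: "finite F" "\<And>\<tau>. \<tau> \<in> F \<Longrightarrow> \<tau> \<in> arrows S" "\<And>\<tau>. \<tau> \<in> F \<Longrightarrow> rr \<tau> = rr \<sigma>"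
    using F(1) unfolding transversal_def by blast+
  \<comment> \<open>The common transversal \<open>L\<close> lifts the arrows needed to multiply \<open>f \<star> g\<close> by \<open>h\<close>, and all products of
    arrows in the supports of \<open>f\<close> and \<open>g\<close>.\<close>
  let ?Q1 = "{\<alpha> \<in> q ` supp (f \<star> g). rng G \<alpha> = q (rr \<sigma>)}"
  let ?Q2 = "\<Union>\<tau>\<in>F. gmult G (q \<tau>) ` {\<alpha> \<in> q ` supp g. rng G \<alpha> = q (ss \<tau>)}"
  have fin: "finite (?Q1 \<union> ?Q2)" using finite_row[OF fg] finite_row[OF g] Fin(1) by blast
  have Q2: "\<alpha> \<in> arrows G \<and> rng G \<alpha> = q (rr \<sigma>)" if \<alpha>: "\<alpha> \<in> ?Q2" for \<alpha>
  proof -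
    obtain \<tau> \<beta> where *: "\<tau> \<in> F" "\<beta> \<in> q ` supp g" "rng G \<beta> = q (ss \<tau>)" "\<alpha> = gmult G (q \<tau>) \<beta>"
      using \<alpha> by blast
    have \<tau>: "\<tau> \<in> arrows S" "rr \<tau> = rr \<sigma>" using * Fin by blast+
    have \<beta>: "\<beta> \<in> arrows G" using *(2) A_supp[OF g] q_arrow by blast
    have "src G (q \<tau>) = rng G \<beta>" using *(3) q_src[OF \<tau>(1)] by simp
    then show ?thesis using *(4) \<beta> \<tau> q_rng[OF \<tau>(1)] by simp
  qed
  have Q1: "\<alpha> \<in> arrows G \<and> rng G \<alpha> = q (rr \<sigma>)" if "\<alpha> \<in> ?Q1" for \<alpha>
    using that A_supp[OF fg] q_arrow by blast
  have sub: "?Q1 \<union> ?Q2 \<subseteq> arrows G" using Q1 Q2 by blast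
  have rQ: "rng G \<alpha> = q (rr \<sigma>)" if "\<alpha> \<in> ?Q1 \<union> ?Q2" for \<alpha> using Q1 Q2 that by blast
  obtain L where L: "transversal L (rr \<sigma>)" "q ` L = insert (q \<sigma>) (?Q1 \<union> ?Q2)"
    using transversal_exists[OF S.rng_units[OF \<sigma>] fin sub rQ \<sigma> refl] by blast
  have Lin: "finite L" "\<And>\<tau>. \<tau> \<in> L \<Longrightarrow> \<tau> \<in> arrows S" "\<And>\<tau>. \<tau> \<in> L \<Longrightarrow> rr \<tau> = rr \<sigma>" "inj_on q L"
    using L(1) unfolding transversal_def by blast+
  have covL: "covers L (f \<star> g) (rr \<sigma>)"
    unfolding covers_def
  proof (intro ballI impI)
    fix \<tau> assume \<tau>: "\<tau> \<in> arrows S" "rr \<tau> = rr \<sigma> \<and> (f \<star> g) \<tau> \<noteq> 0"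
    have "rng G (q \<tau>) = q (rr \<sigma>)" using \<tau> q_rng[OF \<tau>(1)] by simp
    moreover have "q \<tau> \<in> q ` supp (f \<star> g)" using \<tau>(2) unfolding supp_def by blast
    ultimately show "q \<tau> \<in> q ` L" unfolding L(2) by blast
  qed
  have inner: "(g \<star> h) (iv \<tau> \<odot> \<sigma>) = (\<Sum>\<kappa>\<in>L. g (iv \<tau> \<odot> \<kappa>) * h (iv \<kappa> \<odot> \<sigma>))" if \<tau>F: "\<tau> \<in> F" for \<tau>
  proof -
    have \<tau>: "\<tau> \<in> arrows S" "rr \<tau> = rr \<sigma>" using \<tau>F Fin by blast+
    let ?m = "\<lambda>\<kappa>. iv \<tau> \<odot> \<kappa>"
    have m: "?m \<kappa> \<in> arrows S" "rr (?m \<kappa>) = ss \<tau>" "ss (?m \<kappa>) = ss \<kappa>" "\<tau> \<odot> ?m \<kappa> = \<kappa>"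
      "q (?m \<kappa>) = gmult G (ginv G (q \<tau>)) (q \<kappa>)" if "\<kappa> \<in> arrows S" "rr \<kappa> = rr \<sigma>" for \<kappa>
      using that \<tau> by auto
    have qcancel: "q \<kappa> = q \<mu>" if "\<kappa> \<in> arrows S" "rr \<kappa> = rr \<sigma>" "\<mu> \<in> arrows S" "rr \<mu> = rr \<sigma>"
      "q (?m \<kappa>) = q (?m \<mu>)" for \<kappa> \<mu>
    proof -
      have "q \<kappa> = q (\<tau> \<odot> ?m \<kappa>)" using m(4)[OF that(1,2)] by simp
      also have "\<dots> = gmult G (q \<tau>) (q (?m \<kappa>))" using that(1,2) m \<tau> by (intro q_mult) auto
      also have "\<dots> = gmult G (q \<tau>) (q (?m \<mu>))" using that(5) by simp
      also have "\<dots> = q (\<tau> \<odot> ?m \<mu>)" using that(3,4) m \<tau> by (intro q_mult[symmetric]) auto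
      also have "\<dots> = q \<mu>" using m(4)[OF that(3,4)] by simp
      finally show ?thesis .
    qed
    have inj: "inj_on ?m L"
    proof (rule inj_onI)
      fix \<kappa> \<mu> assume a: "\<kappa> \<in> L" "\<mu> \<in> L" "?m \<kappa> = ?m \<mu>"
      have "\<tau> \<odot> ?m \<kappa> = \<tau> \<odot> ?m \<mu>" by (rule arg_cong[OF a(3)])
      then show "\<kappa> = \<mu>"
        unfolding m(4)[OF Lin(2)[OF a(1)] Lin(3)[OF a(1)]] m(4)[OF Lin(2)[OF a(2)] Lin(3)[OF a(2)]] .
    qed
    have tr: "transversal (?m ` L) (rr (?m \<sigma>))"
      unfolding transversal_def
    proof (intro conjI)
      show "finite (?m ` L)" using Lin(1) by blast
      show "?m ` L \<subseteq> arrows S" using m(1) Lin(2,3) by blast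
      show "\<forall>\<omega>\<in>?m ` L. rr \<omega> = rr (?m \<sigma>)" using m(2) Lin(2,3) \<sigma> by simp
      show "inj_on q (?m ` L)"
      proof (rule inj_onI)
        fix \<omega> \<omega>' assume "\<omega> \<in> ?m ` L" "\<omega>' \<in> ?m ` L" "q \<omega> = q \<omega>'"
        then obtain \<kappa> \<mu> where l: "\<kappa> \<in> L" "\<mu> \<in> L" "\<omega> = ?m \<kappa>" "\<omega>' = ?m \<mu>" "q (?m \<kappa>) = q (?m \<mu>)" by blast
        then have "q \<kappa> = q \<mu>" using qcancel Lin(2,3) by blast
        then have "\<kappa> = \<mu>" using inj_onD[OF Lin(4)] l by blast
        then show "\<omega> = \<omega>'" using l(3,4) by (simp only:)
      qed
    qed
    have cov: "covers (?m ` L) g (rr (?m \<sigma>))"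
      unfolding covers_def
    proof (intro ballI impI)
      fix \<omega> assume "\<omega> \<in> arrows S" "rr \<omega> = rr (?m \<sigma>) \<and> g \<omega> \<noteq> 0"
      then have \<omega>: "\<omega> \<in> arrows S" "rr \<omega> = ss \<tau>" "g \<omega> \<noteq> 0" using m(2)[OF \<sigma> refl] by auto
      have "rng G (q \<omega>) = q (ss \<tau>)" using \<omega> q_rng[OF \<omega>(1)] by simp
      moreover have "q \<omega> \<in> q ` supp g" using \<omega>(3) unfolding supp_def by blast
      ultimately have "gmult G (q \<tau>) (q \<omega>) \<in> q ` L" unfolding L(2) using \<tau>F by blast
      then obtain \<kappa> where \<kappa>: "\<kappa> \<in> L" "q \<kappa> = gmult G (q \<tau>) (q \<omega>)" by force
      have \<tau>\<omega>: "\<tau> \<odot> \<omega> \<in> arrows S" "rr (\<tau> \<odot> \<omega>) = rr \<sigma>" using \<omega>(1,2) \<tau> by auto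
      have "q \<kappa> = q (\<tau> \<odot> \<omega>)" unfolding \<kappa>(2) using \<omega>(1,2) \<tau>(1) by (intro q_mult[symmetric]) auto
      then have "q (?m \<kappa>) = q (?m (\<tau> \<odot> \<omega>))"
        unfolding m(5)[OF Lin(2)[OF \<kappa>(1)] Lin(3)[OF \<kappa>(1)]] m(5)[OF \<tau>\<omega>] by (rule arg_cong)
      also have "?m (\<tau> \<odot> \<omega>) = \<omega>" using \<omega> \<tau> by simp
      finally show "q \<omega> \<in> q ` ?m ` L" using \<kappa>(1) by (metis imageI)
    qed
    have "(g \<star> h) (?m \<sigma>) = (\<Sum>\<omega>\<in>?m ` L. g \<omega> * h (iv \<omega> \<odot> ?m \<sigma>))"
      using m(1)[OF \<sigma> refl] tr cov by (rule conv_eq[OF g h])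
    also have "\<dots> = (\<Sum>\<kappa>\<in>L. g (?m \<kappa>) * h (iv (?m \<kappa>) \<odot> ?m \<sigma>))"
      using sum.reindex[OF inj] by simp
    also have "\<dots> = (\<Sum>\<kappa>\<in>L. g (?m \<kappa>) * h (iv \<kappa> \<odot> \<sigma>))"
    proof (rule sum.cong[OF refl])
      fix \<kappa> assume \<kappa>L: "\<kappa> \<in> L"
      then have \<kappa>: "\<kappa> \<in> arrows S" "rr \<kappa> = rr \<sigma>" using Lin by blast+
      have "iv (?m \<kappa>) \<odot> ?m \<sigma> = (iv \<kappa> \<odot> \<tau>) \<odot> (iv \<tau> \<odot> \<sigma>)" using S.inv_mult[of "iv \<tau>" \<kappa>] \<tau> \<kappa> by simp
      also have "\<dots> = iv \<kappa> \<odot> (\<tau> \<odot> (iv \<tau> \<odot> \<sigma>))" using \<tau> \<kappa> \<sigma> by (intro S.assoc) auto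
      also have "\<dots> = iv \<kappa> \<odot> \<sigma>" using \<tau> \<sigma> by simp
      finally show "g (?m \<kappa>) * h (iv (?m \<kappa>) \<odot> ?m \<sigma>) = g (?m \<kappa>) * h (iv \<kappa> \<odot> \<sigma>)" by simp
    qed
    finally show ?thesis .
  qed
  have left: "(f \<star> g) \<kappa> = (\<Sum>\<tau>\<in>F. f \<tau> * g (iv \<tau> \<odot> \<kappa>))" if "\<kappa> \<in> L" for \<kappa>
    using F Lin(2,3)[OF that] by (intro conv_eq[OF f g]) auto
  have "((f \<star> g) \<star> h) \<sigma> = (\<Sum>\<kappa>\<in>L. (f \<star> g) \<kappa> * h (iv \<kappa> \<odot> \<sigma>))"
    using conv_eq[OF fg h \<sigma> L(1) covL] .
  also have "\<dots> = (\<Sum>\<kappa>\<in>L. \<Sum>\<tau>\<in>F. f \<tau> * (g (iv \<tau> \<odot> \<kappa>) * h (iv \<kappa> \<odot> \<sigma>)))"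
    using left by (intro sum.cong) (auto simp: sum_distrib_right mult.assoc)
  also have "\<dots> = (\<Sum>\<tau>\<in>F. \<Sum>\<kappa>\<in>L. f \<tau> * (g (iv \<tau> \<odot> \<kappa>) * h (iv \<kappa> \<odot> \<sigma>)))" by (rule sum.swap)
  also have "\<dots> = (\<Sum>\<tau>\<in>F. f \<tau> * (g \<star> h) (iv \<tau> \<odot> \<sigma>))"
    using inner by (intro sum.cong) (auto simp: sum_distrib_left)
  also have "\<dots> = (f \<star> (g \<star> h)) \<sigma>" using conv_eq[OF f gh \<sigma> F] by simp
  finally show "((f \<star> g) \<star> h) \<sigma> = (f \<star> (g \<star> h)) \<sigma>" .
qed

end

section \<open>The diagonal subalgebra\<close>

context ample_twist
begin

abbreviation I where "I \<equiv> idems T"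
abbreviation N where "N \<equiv> normalisers T"
abbreviation dag ("_\<^sup>\<dagger>" [1000] 999) where "n\<^sup>\<dagger> \<equiv> dagger T n"

lemma diagonal_A: "b \<in> B \<Longrightarrow> b \<in> A"
  unfolding diagonal_def by simp

lemma diagonal_over_units: "b \<in> B \<Longrightarrow> b \<sigma> \<noteq> 0 \<Longrightarrow> q \<sigma> \<in> units G"
  unfolding diagonal_def supp_def fibre_def by blast

lemma diagonalI:
  assumes "f \<in> A" "\<And>\<sigma>. \<sigma> \<in> arrows S \<Longrightarrow> f \<sigma> \<noteq> 0 \<Longrightarrow> q \<sigma> \<in> units G"
  shows "f \<in> B"
  unfolding diagonal_def supp_def fibre_def using assms A_nonzero_arrow by blast

text \<open>Elements of the diagonal act like diagonal matrices: their range fibres have one entry, at the unit.\<close>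

lemma conv_diagonal_left:
  assumes b: "b \<in> B" and f: "f \<in> A" and \<rho>: "\<rho> \<in> arrows S"
  shows "(b \<star> f) \<rho> = b (rr \<rho>) * f \<rho>"
proof -
  have "transversal {rr \<rho>} (rr \<rho>)" unfolding transversal_def using \<rho> by (simp add: S.units_rng)
  moreover have "covers {rr \<rho>} b (rr \<rho>)"
    unfolding covers_def
  proof (intro ballI impI)
    fix \<tau> assume \<tau>: "\<tau> \<in> arrows S" "rr \<tau> = rr \<rho> \<and> b \<tau> \<noteq> 0"
    then have "q \<tau> \<in> units G" using diagonal_over_units[OF b] by blast
    then have "q \<tau> = q (rr \<rho>)" using q_rng[OF \<tau>(1)] \<tau>(2) G.units_rng by simp
    then show "q \<tau> \<in> q ` {rr \<rho>}" by simp
  qed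
  ultimately have "(b \<star> f) \<rho> = b (rr \<rho>) * f (iv (rr \<rho>) \<odot> \<rho>)"
    using conv_eq[OF diagonal_A[OF b] f \<rho>] by simp
  then show ?thesis using \<rho> by (simp add: S.units_inv)
qed

lemma conv_diagonal_right:
  assumes b: "b \<in> B" and f: "f \<in> A" and \<rho>: "\<rho> \<in> arrows S"
  shows "(f \<star> b) \<rho> = f \<rho> * b (ss \<rho>)"
proof -
  obtain F where F: "transversal F (rr \<rho>)" "covers F f (rr \<rho>)" "\<rho> \<in> F"
    using covering_transversal[OF f \<rho>] by blast
  have Fin: "finite F" "\<And>\<tau>. \<tau> \<in> F \<Longrightarrow> \<tau> \<in> arrows S" "\<And>\<tau>. \<tau> \<in> F \<Longrightarrow> rr \<tau> = rr \<rho>" "inj_on q F"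
    using F(1) unfolding transversal_def by blast+
  have "b (iv \<tau> \<odot> \<rho>) = 0" if \<tau>: "\<tau> \<in> F - {\<rho>}" for \<tau>
  proof (rule ccontr)
    have \<tau>F: "\<tau> \<in> F" using \<tau> by blast
    assume "b (iv \<tau> \<odot> \<rho>) \<noteq> 0"
    then have "q (iv \<tau> \<odot> \<rho>) \<in> units G" by (rule diagonal_over_units[OF b])
    then have "q \<tau> = q \<rho>" by (rule inv_mult_over_unit[OF Fin(2)[OF \<tau>F] \<rho> Fin(3)[OF \<tau>F]])
    then show False using inj_onD[OF Fin(4) _ \<tau>F F(3)] \<tau> by blast
  qed
  then have "(\<Sum>\<tau>\<in>F. f \<tau> * b (iv \<tau> \<odot> \<rho>)) = (\<Sum>\<tau>\<in>{\<rho>}. f \<tau> * b (iv \<tau> \<odot> \<rho>))"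
    using F(3) Fin(1) by (intro sum.mono_neutral_right) auto
  then show ?thesis using conv_eq[OF f diagonal_A[OF b] \<rho> F(1,2)] by (simp add: src_def)
qed

lemma diagonal_ext:
  assumes b: "b \<in> B" "b' \<in> B" and eq: "\<And>x. x \<in> units S \<Longrightarrow> b x = b' x"
  shows "b = b'"
proof (rule A_ext)
  show "b \<in> A" "b' \<in> A" using b diagonal_A by blast+
  fix \<sigma> assume \<sigma>: "\<sigma> \<in> arrows S"
  show "b \<sigma> = b' \<sigma>"
  proof (cases "q \<sigma> \<in> units G")
    case True
    then obtain t where t: "t \<in> runits" "\<sigma> = t \<rhd> rr \<sigma>" using q_unit_iff_act_unit[OF \<sigma>] by blast
    have "b (t \<rhd> rr \<sigma>) = b' (t \<rhd> rr \<sigma>)"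
      using A_act[OF diagonal_A[OF b(1)] t(1), of "rr \<sigma>"] A_act[OF diagonal_A[OF b(2)] t(1), of "rr \<sigma>"]
        eq[OF S.rng_units[OF \<sigma>]] \<sigma> by simp
    then show ?thesis using t(2) by metis
  next
    case False
    then have "b \<sigma> = 0" "b' \<sigma> = 0" using b diagonal_over_units by blast+
    then show ?thesis by simp
  qed
qed

lemma conv_diagonal:
  assumes "b \<in> B" "b' \<in> B" shows "b \<star> b' \<in> B"
proof (rule diagonalI)
  show "b \<star> b' \<in> A" using assms diagonal_A conv_A by blast
  fix \<sigma> assume \<sigma>: "\<sigma> \<in> arrows S" "(b \<star> b') \<sigma> \<noteq> 0"
  then have "b' \<sigma> \<noteq> 0" using conv_diagonal_left[OF assms(1) diagonal_A[OF assms(2)] \<sigma>(1)] by auto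
  then show "q \<sigma> \<in> units G" by (rule diagonal_over_units[OF assms(2)])
qed

lemma conv_diagonal_unit:
  assumes "b \<in> B" "b' \<in> B" "x \<in> units S" shows "(b \<star> b') x = b x * b' x"
  using conv_diagonal_left[OF assms(1) diagonal_A[OF assms(2)] S.units_arrow[OF assms(3)]]
    S.units_rng[OF assms(3)] by simp

lemma conv_diagonal_commute:
  assumes "b \<in> B" "b' \<in> B" shows "b \<star> b' = b' \<star> b"
  using assms by (intro diagonal_ext conv_diagonal) (simp_all add: conv_diagonal_unit mult.commute)

lemma idem_diagonal: "e \<in> I \<Longrightarrow> e \<in> B"
  unfolding idems_def by simp

lemma idem_A: "e \<in> I \<Longrightarrow> e \<in> A"
  by (rule diagonal_A[OF idem_diagonal])

lemma idem_conv: "e \<in> I \<Longrightarrow> e \<star> e = e"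
  unfolding idems_def by simp

text \<open>This is where indecomposability of the ring enters.\<close>

lemma idem_values:
  assumes "e \<in> I" "x \<in> units S" shows "e x = 0 \<or> e x = 1"
proof -
  have "e x * e x = e x"
    using conv_diagonal_unit[OF idem_diagonal idem_diagonal, of e e x] idem_conv[of e] assms by simp
  then show ?thesis using indecomposable unfolding indecomposable_ring_def by blast
qed

lemma one_neq_zero: "(1::'r) \<noteq> 0"
  using indecomposable unfolding indecomposable_ring_def by metis

lemma idemI:
  assumes "e \<in> B" "\<And>x. x \<in> units S \<Longrightarrow> e x = 0 \<or> e x = 1" shows "e \<in> I"
proof -
  have "e \<star> e = e"
  proof (rule diagonal_ext)
    fix x assume x: "x \<in> units S"
    then show "(e \<star> e) x = e x"
      using conv_diagonal_unit[OF assms(1,1) x] assms(2)[OF x] by auto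
  qed (use assms conv_diagonal in auto)
  then show ?thesis unfolding idems_def using assms(1) by simp
qed

lemma idem_indicator:
  assumes K: "openin (unit_top S) K" "compactin (unit_top S) K"
  obtains e where "e \<in> I" "\<And>x. x \<in> units S \<Longrightarrow> e x = (if x \<in> K then 1 else 0)"
proof -
  have Ku: "K \<subseteq> units S" "openin (gtop S) K" using K(1) openin_unit_top_iff by blast+
  have "inj_on rr K" "inj_on ss K"
    using Ku(1) S.units_rng S.units_src by (auto intro!: inj_onI simp: subset_iff)
  moreover have "compactin (gtop S) K" using K(2) unfolding unit_top_def by (simp add: compactin_subtopology)
  ultimately have K': "compact_open_bisection S K"
    unfolding compact_open_bisection_def using Ku bisectionI by blast
  let ?e = "tilde_one T K"
  have "?e \<in> B"
  proof (rule diagonalI[OF tilde_one_A[OF K']])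
    fix \<sigma> assume "?e \<sigma> \<noteq> 0"
    then obtain t x where t: "t \<in> runits" "x \<in> K" "\<sigma> = t \<rhd> x" using tilde_one_nonzero[OF K'] by blast
    then have "x \<in> units S" using Ku by blast
    then show "q \<sigma> \<in> units G" using t q_units S.units_arrow by simp
  qed
  moreover have val: "?e x = (if x \<in> K then 1 else 0)" if x: "x \<in> units S" for x
  proof (cases "x \<in> K")
    case False
    have "rr ` K \<subseteq> K"
    proof
      fix y assume "y \<in> rr ` K"
      then obtain z where "z \<in> K" "y = rr z" by blast
      then show "y \<in> K" using Ku(1) S.units_rng[of z] by auto
    qed
    then have "rr x \<notin> rr ` K" using False S.units_rng[OF x] by auto
    then show ?thesis using tilde_one_zero_row[OF K' S.units_arrow[OF x]] False by simp
  qed (simp add: tilde_one_eq_1[OF K'])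
  ultimately have "?e \<in> I" by (intro idemI) auto
  then show ?thesis using that val by blast
qed

lemma idem_near:
  assumes W: "openin (unit_top S) W" and x: "x \<in> W"
  obtains e where "e \<in> I" "e x = 1" "\<And>y. y \<in> units S \<Longrightarrow> e y \<noteq> 0 \<Longrightarrow> y \<in> W"
proof -
  have W': "openin (gtop S) W" "W \<subseteq> units S" using W openin_unit_top_iff by blast+
  obtain X where X: "compact_open_bisection S X" "x \<in> X" "X \<subseteq> W"
    using compact_open_bisection_basis[OF W'(1) x] by blast
  note XD = compact_open_bisectionD[OF X(1)]
  have Xu: "X \<subseteq> units S" using X(3) W'(2) by blast
  have "openin (unit_top S) X" using XD(2) Xu openin_unit_top_iff by blast
  moreover have "compactin (unit_top S) X"
    using XD(3) Xu unfolding unit_top_def by (simp add: compactin_subtopology)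
  ultimately obtain e where e: "e \<in> I" "\<And>x. x \<in> units S \<Longrightarrow> e x = (if x \<in> X then 1 else 0)"
    using idem_indicator by blast
  show ?thesis
  proof (rule that[OF e(1)])
    show "e x = 1" using e(2)[of x] X(2) Xu by auto
    fix y assume "y \<in> units S" "e y \<noteq> 0"
    then show "y \<in> W" using e(2)[of y] X(3) by (auto split: if_splits)
  qed
qed

text \<open>The set of ranges at which \<open>f - g\<close> is nonzero is closed and does not contain \<open>x\<close>.\<close>

lemma agree_near:
  assumes f: "f \<in> A" and g: "g \<in> A" and x: "x \<in> units S"
    and eq: "\<And>\<tau>. \<tau> \<in> arrows S \<Longrightarrow> rr \<tau> = x \<Longrightarrow> f \<tau> = g \<tau>"
  obtains e where "e \<in> I" "e x = 1" "e \<star> f = e \<star> g"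
proof -
  let ?d = "\<lambda>\<rho>. f \<rho> - g \<rho>"
  have d: "?d \<in> A" using f g by (rule diff_A)
  let ?W = "units S - rr ` supp ?d"
  have "openin (unit_top S) ?W"
    using nonvanishing_ranges(3)[OF d] S.topspace_unit_top by (metis openin_diff openin_topspace)
  moreover have "x \<notin> rr ` supp ?d"
  proof
    assume "x \<in> rr ` supp ?d"
    then obtain \<rho> where \<rho>: "\<rho> \<in> supp ?d" "x = rr \<rho>" by (rule imageE) blast
    then show False using eq[of \<rho>] A_supp[OF d] unfolding supp_def by auto
  qed
  ultimately obtain e where e: "e \<in> I" "e x = 1" "\<And>y. y \<in> units S \<Longrightarrow> e y \<noteq> 0 \<Longrightarrow> y \<in> ?W"
    using idem_near[of ?W x] x by blast
  have "e \<star> f = e \<star> g"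
  proof (rule A_ext)
    show "e \<star> f \<in> A" "e \<star> g \<in> A" using e(1) f g idem_A conv_A by blast+
    fix \<rho> assume \<rho>: "\<rho> \<in> arrows S"
    have "e (rr \<rho>) * f \<rho> = e (rr \<rho>) * g \<rho>"
    proof (cases "e (rr \<rho>) = 0")
      case False
      then have "rr \<rho> \<notin> rr ` supp ?d" using e(3)[OF S.rng_units[OF \<rho>]] by blast
      then have "\<rho> \<notin> supp ?d" by blast
      then show ?thesis unfolding supp_def by simp
    qed simp
    then show "(e \<star> f) \<rho> = (e \<star> g) \<rho>"
      using conv_diagonal_left[OF idem_diagonal[OF e(1)] f \<rho>]
        conv_diagonal_left[OF idem_diagonal[OF e(1)] g \<rho>] by simp
  qed
  then show ?thesis using that e by blast
qed

lemma local_unit: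
  assumes f: "f \<in> A" obtains e where "e \<in> I" "e \<star> f = f"
proof -
  obtain e where e: "e \<in> I" "\<And>x. x \<in> units S \<Longrightarrow> e x = (if x \<in> rr ` supp f then 1 else 0)"
    using idem_indicator[OF nonvanishing_ranges(1,2)[OF f]] by blast
  have "e \<star> f = f"
  proof (rule A_ext)
    show "e \<star> f \<in> A" using e(1) f idem_A conv_A by blast
    fix \<rho> assume \<rho>: "\<rho> \<in> arrows S"
    have "e (rr \<rho>) * f \<rho> = f \<rho>"
    proof (cases "f \<rho> = 0")
      case False
      then have "rr \<rho> \<in> rr ` supp f" unfolding supp_def by blast
      then show ?thesis using e(2)[OF S.rng_units[OF \<rho>]] by simp
    qed simp
    then show "(e \<star> f) \<rho> = f \<rho>" using conv_diagonal_left[OF idem_diagonal[OF e(1)] f \<rho>] by simp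
  qed (rule f)
  then show ?thesis using that e by blast
qed

section \<open>The inverse semigroup of normalisers\<close>

abbreviation NI where "NI \<equiv> normalising_inverse T"

lemma NI_D:
  assumes "NI n k"
  shows NI_A: "k \<in> A" and NI_knk: "(k \<star> n) \<star> k = k" and NI_nkn: "(n \<star> k) \<star> n = n"
    and NI_kbn: "b \<in> B \<Longrightarrow> (k \<star> b) \<star> n \<in> B" and NI_nbk: "b \<in> B \<Longrightarrow> (n \<star> b) \<star> k \<in> B"
  using assms unfolding normalising_inverse_def by blast+

lemma NI_sym: "n \<in> A \<Longrightarrow> NI n k \<Longrightarrow> NI k n"
  unfolding normalising_inverse_def by blast

text \<open>
  By definition the products \<open>n \<star> b \<star> k\<close> with \<open>b \<in> B\<close> lie in the diagonal. As \<open>A\<close> need not have an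
  identity, \<open>n \<star> k\<close> is of this form because some idempotent \<open>b\<close> satisfies \<open>b \<star> k = k\<close>.
\<close>

lemma NI_idem:
  assumes n: "n \<in> A" and k: "NI n k"
  shows NI_idem_left: "n \<star> k \<in> I" and NI_idem_right: "k \<star> n \<in> I"
proof -
  have main: "m \<star> l \<in> I" if m: "m \<in> A" and l: "NI m l" for m l
  proof -
    obtain e where e: "e \<in> I" "e \<star> l = l" using local_unit[OF NI_A[OF l]] by blast
    have "m \<star> l \<in> B"
      using NI_nbk[OF l idem_diagonal[OF e(1)]] conv_assoc[OF m idem_A[OF e(1)] NI_A[OF l]] e(2) by simp
    moreover have "(m \<star> l) \<star> (m \<star> l) = m \<star> l"
      using conv_assoc[OF conv_A[OF m NI_A[OF l]] m NI_A[OF l]] NI_nkn[OF l] by simp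
    ultimately show ?thesis unfolding idems_def by simp
  qed
  show "n \<star> k \<in> I" using main n k by blast
  show "k \<star> n \<in> I" using main NI_A[OF k] NI_sym[OF n k] by blast
qed

text \<open>
  The usual argument for inverse semigroups: the idempotents \<open>n \<star> k\<close> and \<open>n \<star> l\<close> commute, so each
  absorbs the other and they coincide; the same holds for \<open>k \<star> n\<close> and \<open>l \<star> n\<close>.
\<close>

lemma NI_unique:
  assumes n: "n \<in> A" and k: "NI n k" and l: "NI n l"
  shows "k = l"
proof -
  note kA = NI_A[OF k] and lA = NI_A[OF l]
  note [simp] = conv_assoc conv_A n kA lA
  have k1: "k \<star> (n \<star> k) = k" and k2: "n \<star> (k \<star> n) = n" using NI_knk[OF k] NI_nkn[OF k] by simp_all
  have l1: "l \<star> (n \<star> l) = l" and l2: "n \<star> (l \<star> n) = n" using NI_knk[OF l] NI_nkn[OF l] by simp_all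
  have a: "n \<star> k = n \<star> l"
  proof -
    have "n \<star> k = (n \<star> (l \<star> n)) \<star> k" using l2 by simp
    also have "\<dots> = (n \<star> l) \<star> (n \<star> k)" by simp
    also have "\<dots> = (n \<star> k) \<star> (n \<star> l)"
      using NI_idem_left[OF n k] NI_idem_left[OF n l] idem_diagonal conv_diagonal_commute by blast
    also have "\<dots> = (n \<star> (k \<star> n)) \<star> l" by simp
    finally show ?thesis using k2 by simp
  qed
  have b: "k \<star> n = l \<star> n"
  proof -
    have "k \<star> n = k \<star> (n \<star> (l \<star> n))" using l2 by simp
    also have "\<dots> = (k \<star> n) \<star> (l \<star> n)" by simp
    also have "\<dots> = (l \<star> n) \<star> (k \<star> n)"
      using NI_idem_right[OF n k] NI_idem_right[OF n l] idem_diagonal conv_diagonal_commute by blast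
    also have "\<dots> = l \<star> (n \<star> (k \<star> n))" by simp
    finally show ?thesis using k2 by simp
  qed
  have "k = (k \<star> n) \<star> k" using k1 by simp
  also have "\<dots> = l \<star> (n \<star> k)" unfolding b by simp
  also have "\<dots> = l" unfolding a by (rule l1)
  finally show ?thesis .
qed

lemma N_A: "n \<in> N \<Longrightarrow> n \<in> A"
  unfolding normalisers_def by simp

lemma NI_N: "n \<in> A \<Longrightarrow> NI n k \<Longrightarrow> n \<in> N"
  unfolding normalisers_def by blast

lemma dagger_eq: "n \<in> A \<Longrightarrow> NI n k \<Longrightarrow> n\<^sup>\<dagger> = k"
  unfolding dagger_def using NI_unique by (intro the_equality) blast+

lemma NI_dagger: "n \<in> N \<Longrightarrow> NI n (n\<^sup>\<dagger>)"
  using dagger_eq unfolding normalisers_def by auto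

lemma dagger_N: "n \<in> N \<Longrightarrow> n\<^sup>\<dagger> \<in> N"
  using NI_dagger NI_sym NI_A N_A NI_N by blast

lemma dagger_A: "n \<in> N \<Longrightarrow> n\<^sup>\<dagger> \<in> A"
  using dagger_N N_A by blast

lemma dagger_dagger: "n \<in> N \<Longrightarrow> (n\<^sup>\<dagger>)\<^sup>\<dagger> = n"
  using dagger_eq[OF dagger_A NI_sym[OF N_A NI_dagger]] by blast

lemma range_idem: "n \<in> N \<Longrightarrow> n \<star> n\<^sup>\<dagger> \<in> I"
  using NI_idem_left N_A NI_dagger by blast

lemma source_idem: "n \<in> N \<Longrightarrow> n\<^sup>\<dagger> \<star> n \<in> I"
  using NI_idem_right N_A NI_dagger by blast

lemma range_idem_conv: "n \<in> N \<Longrightarrow> (n \<star> n\<^sup>\<dagger>) \<star> n = n"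
  using NI_nkn NI_dagger by blast

lemma NI_conv:
  assumes m: "m \<in> A" and n: "n \<in> A" and k: "NI m k" and l: "NI n l"
  shows "NI (m \<star> n) (l \<star> k)"
proof -
  note kA = NI_A[OF k] and lA = NI_A[OF l]
  note assoc = conv_assoc conv_A m n kA lA
  have comm: "(k \<star> m) \<star> (n \<star> l) = (n \<star> l) \<star> (k \<star> m)"
    using NI_idem_right[OF m k] NI_idem_left[OF n l] idem_diagonal conv_diagonal_commute by blast
  have "((l \<star> k) \<star> (m \<star> n)) \<star> (l \<star> k) = l \<star> (((k \<star> m) \<star> (n \<star> l)) \<star> k)" by (simp add: assoc)
  also have "\<dots> = ((l \<star> n) \<star> l) \<star> ((k \<star> m) \<star> k)" unfolding comm by (simp add: assoc)
  also have "\<dots> = l \<star> k" using NI_knk[OF k] NI_knk[OF l] by simp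
  finally have 1: "((l \<star> k) \<star> (m \<star> n)) \<star> (l \<star> k) = l \<star> k" .
  have "((m \<star> n) \<star> (l \<star> k)) \<star> (m \<star> n) = m \<star> (((n \<star> l) \<star> (k \<star> m)) \<star> n)" by (simp add: assoc)
  also have "\<dots> = ((m \<star> k) \<star> m) \<star> ((n \<star> l) \<star> n)" unfolding comm[symmetric] by (simp add: assoc)
  also have "\<dots> = m \<star> n" using NI_nkn[OF k] NI_nkn[OF l] by simp
  finally have 2: "((m \<star> n) \<star> (l \<star> k)) \<star> (m \<star> n) = m \<star> n" .
  have 3: "((l \<star> k) \<star> b) \<star> (m \<star> n) \<in> B" "((m \<star> n) \<star> b) \<star> (l \<star> k) \<in> B" if b: "b \<in> B" for b
  proof -
    have bA: "b \<in> A" by (rule diagonal_A[OF b])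
    have "(l \<star> ((k \<star> b) \<star> m)) \<star> n \<in> B" using NI_kbn[OF l NI_kbn[OF k b]] .
    then show "((l \<star> k) \<star> b) \<star> (m \<star> n) \<in> B" by (simp add: assoc bA)
    have "(m \<star> ((n \<star> b) \<star> l)) \<star> k \<in> B" using NI_nbk[OF k NI_nbk[OF l b]] .
    then show "((m \<star> n) \<star> b) \<star> (l \<star> k) \<in> B" by (simp add: assoc bA)
  qed
  show ?thesis unfolding normalising_inverse_def using 1 2 3 conv_A[OF lA kA] by blast
qed

lemma conv_N: "m \<in> N \<Longrightarrow> n \<in> N \<Longrightarrow> m \<star> n \<in> N"
  using NI_N[OF conv_A NI_conv] N_A NI_dagger by blast

lemma dagger_conv: "m \<in> N \<Longrightarrow> n \<in> N \<Longrightarrow> (m \<star> n)\<^sup>\<dagger> = n\<^sup>\<dagger> \<star> m\<^sup>\<dagger>"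
  using dagger_eq[OF conv_A NI_conv] N_A NI_dagger by blast

lemma NI_idem_self:
  assumes "e \<in> I" shows "NI e e"
  unfolding normalising_inverse_def
  using assms idem_A idem_conv idem_diagonal conv_diagonal by auto

lemma idem_N: "e \<in> I \<Longrightarrow> e \<in> N"
  using NI_N idem_A NI_idem_self by blast

lemma dagger_idem: "e \<in> I \<Longrightarrow> e\<^sup>\<dagger> = e"
  using dagger_eq idem_A NI_idem_self by blast

lemma scale_N:
  assumes t: "t \<in> runits" and n: "n \<in> N"
  shows "(\<lambda>\<sigma>. t * n \<sigma>) \<in> N"
proof (rule NI_N)
  note nA = N_A[OF n] and kA = dagger_A[OF n] and k = NI_dagger[OF n]
  show "(\<lambda>\<sigma>. t * n \<sigma>) \<in> A" using nA by (rule scale_A)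
  note [simp] = conv_scale_left conv_scale_right scale_A nA kA conv_A diagonal_A
  show "NI (\<lambda>\<sigma>. t * n \<sigma>) (\<lambda>\<sigma>. rinv t * (n\<^sup>\<dagger>) \<sigma>)"
    unfolding normalising_inverse_def
    using t NI_knk[OF k] NI_nkn[OF k] NI_kbn[OF k] NI_nbk[OF k] by simp
qed

text \<open>
  Applied to \<open>m\<close> and to \<open>m'\<close>, this turns agreement near a range into a common lower bound.
\<close>

lemma nle_restrict:
  assumes e: "e \<in> I" and m: "m \<in> N" and m': "m' \<in> N" and eq: "e \<star> m = e \<star> m'"
  shows "nle T (e \<star> m) m'"
proof -
  note A = N_A[OF m] N_A[OF m'] dagger_A[OF m] idem_A[OF e]
  have comm: "(m \<star> m\<^sup>\<dagger>) \<star> e = e \<star> (m \<star> m\<^sup>\<dagger>)"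
    using range_idem[OF m] e idem_diagonal conv_diagonal_commute by blast
  have "((e \<star> m) \<star> (e \<star> m)\<^sup>\<dagger>) \<star> m' = (e \<star> m) \<star> (m\<^sup>\<dagger> \<star> (e \<star> m'))"
    by (simp add: dagger_conv[OF idem_N[OF e] m] dagger_idem[OF e] conv_assoc conv_A A)
  also have "\<dots> = e \<star> (((m \<star> m\<^sup>\<dagger>) \<star> e) \<star> m)" unfolding eq[symmetric] by (simp add: conv_assoc conv_A A)
  also have "\<dots> = (e \<star> e) \<star> ((m \<star> m\<^sup>\<dagger>) \<star> m)" unfolding comm by (simp add: conv_assoc conv_A A)
  also have "\<dots> = e \<star> m" using idem_conv[OF e] range_idem_conv[OF m] by simp
  finally show ?thesis unfolding nle_def by simp
qed

lemma nle_refl: "n \<in> N \<Longrightarrow> nle T n n"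
  unfolding nle_def using range_idem_conv by simp

end

section \<open>Normalisers that are monomial along a range fibre\<close>

context ample_twist
begin

lemma delta_atI:
  assumes "\<sigma> \<in> arrows S" "f \<sigma> = 1"
    and "\<And>\<tau>. \<tau> \<in> arrows S \<Longrightarrow> rr \<tau> = rr \<sigma> \<Longrightarrow> f \<tau> \<noteq> 0 \<Longrightarrow> q \<tau> = q \<sigma>"
  shows "delta_at f \<sigma>"
  unfolding delta_at_def using assms by blast

lemma delta_at_cong:
  assumes "delta_at m \<sigma>" "\<And>\<rho>. \<rho> \<in> arrows S \<Longrightarrow> rr \<rho> = rr \<sigma> \<Longrightarrow> m \<rho> = n \<rho>"
  shows "delta_at n \<sigma>"
proof -
  have "n \<sigma> = 1" using assms delta_at_arrow delta_at_one by metis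
  moreover have "q \<tau> = q \<sigma>" if "\<tau> \<in> arrows S" "rr \<tau> = rr \<sigma>" "n \<tau> \<noteq> 0" for \<tau>
    using delta_at_nonzero[OF assms(1) that(1,2)] assms(2)[OF that(1,2)] that(3) by simp
  ultimately show ?thesis unfolding delta_at_def using delta_at_arrow[OF assms(1)] by blast
qed

lemma delta_at_agree:
  assumes "m \<in> A" "n \<in> A" "delta_at m \<sigma>" "delta_at n \<sigma>" "\<rho> \<in> arrows S" "rr \<rho> = rr \<sigma>"
  shows "m \<rho> = n \<rho>"
proof (cases "q \<rho> = q \<sigma>")
  case True
  note \<sigma> = delta_at_arrow[OF assms(3)]
  obtain t where t: "t \<in> runits" "\<rho> = t \<rhd> \<sigma>" using act_transitive[OF \<sigma> assms(5)] True by metis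
  show ?thesis
    using A_act[OF assms(1) t(1) \<sigma>] A_act[OF assms(2) t(1) \<sigma>]
      delta_at_one[OF assms(3)] delta_at_one[OF assms(4)] t(2) by simp
next
  case False
  then show ?thesis using delta_at_nonzero[OF _ assms(5,6)] assms(3,4) by metis
qed

text \<open>
  Along the range fibre of \<open>\<sigma>\<close>, the product with \<open>n\<close> is translation by \<open>\<sigma>\<close>, so \<open>n\<^sup>\<dagger>\<close> on the
  range fibre of \<open>\<sigma>\<^sup>-\<^sup>1\<close> can be read off from the diagonal element \<open>n \<star> n\<^sup>\<dagger>\<close>.
\<close>

lemma delta_at_dagger:
  assumes n: "n \<in> N" and d: "delta_at n \<sigma>"
  shows delta_at_range_idem: "(n \<star> n\<^sup>\<dagger>) (rr \<sigma>) = 1"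
    and delta_at_inv: "delta_at (n\<^sup>\<dagger>) (iv \<sigma>)"
proof -
  note \<sigma> = delta_at_arrow[OF d]
  note nk = range_idem[OF n, THEN idem_diagonal]
  have "(n \<star> n\<^sup>\<dagger>) (rr \<sigma>) * n \<sigma> = ((n \<star> n\<^sup>\<dagger>) \<star> n) \<sigma>"
    using conv_diagonal_left[OF nk N_A[OF n] \<sigma>] by simp
  then show r: "(n \<star> n\<^sup>\<dagger>) (rr \<sigma>) = 1"
    using range_idem_conv[OF n] delta_at_one[OF d] by simp
  have conv: "(n \<star> n\<^sup>\<dagger>) \<rho> = (n\<^sup>\<dagger>) (iv \<sigma> \<odot> \<rho>)" if "\<rho> \<in> arrows S" "rr \<rho> = rr \<sigma>" for \<rho>
    using conv_delta[OF N_A[OF n] dagger_A[OF n] d that] .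
  have "iv \<sigma> \<odot> rr \<sigma> = iv \<sigma>" using S.mult_src[of "iv \<sigma>"] \<sigma> by simp
  then have "(n\<^sup>\<dagger>) (iv \<sigma>) = 1" using conv[of "rr \<sigma>"] r \<sigma> by (simp add: S.units_rng)
  moreover have "q \<tau> = q (iv \<sigma>)" if \<tau>: "\<tau> \<in> arrows S" "rr \<tau> = rr (iv \<sigma>)" "(n\<^sup>\<dagger>) \<tau> \<noteq> 0" for \<tau>
  proof -
    have e: "ss \<sigma> = rr \<tau>" using \<tau>(2) \<sigma> by simp
    have "(n \<star> n\<^sup>\<dagger>) (\<sigma> \<odot> \<tau>) = (n\<^sup>\<dagger>) \<tau>" using conv[of "\<sigma> \<odot> \<tau>"] \<sigma> \<tau>(1) e by simp
    then have "q (\<sigma> \<odot> \<tau>) \<in> units G" using \<tau>(3) diagonal_over_units[OF nk] by simp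
    then show ?thesis using inv_mult_over_unit[of "iv \<sigma>" \<tau>] \<sigma> \<tau>(1,2) by simp
  qed
  ultimately show "delta_at (n\<^sup>\<dagger>) (iv \<sigma>)" by (rule delta_atI[OF S.inv_arrow[OF \<sigma>]])
qed

lemma delta_at_conv:
  assumes m: "m \<in> A" "delta_at m \<sigma>" and n: "n \<in> A" "delta_at n \<tau>" and st: "ss \<sigma> = rr \<tau>"
  shows "delta_at (m \<star> n) (\<sigma> \<odot> \<tau>)"
proof -
  note \<sigma> = delta_at_arrow[OF m(2)] and \<tau> = delta_at_arrow[OF n(2)]
  have conv: "(m \<star> n) \<rho> = n (iv \<sigma> \<odot> \<rho>)" if "\<rho> \<in> arrows S" "rr \<rho> = rr \<sigma>" for \<rho>
    using conv_delta[OF m(1) n(1) m(2) that] .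
  have "(m \<star> n) (\<sigma> \<odot> \<tau>) = 1" using conv[of "\<sigma> \<odot> \<tau>"] \<sigma> \<tau> st delta_at_one[OF n(2)] by simp
  moreover have "q \<rho> = q (\<sigma> \<odot> \<tau>)"
    if \<rho>: "\<rho> \<in> arrows S" "rr \<rho> = rr (\<sigma> \<odot> \<tau>)" "(m \<star> n) \<rho> \<noteq> 0" for \<rho>
  proof -
    have r: "rr \<rho> = rr \<sigma>" using \<rho>(2) \<sigma> \<tau> st by simp
    have a: "iv \<sigma> \<odot> \<rho> \<in> arrows S" "rr (iv \<sigma> \<odot> \<rho>) = ss \<sigma>" using \<sigma> \<rho>(1) r by auto
    have "q (iv \<sigma> \<odot> \<rho>) = q \<tau>"
      using delta_at_nonzero[OF n(2) a(1)] a(2) st conv[OF \<rho>(1) r] \<rho>(3) by simp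
    then have "q (\<sigma> \<odot> (iv \<sigma> \<odot> \<rho>)) = q (\<sigma> \<odot> \<tau>)"
      using q_mult[OF \<sigma> a(1)] q_mult[OF \<sigma> \<tau> st] a(2) by simp
    moreover have "\<sigma> \<odot> (iv \<sigma> \<odot> \<rho>) = \<rho>" using \<sigma> \<rho>(1) r by simp
    ultimately show ?thesis by simp
  qed
  ultimately show ?thesis by (rule delta_atI[OF S.mult_arrow[OF \<sigma> \<tau> st]])
qed

lemma delta_at_idem_left:
  assumes n: "n \<in> A" "delta_at n \<sigma>" and e: "e \<in> I" "e (rr \<sigma>) = 1"
  shows "delta_at (e \<star> n) \<sigma>"
proof (rule delta_at_cong[OF n(2)])
  fix \<rho> assume "\<rho> \<in> arrows S" "rr \<rho> = rr \<sigma>"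
  then show "n \<rho> = (e \<star> n) \<rho>" using conv_diagonal_left[OF idem_diagonal[OF e(1)] n(1)] e(2) by simp
qed

lemma delta_at_idem_right:
  assumes n: "n \<in> A" "delta_at n \<sigma>" and e: "e \<in> I" "e (ss \<sigma>) = 1"
  shows "delta_at (n \<star> e) \<sigma>"
proof -
  note \<sigma> = delta_at_arrow[OF n(2)]
  have conv: "(n \<star> e) \<rho> = n \<rho> * e (ss \<rho>)" if "\<rho> \<in> arrows S" for \<rho>
    using conv_diagonal_right[OF idem_diagonal[OF e(1)] n(1) that] .
  have "q \<tau> = q \<sigma>" if "\<tau> \<in> arrows S" "rr \<tau> = rr \<sigma>" "(n \<star> e) \<tau> \<noteq> 0" for \<tau>
  proof -
    have "n \<tau> \<noteq> 0" using conv[OF that(1)] that(3) by auto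
    then show ?thesis using delta_at_nonzero[OF n(2) that(1,2)] by simp
  qed
  moreover have "(n \<star> e) \<sigma> = 1" using conv[OF \<sigma>] e(2) delta_at_one[OF n(2)] by simp
  ultimately show ?thesis using delta_atI[OF \<sigma>] by blast
qed

lemma delta_at_idem:
  assumes e: "e \<in> I" and x: "x \<in> units S" "e x = 1"
  shows "delta_at e x"
  unfolding delta_at_def
proof (intro conjI ballI impI)
  show "x \<in> arrows S" by (rule S.units_arrow[OF x(1)])
  show "e x = 1" by (rule x(2))
  fix \<tau> assume \<tau>: "\<tau> \<in> arrows S" "rr \<tau> = rr x \<and> e \<tau> \<noteq> 0"
  then have "q \<tau> \<in> units G" using diagonal_over_units[OF idem_diagonal[OF e]] by blast
  then have "q \<tau> = q (rr \<tau>)" using q_rng[OF \<tau>(1)] G.units_rng by simp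
  then show "q \<tau> = q x" using \<tau>(2) S.units_rng[OF x(1)] by simp
qed

lemma delta_at_tilde_one_iff:
  assumes X: "compact_open_bisection S X"
  shows "delta_at (tilde_one T X) \<sigma> \<longleftrightarrow> \<sigma> \<in> X"
proof
  assume d: "delta_at (tilde_one T X) \<sigma>"
  then have "tilde_one T X \<sigma> \<noteq> 0" using delta_at_one one_neq_zero by metis
  then obtain t \<tau> where t: "t \<in> runits" "\<tau> \<in> X" "\<sigma> = t \<rhd> \<tau>" using tilde_one_nonzero[OF X] by blast
  have "rinv t = 1" using tilde_one_act[OF X t(2,1)] delta_at_one[OF d] t(3) by simp
  then have "t = 1" using rinv_rinv[OF t(1)] by simp
  then show "\<sigma> \<in> X" using t(2,3) compact_open_bisectionD(4)[OF X] by auto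
qed (rule tilde_one_delta[OF X])

text \<open>
  At \<open>\<sigma>\<close>, the element \<open>n\<close> agrees with \<open>tilde_one T X\<close> for a bisection \<open>X\<close> around \<open>\<sigma>\<close>; the agreement
  persists at nearby ranges, where \<open>tilde_one T X\<close> is the delta function at other arrows of \<open>X\<close>.
\<close>

lemma openin_delta_at:
  assumes n: "n \<in> A" shows "openin (gtop S) {\<sigma> \<in> arrows S. delta_at n \<sigma>}"
proof (subst openin_subopen, intro ballI)
  fix \<sigma> assume "\<sigma> \<in> {\<sigma> \<in> arrows S. delta_at n \<sigma>}"
  then have \<sigma>: "\<sigma> \<in> arrows S" "delta_at n \<sigma>" by blast+
  obtain X where X: "compact_open_bisection S X" "\<sigma> \<in> X" using arrow_basis[OF \<sigma>(1)] by blast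
  note XD = compact_open_bisectionD[OF X(1)] and XA = tilde_one_A[OF X(1)]
  obtain e where e: "e \<in> I" "e (rr \<sigma>) = 1" "e \<star> tilde_one T X = e \<star> n"
    using agree_near[OF XA n S.rng_units[OF \<sigma>(1)]]
      delta_at_agree[OF XA n tilde_one_delta[OF X] \<sigma>(2)] by blast
  let ?U = "{x \<in> topspace (gtop S). e x \<in> {1}}"
  let ?W = "X \<inter> {\<tau> \<in> topspace (gtop S). rr \<tau> \<in> ?U}"
  have "openin (gtop S) ?U" by (rule openin_locally_constant_level[OF A_locally_constant[OF idem_A[OF e(1)]]])
  then have "openin (gtop S) ?W"
    using XD(2) openin_continuous_map_preimage[OF S.continuous_rng] by blast
  moreover have "\<sigma> \<in> ?W" using X(2) e(2) \<sigma>(1) S.rng_arrow[OF \<sigma>(1)] unfolding arrows_def by blast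
  moreover have "delta_at n \<tau>" if \<tau>: "\<tau> \<in> ?W" for \<tau>
  proof (rule delta_at_cong)
    have \<tau>X: "\<tau> \<in> X" and e\<tau>: "e (rr \<tau>) = 1" using \<tau> by blast+
    show "delta_at (tilde_one T X) \<tau>" by (rule tilde_one_delta[OF X(1) \<tau>X])
    fix \<rho> assume \<rho>: "\<rho> \<in> arrows S" "rr \<rho> = rr \<tau>"
    have "(e \<star> tilde_one T X) \<rho> = (e \<star> n) \<rho>" using e(3) by simp
    then show "tilde_one T X \<rho> = n \<rho>"
      using conv_diagonal_left[OF idem_diagonal[OF e(1)] XA \<rho>(1)]
        conv_diagonal_left[OF idem_diagonal[OF e(1)] n \<rho>(1)] e\<tau> \<rho>(2) by simp
  qed
  ultimately show "\<exists>W. openin (gtop S) W \<and> \<sigma> \<in> W \<and> W \<subseteq> {\<sigma> \<in> arrows S. delta_at n \<sigma>}"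
    using XD(4) by (intro exI[of _ ?W]) blast
qed

lemma compact_open_bisection_inv:
  assumes X: "compact_open_bisection S X" shows "compact_open_bisection S (iv ` X)"
proof -
  note XD = compact_open_bisectionD[OF X]
  have "openin (gtop S) {\<sigma> \<in> topspace (gtop S). iv \<sigma> \<in> X}"
    using S.continuous_inv XD(2) by (rule openin_continuous_map_preimage)
  also have "{\<sigma> \<in> topspace (gtop S). iv \<sigma> \<in> X} = iv ` X"
  proof (intro equalityI subsetI)
    fix \<sigma> assume "\<sigma> \<in> {\<sigma> \<in> topspace (gtop S). iv \<sigma> \<in> X}"
    then have "iv \<sigma> \<in> X" "\<sigma> \<in> arrows S" unfolding arrows_def by blast+
    then show "\<sigma> \<in> iv ` X" by (intro image_eqI[of _ _ "iv \<sigma>"]) auto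
  next
    fix \<sigma> assume "\<sigma> \<in> iv ` X"
    then obtain \<tau> where \<tau>: "\<tau> \<in> X" "\<sigma> = iv \<tau>" by blast
    then have "\<tau> \<in> arrows S" using XD(4) by blast
    then show "\<sigma> \<in> {\<sigma> \<in> topspace (gtop S). iv \<sigma> \<in> X}"
      using \<tau> S.inv_arrow[of \<tau>] unfolding arrows_def[symmetric] by simp
  qed
  finally have op: "openin (gtop S) (iv ` X)" .
  have "inj_on (rr \<circ> iv) X" "inj_on (ss \<circ> iv) X"
    using XD(4-6) by (simp_all add: inj_on_def subset_iff)
  then have inj: "inj_on rr (iv ` X)" "inj_on ss (iv ` X)" by (auto intro: inj_on_imageI)
  have "compactin (gtop S) (iv ` X)" using XD(3) S.continuous_inv by (rule image_compactin)
  then show ?thesis unfolding compact_open_bisection_def using op bisectionI[OF op inj] by blast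
qed

text \<open>Multiplication by \<open>tilde_one T X\<close> and by \<open>tilde_one T (iv ` X)\<close> are mutually inverse
  translations between range fibres.\<close>

lemma tilde_one_inverse_pair:
  assumes X: "compact_open_bisection S X"
  shows "(tilde_one T X \<star> tilde_one T (iv ` X)) \<star> tilde_one T X = tilde_one T X" (is "(?n \<star> ?k) \<star> ?n = ?n")
    and "b \<in> B \<Longrightarrow> (tilde_one T X \<star> b) \<star> tilde_one T (iv ` X) \<in> B"
proof -
  note XD = compact_open_bisectionD[OF X] and X' = compact_open_bisection_inv[OF X]
  note nA = tilde_one_A[OF X] and kA = tilde_one_A[OF X']
  have n_row: "(?n \<star> g) \<rho> = g (iv \<sigma> \<odot> \<rho>)" if "g \<in> A" "\<sigma> \<in> X" "\<rho> \<in> arrows S" "rr \<rho> = rr \<sigma>" for g \<sigma> \<rho>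
    using conv_delta[OF nA that(1) tilde_one_delta[OF X that(2)] that(3,4)] .
  have n_zero: "(?n \<star> g) \<rho> = 0" if "g \<in> A" "\<rho> \<in> arrows S" "rr \<rho> \<notin> rr ` X" for g \<rho>
  proof (rule conv_zero_row[OF nA that(1,2)])
    fix \<tau> assume "\<tau> \<in> arrows S" "rr \<tau> = rr \<rho>"
    then show "?n \<tau> = 0" using tilde_one_zero_row[OF X, of \<tau>] that(3) by simp
  qed
  have k_delta: "delta_at ?k (iv \<sigma>)" if "\<sigma> \<in> X" for \<sigma>
    using tilde_one_delta[OF X'] that by blast
  have "?n \<star> (?k \<star> ?n) = ?n"
  proof (rule A_ext)
    show "?n \<star> (?k \<star> ?n) \<in> A" using nA kA conv_A by blast
    fix \<rho> assume \<rho>: "\<rho> \<in> arrows S"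
    show "(?n \<star> (?k \<star> ?n)) \<rho> = ?n \<rho>"
    proof (cases "rr \<rho> \<in> rr ` X")
      case True
      then obtain \<sigma> where \<sigma>: "\<sigma> \<in> X" "rr \<rho> = rr \<sigma>" by blast
      have \<sigma>a: "\<sigma> \<in> arrows S" using \<sigma>(1) XD(4) by blast
      have "(?n \<star> (?k \<star> ?n)) \<rho> = (?k \<star> ?n) (iv \<sigma> \<odot> \<rho>)" using n_row[OF conv_A[OF kA nA] \<sigma>(1) \<rho> \<sigma>(2)] .
      also have "\<dots> = ?n (iv (iv \<sigma>) \<odot> (iv \<sigma> \<odot> \<rho>))"
        using \<sigma>a \<sigma>(2) \<rho> by (intro conv_delta[OF kA nA k_delta[OF \<sigma>(1)]]) auto
      also have "\<dots> = ?n \<rho>" using \<sigma>a \<sigma>(2) \<rho> by simp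
      finally show ?thesis .
    next
      case False
      then show ?thesis
        using n_zero[OF conv_A[OF kA nA] \<rho>] tilde_one_zero_row[OF X \<rho>] by simp
    qed
  qed (rule nA)
  then show "(?n \<star> ?k) \<star> ?n = ?n" using conv_assoc[OF nA kA nA] by simp
  assume b: "b \<in> B"
  note bA = diagonal_A[OF b]
  have "?n \<star> (b \<star> ?k) \<in> B"
  proof (rule diagonalI)
    show "?n \<star> (b \<star> ?k) \<in> A" using nA bA kA conv_A by blast
    fix \<rho> assume \<rho>: "\<rho> \<in> arrows S" "(?n \<star> (b \<star> ?k)) \<rho> \<noteq> 0"
    then have "rr \<rho> \<in> rr ` X" using n_zero[OF conv_A[OF bA kA] \<rho>(1)] by blast
    then obtain \<sigma> where \<sigma>: "\<sigma> \<in> X" "rr \<rho> = rr \<sigma>" by blast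
    have \<sigma>a: "\<sigma> \<in> arrows S" using \<sigma>(1) XD(4) by blast
    have a: "iv \<sigma> \<odot> \<rho> \<in> arrows S" "rr (iv \<sigma> \<odot> \<rho>) = rr (iv \<sigma>)" using \<sigma>a \<sigma>(2) \<rho>(1) by auto
    have "(b \<star> ?k) (iv \<sigma> \<odot> \<rho>) \<noteq> 0" using n_row[OF conv_A[OF bA kA] \<sigma>(1) \<rho>(1) \<sigma>(2)] \<rho>(2) by simp
    then have "?k (iv \<sigma> \<odot> \<rho>) \<noteq> 0" using conv_diagonal_left[OF b kA a(1)] by auto
    then have "q (iv \<sigma> \<odot> \<rho>) = q (iv \<sigma>)" using delta_at_nonzero[OF k_delta[OF \<sigma>(1)] a] by simp
    then have "q (\<sigma> \<odot> (iv \<sigma> \<odot> \<rho>)) = q (\<sigma> \<odot> iv \<sigma>)"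
      using q_mult[OF \<sigma>a a(1)] q_mult[OF \<sigma>a S.inv_arrow[OF \<sigma>a]] a(2) \<sigma>a by simp
    moreover have "\<sigma> \<odot> (iv \<sigma> \<odot> \<rho>) = \<rho>" using \<sigma>a \<sigma>(2) \<rho>(1) by simp
    ultimately have "q \<rho> = q (rr \<sigma>)" by (simp add: rng_def)
    then show "q \<rho> \<in> units G" using q_units[OF S.rng_units[OF \<sigma>a]] by simp
  qed
  then show "(?n \<star> b) \<star> ?k \<in> B" using conv_assoc[OF nA bA kA] by simp
qed

lemma tilde_one_N:
  assumes X: "compact_open_bisection S X"
  shows "tilde_one T X \<in> N"
proof (rule NI_N[OF tilde_one_A[OF X]])
  note X' = compact_open_bisection_inv[OF X]
  have "iv ` iv ` X = X"
  proof -
    have "iv (iv \<sigma>) = \<sigma>" if "\<sigma> \<in> X" for \<sigma>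
      using that compact_open_bisectionD(4)[OF X] by auto
    then show ?thesis by (simp add: image_image)
  qed
  then show "NI (tilde_one T X) (tilde_one T (iv ` X))"
    unfolding normalising_inverse_def
    using tilde_one_A[OF X'] tilde_one_inverse_pair[OF X] tilde_one_inverse_pair[OF X'] by simp
qed

section \<open>The ultrafilter at an arrow\<close>

text \<open>
  For \<open>\<sigma> \<in> X\<close> this is \<open>Phi_at T X \<sigma>\<close>, described without a bisection. Range fibres fit the order on
  normalisers, which is defined by multiplication with idempotents on the left.
\<close>

definition arrow_filter :: "'a \<Rightarrow> ('a \<Rightarrow> 'r) set"
  where "arrow_filter \<sigma> = {n \<in> N. delta_at n \<sigma>}"

lemma arrow_filterD:
  "m \<in> arrow_filter \<sigma> \<Longrightarrow> m \<in> N" "m \<in> arrow_filter \<sigma> \<Longrightarrow> delta_at m \<sigma>"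
  "m \<in> arrow_filter \<sigma> \<Longrightarrow> m \<in> A"
  unfolding arrow_filter_def using N_A by auto

lemma arrow_filterI: "m \<in> N \<Longrightarrow> delta_at m \<sigma> \<Longrightarrow> m \<in> arrow_filter \<sigma>"
  unfolding arrow_filter_def by simp

lemma tilde_one_arrow_filter: "compact_open_bisection S X \<Longrightarrow> \<sigma> \<in> X \<Longrightarrow> tilde_one T X \<in> arrow_filter \<sigma>"
  using arrow_filterI tilde_one_N tilde_one_delta by blast

lemma arrow_filter_nonempty: "\<sigma> \<in> arrows S \<Longrightarrow> arrow_filter \<sigma> \<noteq> {}"
  using arrow_basis tilde_one_arrow_filter by (metis empty_iff)

lemma arrow_filter_upward:
  assumes m: "m \<in> arrow_filter \<sigma>" and n: "n \<in> N" and le: "nle T m n"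
  shows "n \<in> arrow_filter \<sigma>"
proof (rule arrow_filterI[OF n], rule delta_at_cong[OF arrow_filterD(2)[OF m]])
  fix \<rho> assume \<rho>: "\<rho> \<in> arrows S" "rr \<rho> = rr \<sigma>"
  have "m \<rho> = ((m \<star> m\<^sup>\<dagger>) \<star> n) \<rho>" using le unfolding nle_def by metis
  also have "\<dots> = (m \<star> m\<^sup>\<dagger>) (rr \<sigma>) * n \<rho>"
    using conv_diagonal_left[OF idem_diagonal[OF range_idem[OF arrow_filterD(1)[OF m]]] N_A[OF n] \<rho>(1)] \<rho>(2) by simp
  also have "\<dots> = n \<rho>"
    using delta_at_range_idem[OF arrow_filterD(1)[OF m] arrow_filterD(2)[OF m]] by simp
  finally show "m \<rho> = n \<rho>" .
qed

lemma arrow_filter_common_restriction: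
  assumes m: "m \<in> arrow_filter \<sigma>" and n: "n \<in> arrow_filter \<sigma>"
  obtains e where "e \<in> I" "e (rr \<sigma>) = 1" "e \<star> m = e \<star> n" "e \<star> m \<in> arrow_filter \<sigma>"
    "nle T (e \<star> m) m" "nle T (e \<star> m) n"
proof -
  note mD = arrow_filterD[OF m] and nD = arrow_filterD[OF n]
  obtain e where e: "e \<in> I" "e (rr \<sigma>) = 1" "e \<star> m = e \<star> n"
    using agree_near[OF mD(3) nD(3) S.rng_units[OF delta_at_arrow[OF mD(2)]]]
      delta_at_agree[OF mD(3) nD(3) mD(2) nD(2)] by blast
  have "e \<star> m \<in> arrow_filter \<sigma>"
    using arrow_filterI conv_N[OF idem_N[OF e(1)] mD(1)] delta_at_idem_left[OF mD(3,2) e(1,2)] by blast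
  then show ?thesis
    using that e nle_restrict[OF e(1) mD(1) mD(1)] nle_restrict[OF e(1) mD(1) nD(1) e(3)] by blast
qed

lemma arrow_filter_nfilter: "nfilter T (arrow_filter \<sigma>)"
  unfolding nfilter_def
proof (intro conjI ballI)
  show "arrow_filter \<sigma> \<subseteq> N - {\<lambda>_. 0}"
  proof
    fix m assume m: "m \<in> arrow_filter \<sigma>"
    then have "m \<sigma> \<noteq> 0" using delta_at_one[OF arrow_filterD(2)] one_neq_zero by metis
    then show "m \<in> N - {\<lambda>_. 0}" using arrow_filterD(1)[OF m] by auto
  qed
  show "arrow_filter \<sigma> = upset T (arrow_filter \<sigma>)"
    unfolding upset_def using arrow_filter_upward arrow_filterD(1) nle_refl by blast
  fix m n assume "m \<in> arrow_filter \<sigma>" "n \<in> arrow_filter \<sigma>"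
  then show "\<exists>k\<in>arrow_filter \<sigma>. nle T k m \<and> nle T k n"
    using arrow_filter_common_restriction by metis
qed

lemma nfilterD:
  assumes "nfilter T V"
  shows "V \<subseteq> N" "(\<lambda>_. 0) \<notin> V" "\<And>m n. m \<in> V \<Longrightarrow> n \<in> V \<Longrightarrow> \<exists>k\<in>V. nle T k m \<and> nle T k n"
    "m \<in> V \<Longrightarrow> n \<in> N \<Longrightarrow> nle T m n \<Longrightarrow> n \<in> V"
proof -
  show "V \<subseteq> N" "(\<lambda>_. 0) \<notin> V" "\<And>m n. m \<in> V \<Longrightarrow> n \<in> V \<Longrightarrow> \<exists>k\<in>V. nle T k m \<and> nle T k n"
    using assms unfolding nfilter_def by blast+
  assume "m \<in> V" "n \<in> N" "nle T m n"
  then have "n \<in> upset T V" unfolding upset_def by blast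
  then show "n \<in> V" using assms unfolding nfilter_def by blast
qed

text \<open>A lower bound \<open>k\<close> of \<open>m\<close> is the product of \<open>m\<close> with an idempotent, whose values are 0 and 1.\<close>

lemma nle_values:
  assumes k: "k \<in> N" and m: "m \<in> A" and le: "nle T k m" and nz: "k \<omega> \<noteq> 0"
    and \<rho>: "\<rho> \<in> arrows S" "rr \<rho> = rr \<omega>"
  shows "k \<rho> = m \<rho>"
proof -
  have \<omega>: "\<omega> \<in> arrows S" using A_nonzero_arrow[OF N_A[OF k] nz] .
  let ?e = "k \<star> k\<^sup>\<dagger>"
  have e: "?e \<in> I" by (rule range_idem[OF k])
  have km: "k = ?e \<star> m" using le unfolding nle_def .
  have val: "k \<tau> = ?e (rr \<tau>) * m \<tau>" if "\<tau> \<in> arrows S" for \<tau>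
    using fun_cong[OF km, of \<tau>] conv_diagonal_left[OF idem_diagonal[OF e] m that] by (rule trans)
  have "?e (rr \<omega>) \<noteq> 0"
  proof
    assume "?e (rr \<omega>) = 0"
    then show False using val[OF \<omega>] nz by simp
  qed
  then have "?e (rr \<rho>) = 1" using idem_values[OF e S.rng_units[OF \<omega>]] \<rho>(2) by metis
  then show ?thesis using val[OF \<rho>(1)] by simp
qed

text \<open>
  Suppose a larger filter contained an element \<open>m\<close> that differs from some \<open>n\<close> in the arrow filter
  along the range fibre of \<open>\<sigma>\<close>. Then they differ along all nearby range fibres. Cutting \<open>n\<close>
  down to these fibres leaves an element of the filter whose common lower bounds with \<open>m\<close> vanish.
\<close>

lemma arrow_filter_maximal:
  assumes \<sigma>: "\<sigma> \<in> arrows S" and V: "nfilter T V" "arrow_filter \<sigma> \<subseteq> V"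
  shows "V \<subseteq> arrow_filter \<sigma>"
proof
  fix m assume m: "m \<in> V"
  have mN: "m \<in> N" using nfilterD(1)[OF V(1)] m by blast
  note mA = N_A[OF mN]
  obtain n where n: "n \<in> arrow_filter \<sigma>" using arrow_filter_nonempty[OF \<sigma>] by blast
  note nD = arrow_filterD[OF n]
  have "n \<rho> = m \<rho>" if \<rho>: "\<rho> \<in> arrows S" "rr \<rho> = rr \<sigma>" for \<rho>
  proof (rule ccontr)
    assume ne: "n \<rho> \<noteq> m \<rho>"
    let ?d = "\<lambda>\<rho>. n \<rho> - m \<rho>"
    have d: "?d \<in> A" using nD(3) mA by (rule diff_A)
    have "\<rho> \<in> supp ?d" using ne unfolding supp_def by simp
    then have "rr \<sigma> \<in> rr ` supp ?d" using \<rho>(2) by (metis imageI)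
    then obtain e where e: "e \<in> I" "e (rr \<sigma>) = 1" "\<And>y. y \<in> units S \<Longrightarrow> e y \<noteq> 0 \<Longrightarrow> y \<in> rr ` supp ?d"
      using idem_near[OF nonvanishing_ranges(1)[OF d]] by blast
    have enN: "e \<star> n \<in> N" by (rule conv_N[OF idem_N[OF e(1)] nD(1)])
    have "e \<star> n \<in> arrow_filter \<sigma>"
      using arrow_filterI[OF enN] delta_at_idem_left[OF nD(3,2) e(1,2)] by blast
    then obtain k where k: "k \<in> V" "nle T k m" "nle T k (e \<star> n)"
      using nfilterD(3)[OF V(1) m] V(2) by blast
    have kN: "k \<in> N" using k(1) nfilterD(1)[OF V(1)] by blast
    have "k \<noteq> (\<lambda>_. 0)" using k(1) nfilterD(2)[OF V(1)] by metis
    then obtain \<omega> where \<omega>: "k \<omega> \<noteq> 0" by blast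
    have \<omega>a: "\<omega> \<in> arrows S" using A_nonzero_arrow[OF N_A[OF kN] \<omega>] .
    have en: "(e \<star> n) \<tau> = e (rr \<tau>) * n \<tau>" if "\<tau> \<in> arrows S" for \<tau>
      using conv_diagonal_left[OF idem_diagonal[OF e(1)] nD(3) that] .
    have "k \<omega> = (e \<star> n) \<omega>" using nle_values[OF kN N_A[OF enN] k(3) \<omega> \<omega>a refl] .
    then have e\<omega>: "e (rr \<omega>) \<noteq> 0" using \<omega> en[OF \<omega>a] by auto
    then have e1: "e (rr \<omega>) = 1" using idem_values[OF e(1) S.rng_units[OF \<omega>a]] by blast
    have "rr \<omega> \<in> rr ` supp ?d" using e(3)[OF S.rng_units[OF \<omega>a] e\<omega>] .
    then obtain \<tau> where \<tau>: "\<tau> \<in> supp ?d" "rr \<omega> = rr \<tau>" by (rule imageE)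
    have \<tau>a: "\<tau> \<in> arrows S" using A_supp[OF d] \<tau>(1) by blast
    have "m \<tau> = k \<tau>" using nle_values[OF kN mA k(2) \<omega> \<tau>a] \<tau>(2) by simp
    also have "\<dots> = (e \<star> n) \<tau>" using nle_values[OF kN N_A[OF enN] k(3) \<omega> \<tau>a] \<tau>(2) by simp
    also have "\<dots> = n \<tau>" using en[OF \<tau>a] e1 \<tau>(2) by simp
    finally show False using \<tau>(1) unfolding supp_def by simp
  qed
  then have "delta_at m \<sigma>" using delta_at_cong[OF nD(2)] by blast
  then show "m \<in> arrow_filter \<sigma>" by (rule arrow_filterI[OF mN])
qed

lemma arrow_filter_ultrafilter: "\<sigma> \<in> arrows S \<Longrightarrow> arrow_filter \<sigma> \<in> ultrafilters T"
  unfolding ultrafilters_def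
  using arrow_filter_nonempty arrow_filter_nfilter arrow_filter_maximal by blast

text \<open>
  Lower bounds have smaller sets of ranges, so by compactness some range supports all elements of
  the ultrafilter. Along its fibre every element agrees with \<open>n\<close>, because both agree with a common
  lower bound. This is used for \<open>n = tilde_one T X\<close> and for idempotents \<open>n\<close>.
\<close>

lemma ultrafilter_with_monomial:
  assumes U: "U \<in> ultrafilters T" and n: "n \<in> U"
    and mono: "\<And>\<omega>. n \<omega> \<noteq> 0 \<Longrightarrow> \<exists>\<tau>. delta_at n \<tau> \<and> rr \<tau> = rr \<omega>"
  obtains \<sigma> where "delta_at n \<sigma>" "U = arrow_filter \<sigma>"
proof -
  have F: "nfilter T U" and max: "\<And>V. nfilter T V \<Longrightarrow> U \<subseteq> V \<Longrightarrow> V = U"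
    using U unfolding ultrafilters_def by blast+
  have UN: "k \<in> N" if "k \<in> U" for k using nfilterD(1)[OF F] that by blast
  have UA: "k \<in> A" if "k \<in> U" for k using N_A[OF UN[OF that]] .
  have nz: "\<exists>\<omega>. k \<omega> \<noteq> 0" if "k \<in> U" for k
  proof (rule ccontr)
    assume "\<nexists>\<omega>. k \<omega> \<noteq> 0"
    then have "k = (\<lambda>_. 0)" by blast
    then show False using nfilterD(2)[OF F] that by metis
  qed
  let ?E = "\<lambda>k. rr ` supp k"
  have lower: "?E k \<subseteq> ?E m" if "k \<in> U" "m \<in> U" "nle T k m" for k m
  proof
    fix x assume "x \<in> ?E k"
    then obtain \<omega> where \<omega>: "k \<omega> \<noteq> 0" "x = rr \<omega>" unfolding supp_def by blast
    have "\<omega> \<in> arrows S" using A_nonzero_arrow[OF UA[OF that(1)] \<omega>(1)] .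
    then have "k \<omega> = m \<omega>" using nle_values[OF UN[OF that(1)] UA[OF that(2)] that(3) \<omega>(1)] by blast
    then show "x \<in> ?E m" using \<omega> unfolding supp_def by auto
  qed
  have "?E n \<inter> \<Inter>(?E ` U) \<noteq> {}"
  proof -
    have fip: "?E n \<inter> \<Inter>\<F> \<noteq> {}" if "finite \<F>" "\<F> \<subseteq> ?E ` U" for \<F>
    proof -
      have "\<exists>k\<in>U. ?E k \<subseteq> ?E n \<inter> \<Inter>\<F>" using that
      proof (induction \<F> rule: finite_induct)
        case empty
        then show ?case using n by auto
      next
        case (insert C \<F>)
        then obtain k m where km: "k \<in> U" "?E k \<subseteq> ?E n \<inter> \<Inter>\<F>" "m \<in> U" "C = ?E m" by blast
        then obtain l where l: "l \<in> U" "nle T l k" "nle T l m" using nfilterD(3)[OF F] by blast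
        have "?E l \<subseteq> ?E k" "?E l \<subseteq> ?E m" using lower l km by blast+
        then show ?case using l(1) km(2,4) by blast
      qed
      then obtain k where k: "k \<in> U" "?E k \<subseteq> ?E n \<inter> \<Inter>\<F>" by blast
      have "?E k \<noteq> {}" using nz[OF k(1)] unfolding supp_def by blast
      then show ?thesis using k(2) by blast
    qed
    have "\<forall>C\<in>?E ` U. closedin (unit_top S) C" using nonvanishing_ranges(3) UA by blast
    then have "(\<forall>C\<in>?E ` U. closedin (unit_top S) C) \<and>
        (\<forall>\<F>. finite \<F> \<and> \<F> \<subseteq> ?E ` U \<longrightarrow> ?E n \<inter> \<Inter>\<F> \<noteq> {})"
      using fip by (intro conjI allI impI) (assumption, elim conjE)
    with nonvanishing_ranges(2)[OF UA[OF n], unfolded compactin_fip, THEN conjunct2, THEN spec, of "?E ` U"]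
    show ?thesis by (rule mp)
  qed
  then obtain x where x: "x \<in> ?E n" "\<And>k. k \<in> U \<Longrightarrow> x \<in> ?E k" by blast
  then obtain \<omega> where "n \<omega> \<noteq> 0" "x = rr \<omega>" unfolding supp_def by blast
  then obtain \<sigma> where \<sigma>: "delta_at n \<sigma>" "rr \<sigma> = x" using mono by metis
  have "U \<subseteq> arrow_filter \<sigma>"
  proof
    fix m assume m: "m \<in> U"
    obtain k where k: "k \<in> U" "nle T k m" "nle T k n" using nfilterD(3)[OF F m n] by blast
    obtain \<omega>' where \<omega>': "k \<omega>' \<noteq> 0" "rr \<sigma> = rr \<omega>'" using x(2)[OF k(1)] \<sigma>(2) unfolding supp_def by blast
    have "n \<rho> = m \<rho>" if \<rho>: "\<rho> \<in> arrows S" "rr \<rho> = rr \<sigma>" for \<rho>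
      using nle_values[OF UN[OF k(1)] UA[OF m] k(2) \<omega>'(1) \<rho>(1)]
        nle_values[OF UN[OF k(1)] UA[OF n] k(3) \<omega>'(1) \<rho>(1)] \<rho>(2) \<omega>'(2) by simp
    then have "delta_at m \<sigma>" using delta_at_cong[OF \<sigma>(1)] by blast
    then show "m \<in> arrow_filter \<sigma>" by (rule arrow_filterI[OF UN[OF m]])
  qed
  then have "arrow_filter \<sigma> = U" using max[OF arrow_filter_nfilter] by blast
  then show ?thesis using that \<sigma>(1) by blast
qed

end

section \<open>The embedding into the groupoid of ultrafilters\<close>

context ample_twist
begin

abbreviation \<U> where "\<U> \<equiv> ultrafilter_groupoid T"

text \<open>
  Restricting \<open>tilde_one T X\<close> by an idempotent on the left, where \<open>agree_near\<close> provides one, amounts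
  to restricting it by the conjugate idempotent on the right, as in the definition of \<open>Phi_at\<close>.
\<close>

lemma Phi_at_eq_arrow_filter:
  assumes X: "compact_open_bisection S X" and \<sigma>X: "\<sigma> \<in> X"
  shows "Phi_at T X \<sigma> = arrow_filter \<sigma>"
proof (intro equalityI subsetI)
  let ?n = "tilde_one T X"
  have n: "?n \<in> arrow_filter \<sigma>" using tilde_one_arrow_filter[OF X \<sigma>X] .
  note nD = arrow_filterD[OF n]
  note \<sigma> = delta_at_arrow[OF nD(2)]
  fix m
  {
    assume "m \<in> Phi_at T X \<sigma>"
    then obtain e where m: "m \<in> N" "nle T (?n \<star> e) m" and e: "e \<in> I" "e (ss \<sigma>) = 1"
      unfolding Phi_at_def upset_def point_ultrafilter_def by blast
    have "?n \<star> e \<in> arrow_filter \<sigma>"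
      using arrow_filterI conv_N[OF nD(1) idem_N[OF e(1)]] delta_at_idem_right[OF nD(3,2) e] by blast
    then show "m \<in> arrow_filter \<sigma>" using arrow_filter_upward m by blast
  }
  assume m: "m \<in> arrow_filter \<sigma>"
  obtain e where e: "e \<in> I" "e \<star> ?n \<in> arrow_filter \<sigma>" "nle T (e \<star> ?n) m"
    using arrow_filter_common_restriction[OF n m] by metis
  let ?p = "e \<star> ?n"
  note pD = arrow_filterD[OF e(2)]
  \<comment> \<open>Conjugation by \<open>?n\<close> carries the idempotent \<open>e\<close> at the range to one at the source.\<close>
  let ?d = "?p\<^sup>\<dagger> \<star> ?p"
  have dI: "?d \<in> I" by (rule source_idem[OF pD(1)])
  have "(?p\<^sup>\<dagger> \<star> (?p\<^sup>\<dagger>)\<^sup>\<dagger>) (rr (iv \<sigma>)) = 1"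
    using delta_at_range_idem[OF dagger_N[OF pD(1)] delta_at_inv[OF pD(1,2)]] .
  then have d1: "?d (ss \<sigma>) = 1" using dagger_dagger[OF pD(1)] \<sigma> by simp
  have "?n \<star> ?d = ?p"
  proof -
    note A = nD(3) dagger_A[OF nD(1)] idem_A[OF e(1)]
    have comm: "(?n \<star> ?n\<^sup>\<dagger>) \<star> e = e \<star> (?n \<star> ?n\<^sup>\<dagger>)"
      using range_idem[OF nD(1)] e(1) idem_diagonal conv_diagonal_commute by blast
    have "?n \<star> ?d = ((?n \<star> ?n\<^sup>\<dagger>) \<star> e) \<star> (e \<star> ?n)"
      by (simp add: dagger_conv[OF idem_N[OF e(1)] nD(1)] dagger_idem[OF e(1)] conv_assoc conv_A A)
    also have "\<dots> = e \<star> ((?n \<star> ?n\<^sup>\<dagger>) \<star> (e \<star> ?n))" unfolding comm by (simp add: conv_assoc conv_A A)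
    also have "\<dots> = e \<star> (((?n \<star> ?n\<^sup>\<dagger>) \<star> e) \<star> ?n)" by (simp add: conv_assoc conv_A A)
    also have "\<dots> = (e \<star> e) \<star> ((?n \<star> ?n\<^sup>\<dagger>) \<star> ?n)" unfolding comm by (simp add: conv_assoc conv_A A)
    also have "\<dots> = ?p" using idem_conv[OF e(1)] range_idem_conv[OF nD(1)] by simp
    finally show ?thesis .
  qed
  moreover have "?d \<in> point_ultrafilter T (ss \<sigma>)" unfolding point_ultrafilter_def using dI d1 by blast
  ultimately have "?p \<in> conv T ?n ` point_ultrafilter T (ss \<sigma>)" by (metis imageI)
  then show "m \<in> Phi_at T X \<sigma>"
    unfolding Phi_at_def upset_def using arrow_filterD(1)[OF m] e(3) by blast
qed

lemma Phi_eq_arrow_filter: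
  assumes "\<sigma> \<in> arrows S" shows "Phi T \<sigma> = arrow_filter \<sigma>"
proof -
  have "\<exists>X. compact_open_bisection S X \<and> \<sigma> \<in> X" using arrow_basis[OF assms] by blast
  from someI_ex[OF this] show ?thesis unfolding Phi_def using Phi_at_eq_arrow_filter by blast
qed

lemma scale_arrow_filter:
  assumes t: "t \<in> runits" and m: "m \<in> arrow_filter \<sigma>"
  shows "(\<lambda>\<rho>. t * m \<rho>) \<in> arrow_filter (t \<rhd> \<sigma>)"
proof (rule arrow_filterI[OF scale_N[OF t arrow_filterD(1)[OF m]]])
  note d = arrow_filterD(2)[OF m]
  note \<sigma> = delta_at_arrow[OF d]
  show "delta_at (\<lambda>\<rho>. t * m \<rho>) (t \<rhd> \<sigma>)"
    unfolding delta_at_def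
  proof (intro conjI ballI impI)
    show "t \<rhd> \<sigma> \<in> arrows S" using t \<sigma> by simp
    show "t * m (t \<rhd> \<sigma>) = 1"
      using A_act[OF arrow_filterD(3)[OF m] t \<sigma>] delta_at_one[OF d] t by simp
    fix \<tau> assume \<tau>: "\<tau> \<in> arrows S" "rr \<tau> = rr (t \<rhd> \<sigma>) \<and> t * m \<tau> \<noteq> 0"
    then have "rr \<tau> = rr \<sigma>" "m \<tau> \<noteq> 0" using t \<sigma> by auto
    then show "q \<tau> = q (t \<rhd> \<sigma>)" using delta_at_nonzero[OF d \<tau>(1)] t \<sigma> by simp
  qed
qed

lemma arrow_filter_act:
  assumes t: "t \<in> runits" and \<sigma>: "\<sigma> \<in> arrows S"
  shows "arrow_filter (t \<rhd> \<sigma>) = uact t (arrow_filter \<sigma>)"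
proof (intro equalityI subsetI)
  fix m assume m: "m \<in> arrow_filter (t \<rhd> \<sigma>)"
  let ?m = "\<lambda>\<rho>. rinv t * m \<rho>"
  have "?m \<in> arrow_filter \<sigma>"
    using scale_arrow_filter[OF rinv_runits[OF t] m] act_rinv(2)[OF t \<sigma>] by simp
  moreover have "m = (\<lambda>\<rho>. t * ?m \<rho>)" using t by simp
  ultimately show "m \<in> uact t (arrow_filter \<sigma>)"
    unfolding uact_def by (intro image_eqI[where f = "\<lambda>m \<sigma>. t * m \<sigma>" and x = ?m])
next
  fix m assume "m \<in> uact t (arrow_filter \<sigma>)"
  then obtain n where n: "n \<in> arrow_filter \<sigma>" "m = (\<lambda>\<rho>. t * n \<rho>)" unfolding uact_def by blast
  show "m \<in> arrow_filter (t \<rhd> \<sigma>)" unfolding n(2) by (rule scale_arrow_filter[OF t n(1)])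
qed

text \<open>
  Only \<open>arrow_filter (\<sigma> \<odot> \<tau>) \<subseteq> upset \<dots>\<close> needs an argument: each \<open>p\<close> in the filter lies above
  \<open>(e \<star> m) \<star> n\<close> for a small idempotent \<open>e\<close>, and \<open>e \<star> m\<close> still belongs to the filter of \<open>\<sigma>\<close>.
\<close>

lemma arrow_filter_mult:
  assumes \<sigma>: "\<sigma> \<in> arrows S" and \<tau>: "\<tau> \<in> arrows S" and st: "ss \<sigma> = rr \<tau>"
  shows "upset T {m \<star> n | m n. m \<in> arrow_filter \<sigma> \<and> n \<in> arrow_filter \<tau>} = arrow_filter (\<sigma> \<odot> \<tau>)"
proof (intro equalityI subsetI)
  have mult: "m \<star> n \<in> arrow_filter (\<sigma> \<odot> \<tau>)" if m: "m \<in> arrow_filter \<sigma>" and n: "n \<in> arrow_filter \<tau>" for m n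
    using arrow_filterI[OF conv_N[OF arrow_filterD(1)[OF m] arrow_filterD(1)[OF n]]]
      delta_at_conv[OF arrow_filterD(3)[OF m] arrow_filterD(2)[OF m] arrow_filterD(3)[OF n] arrow_filterD(2)[OF n] st]
    by blast
  fix p
  {
    assume "p \<in> upset T {m \<star> n | m n. m \<in> arrow_filter \<sigma> \<and> n \<in> arrow_filter \<tau>}"
    then obtain m n where "m \<in> arrow_filter \<sigma>" "n \<in> arrow_filter \<tau>" "p \<in> N" "nle T (m \<star> n) p"
      unfolding upset_def by blast
    then show "p \<in> arrow_filter (\<sigma> \<odot> \<tau>)" using mult arrow_filter_upward by blast
  }
  assume p: "p \<in> arrow_filter (\<sigma> \<odot> \<tau>)"
  obtain m where m: "m \<in> arrow_filter \<sigma>" using arrow_filter_nonempty[OF \<sigma>] by blast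
  obtain n where n: "n \<in> arrow_filter \<tau>" using arrow_filter_nonempty[OF \<tau>] by blast
  obtain e where e: "e \<in> I" "e (rr (\<sigma> \<odot> \<tau>)) = 1" "nle T (e \<star> (m \<star> n)) p"
    using arrow_filter_common_restriction[OF mult[OF m n] p] by metis
  have e1: "e (rr \<sigma>) = 1" using e(2) \<sigma> \<tau> st by simp
  have "e \<star> m \<in> arrow_filter \<sigma>"
    using arrow_filterI[OF conv_N[OF idem_N[OF e(1)] arrow_filterD(1)[OF m]]]
      delta_at_idem_left[OF arrow_filterD(3)[OF m] arrow_filterD(2)[OF m] e(1) e1] by blast
  moreover have "e \<star> (m \<star> n) = (e \<star> m) \<star> n"
    using conv_assoc[OF idem_A[OF e(1)] arrow_filterD(3)[OF m] arrow_filterD(3)[OF n]] by simp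
  ultimately show "p \<in> upset T {m \<star> n | m n. m \<in> arrow_filter \<sigma> \<and> n \<in> arrow_filter \<tau>}"
    unfolding upset_def using arrow_filterD(1)[OF p] e(3) n by auto
qed

lemma arrow_filter_inv:
  assumes \<sigma>: "\<sigma> \<in> arrows S" shows "dagger T ` arrow_filter \<sigma> = arrow_filter (iv \<sigma>)"
proof (intro equalityI subsetI)
  have inv: "m\<^sup>\<dagger> \<in> arrow_filter (iv \<tau>)" if "m \<in> arrow_filter \<tau>" for m \<tau>
    using arrow_filterI[OF dagger_N delta_at_inv] arrow_filterD(1,2) that by blast
  fix m
  {
    assume "m \<in> dagger T ` arrow_filter \<sigma>"
    then show "m \<in> arrow_filter (iv \<sigma>)" using inv by blast
  }
  assume m: "m \<in> arrow_filter (iv \<sigma>)"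
  have "m\<^sup>\<dagger> \<in> arrow_filter \<sigma>" using inv[OF m] \<sigma> by simp
  moreover have "m = (m\<^sup>\<dagger>)\<^sup>\<dagger>" using dagger_dagger[OF arrow_filterD(1)[OF m]] by simp
  ultimately show "m \<in> dagger T ` arrow_filter \<sigma>" by (metis imageI)
qed

lemma separating_idems:
  assumes "x \<in> units S" "y \<in> units S" "x \<noteq> y"
  obtains e e' where "e \<in> I" "e' \<in> I" "e x = 1" "e' y = 1" "e \<star> e' = (\<lambda>_. 0)"
proof -
  obtain V W where VW: "openin (unit_top S) V" "openin (unit_top S) W" "x \<in> V" "y \<in> W" "disjnt V W"
    using S.Hausdorff_units assms unfolding Hausdorff_space_def S.topspace_unit_top by blast
  obtain e where e: "e \<in> I" "e x = 1" "\<And>z. z \<in> units S \<Longrightarrow> e z \<noteq> 0 \<Longrightarrow> z \<in> V"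
    using idem_near[OF VW(1,3)] by blast
  obtain e' where e': "e' \<in> I" "e' y = 1" "\<And>z. z \<in> units S \<Longrightarrow> e' z \<noteq> 0 \<Longrightarrow> z \<in> W"
    using idem_near[OF VW(2,4)] by blast
  note eB = idem_diagonal[OF e(1)] and eB' = idem_diagonal[OF e'(1)]
  have "e \<star> e' = (\<lambda>_. 0)"
  proof (rule diagonal_ext)
    show "e \<star> e' \<in> B" using eB eB' by (rule conv_diagonal)
    show "(\<lambda>_. 0) \<in> B" using zero_A by (rule diagonalI) simp
    fix z assume z: "z \<in> units S"
    have "e z = 0 \<or> e' z = 0" using e(3)[OF z] e'(3)[OF z] VW(5) unfolding disjnt_def by blast
    then show "(e \<star> e') z = 0" using conv_diagonal_unit[OF eB eB' z] by auto
  qed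
  then show ?thesis using that e e' by blast
qed

lemma conv_zero [simp]:
  assumes "f \<in> A" shows "(\<lambda>_. 0) \<star> f = (\<lambda>_. 0)" "f \<star> (\<lambda>_. 0) = (\<lambda>_. 0)"
  using conv_scale_left[OF assms assms, of 0] conv_scale_right[OF assms assms, of 0] by simp_all

text \<open>
  If source and range differ, separating idempotents \<open>e\<close> and \<open>e'\<close> cut \<open>m\<close> and \<open>n\<close> down to elements of
  the two filters whose product contains the factor \<open>e \<star> e' = 0\<close>.
\<close>

lemma arrow_filter_composable_imp:
  assumes \<sigma>: "\<sigma> \<in> arrows S" and \<tau>: "\<tau> \<in> arrows S"
    and nz: "\<And>m n. m \<in> arrow_filter \<sigma> \<Longrightarrow> n \<in> arrow_filter \<tau> \<Longrightarrow> m \<star> n \<noteq> (\<lambda>_. 0)"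
  shows "ss \<sigma> = rr \<tau>"
proof (rule ccontr)
  assume "ss \<sigma> \<noteq> rr \<tau>"
  then obtain e e' where e: "e \<in> I" "e' \<in> I" "e (ss \<sigma>) = 1" "e' (rr \<tau>) = 1" "e \<star> e' = (\<lambda>_. 0)"
    using separating_idems[OF S.src_units[OF \<sigma>] S.rng_units[OF \<tau>]] by blast
  obtain m where m: "m \<in> arrow_filter \<sigma>" using arrow_filter_nonempty[OF \<sigma>] by blast
  obtain n where n: "n \<in> arrow_filter \<tau>" using arrow_filter_nonempty[OF \<tau>] by blast
  note mD = arrow_filterD[OF m] and nD = arrow_filterD[OF n]
  have "m \<star> e \<in> arrow_filter \<sigma>"
    using arrow_filterI[OF conv_N[OF mD(1) idem_N[OF e(1)]]] delta_at_idem_right[OF mD(3,2) e(1,3)] by blast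
  moreover have "e' \<star> n \<in> arrow_filter \<tau>"
    using arrow_filterI[OF conv_N[OF idem_N[OF e(2)] nD(1)]] delta_at_idem_left[OF nD(3,2) e(2,4)] by blast
  moreover have "(m \<star> e) \<star> (e' \<star> n) = m \<star> ((e \<star> e') \<star> n)"
    using mD(3) nD(3) idem_A[OF e(1)] idem_A[OF e(2)] by (simp add: conv_assoc conv_A)
  ultimately show False using nz e(5) mD(3) nD(3) by fastforce
qed

lemma inj_on_arrow_filter: "inj_on arrow_filter (arrows S)"
proof (rule inj_onI)
  fix \<sigma> \<tau> assume \<sigma>: "\<sigma> \<in> arrows S" and \<tau>: "\<tau> \<in> arrows S" and eq: "arrow_filter \<sigma> = arrow_filter \<tau>"
  obtain m where m: "m \<in> arrow_filter \<sigma>" using arrow_filter_nonempty[OF \<sigma>] by blast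
  note mD = arrow_filterD[OF m]
  have r: "rr \<sigma> = rr \<tau>"
  proof (rule ccontr)
    assume "rr \<sigma> \<noteq> rr \<tau>"
    then obtain e e' where e: "e \<in> I" "e' \<in> I" "e (rr \<sigma>) = 1" "e' (rr \<tau>) = 1" "e \<star> e' = (\<lambda>_. 0)"
      using separating_idems[OF S.rng_units[OF \<sigma>] S.rng_units[OF \<tau>]] by blast
    have "e (rr \<tau>) = 0"
      using conv_diagonal_unit[OF idem_diagonal[OF e(1)] idem_diagonal[OF e(2)] S.rng_units[OF \<tau>]] e(4,5) by simp
    moreover have "e \<star> m \<in> arrow_filter \<tau>"
      using arrow_filterI[OF conv_N[OF idem_N[OF e(1)] mD(1)]] delta_at_idem_left[OF mD(3,2) e(1,3)] eq by blast
    then have "(e \<star> m) \<tau> = 1" using delta_at_one[OF arrow_filterD(2)] by blast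
    ultimately show False
      using conv_diagonal_left[OF idem_diagonal[OF e(1)] mD(3) \<tau>] one_neq_zero by simp
  qed
  have m\<tau>: "m \<tau> = 1" using delta_at_one[OF arrow_filterD(2)] m eq by blast
  then have "q \<tau> = q \<sigma>" using delta_at_nonzero[OF mD(2) \<tau>] r one_neq_zero by simp
  then obtain t where t: "t \<in> runits" "\<tau> = t \<rhd> \<sigma>" using act_transitive[OF \<sigma> \<tau>] by metis
  have "rinv t = 1" using A_act[OF mD(3) t(1) \<sigma>] delta_at_one[OF mD(2)] m\<tau> t(2) by simp
  then have "t = 1" using rinv_rinv[OF t(1)] by simp
  then show "\<sigma> = \<tau>" using t(2) \<sigma> by simp
qed

lemma gtop_ultrafilter_groupoid:
  "gtop \<U> = topology_generated_by ((\<lambda>n. {U \<in> ultrafilters T. n \<in> U}) ` N)"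
  by (simp add: ultrafilter_groupoid_def)

lemma arrows_ultrafilter_groupoid: "arrows \<U> = ultrafilters T"
proof -
  have "\<exists>n\<in>N. n \<in> U" if "U \<in> ultrafilters T" for U
    using that unfolding ultrafilters_def nfilter_def by blast
  then show ?thesis unfolding arrows_def gtop_ultrafilter_groupoid by auto
qed

text \<open>By \<open>ultrafilter_with_monomial\<close>. The image of a bisection is thus a basic open set, so \<open>Phi\<close> is open.\<close>

lemma ultrafilters_of_bisection:
  assumes X: "compact_open_bisection S X"
  shows "{U \<in> ultrafilters T. tilde_one T X \<in> U} = arrow_filter ` X"
proof (intro equalityI subsetI)
  fix U assume "U \<in> {U \<in> ultrafilters T. tilde_one T X \<in> U}"
  then have U: "U \<in> ultrafilters T" "tilde_one T X \<in> U" by blast+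
  have "\<exists>\<tau>. delta_at (tilde_one T X) \<tau> \<and> rr \<tau> = rr \<omega>" if nz: "tilde_one T X \<omega> \<noteq> 0" for \<omega>
  proof -
    obtain t \<tau> where t: "t \<in> runits" "\<tau> \<in> X" "\<omega> = t \<rhd> \<tau>" using tilde_one_nonzero[OF X nz] by blast
    then have "rr \<tau> = rr \<omega>" using compact_open_bisectionD(4)[OF X] by auto
    then show ?thesis using tilde_one_delta[OF X t(2)] by blast
  qed
  then obtain \<sigma> where "delta_at (tilde_one T X) \<sigma>" "U = arrow_filter \<sigma>"
    using ultrafilter_with_monomial[OF U] by blast
  then show "U \<in> arrow_filter ` X" using delta_at_tilde_one_iff[OF X] by blast
next
  fix U assume "U \<in> arrow_filter ` X"
  then obtain \<sigma> where "\<sigma> \<in> X" "U = arrow_filter \<sigma>" by blast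
  then show "U \<in> {U \<in> ultrafilters T. tilde_one T X \<in> U}"
    using arrow_filter_ultrafilter tilde_one_arrow_filter[OF X] compact_open_bisectionD(4)[OF X] by blast
qed

text \<open>
  An idempotent that is the delta function at \<open>\<sigma> = t \<rhd> x\<close> has value \<open>t\<^sup>-\<^sup>1\<close> times 0 or 1 there, so
  \<open>t = 1\<close> and \<open>\<sigma>\<close> is the unit \<open>x\<close>.
\<close>

lemma arrow_filter_units: "arrow_filter ` units S = ultrafilter_units T"
proof (intro equalityI subsetI)
  fix U assume "U \<in> arrow_filter ` units S"
  then obtain x where x: "x \<in> units S" "U = arrow_filter x" by blast
  have "openin (unit_top S) (units S)" using openin_unit_top_iff openin_units by blast
  then obtain e where e: "e \<in> I" "e x = 1" using idem_near[OF _ x(1)] by metis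
  then have "e \<in> arrow_filter x" using arrow_filterI[OF idem_N delta_at_idem] x(1) by blast
  then show "U \<in> ultrafilter_units T"
    unfolding ultrafilter_units_def
    using e(1) x arrow_filter_ultrafilter[OF S.units_arrow[OF x(1)]] by blast
next
  fix U assume "U \<in> ultrafilter_units T"
  then obtain e where e: "e \<in> I" "e \<in> U" and U: "U \<in> ultrafilters T" unfolding ultrafilter_units_def by blast
  have unit: "\<exists>t. t \<in> runits \<and> \<omega> = t \<rhd> rr \<omega> \<and> e \<omega> = rinv t \<and> e (rr \<omega>) = 1 \<and> \<omega> \<in> arrows S" if nz: "e \<omega> \<noteq> 0" for \<omega>
  proof -
    have \<omega>: "\<omega> \<in> arrows S" using A_nonzero_arrow[OF idem_A[OF e(1)] nz] .
    obtain t where t: "t \<in> runits" "\<omega> = t \<rhd> rr \<omega>"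
      using q_unit_iff_act_unit[OF \<omega> diagonal_over_units[OF idem_diagonal[OF e(1)] nz]] by blast
    have "e (t \<rhd> rr \<omega>) = rinv t * e (rr \<omega>)" using A_act[OF idem_A[OF e(1)] t(1)] \<omega> by simp
    then have v: "e \<omega> = rinv t * e (rr \<omega>)" using t(2) by metis
    then have "e (rr \<omega>) \<noteq> 0" using nz by auto
    then have "e (rr \<omega>) = 1" using idem_values[OF e(1) S.rng_units[OF \<omega>]] by blast
    then show ?thesis using t v \<omega> by auto
  qed
  have "\<exists>\<tau>. delta_at e \<tau> \<and> rr \<tau> = rr \<omega>" if "e \<omega> \<noteq> 0" for \<omega>
  proof -
    have "\<omega> \<in> arrows S" "e (rr \<omega>) = 1" using unit[OF that] by blast+
    then have "delta_at e (rr \<omega>)" "rr (rr \<omega>) = rr \<omega>"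
      using delta_at_idem[OF e(1)] S.rng_units S.units_rng by blast+
    then show ?thesis by blast
  qed
  then obtain \<sigma> where \<sigma>: "delta_at e \<sigma>" "U = arrow_filter \<sigma>"
    using ultrafilter_with_monomial[OF U e(2)] by blast
  have "e \<sigma> \<noteq> 0" using delta_at_one[OF \<sigma>(1)] one_neq_zero by simp
  then obtain t where t: "t \<in> runits" "\<sigma> = t \<rhd> rr \<sigma>" "e \<sigma> = rinv t" "\<sigma> \<in> arrows S" using unit by blast
  have "t = 1" using t(3) delta_at_one[OF \<sigma>(1)] rinv_rinv[OF t(1)] by simp
  then have "\<sigma> = rr \<sigma>" using t(2) act_one[OF S.rng_arrow[OF t(4)]] by metis
  then have "\<sigma> \<in> units S" using S.rng_units[OF t(4)] by simp
  then show "U \<in> arrow_filter ` units S" using \<sigma>(2) by blast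
qed

lemma continuous_Phi: "continuous_map (gtop S) (gtop \<U>) (Phi T)"
  unfolding gtop_ultrafilter_groupoid
proof (rule continuous_on_generated_topo)
  fix V assume "V \<in> (\<lambda>n. {U \<in> ultrafilters T. n \<in> U}) ` N"
  then obtain n where n: "n \<in> N" "V = {U \<in> ultrafilters T. n \<in> U}" by blast
  have "Phi T -` V \<inter> topspace (gtop S) = {\<sigma> \<in> arrows S. delta_at n \<sigma>}"
  proof (intro equalityI subsetI)
    fix \<sigma> assume "\<sigma> \<in> Phi T -` V \<inter> topspace (gtop S)"
    then have "\<sigma> \<in> arrows S" "n \<in> Phi T \<sigma>" unfolding n(2) arrows_def by blast+
    then show "\<sigma> \<in> {\<sigma> \<in> arrows S. delta_at n \<sigma>}"
      using Phi_eq_arrow_filter arrow_filterD(2) by blast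
  next
    fix \<sigma> assume "\<sigma> \<in> {\<sigma> \<in> arrows S. delta_at n \<sigma>}"
    then have \<sigma>: "\<sigma> \<in> arrows S" "delta_at n \<sigma>" by blast+
    then have "Phi T \<sigma> \<in> V"
      unfolding n(2) Phi_eq_arrow_filter[OF \<sigma>(1)]
      using arrow_filter_ultrafilter arrow_filterI[OF n(1)] by blast
    then show "\<sigma> \<in> Phi T -` V \<inter> topspace (gtop S)" using \<sigma>(1) unfolding arrows_def by blast
  qed
  then show "openin (gtop S) (Phi T -` V \<inter> topspace (gtop S))"
    using openin_delta_at[OF N_A[OF n(1)]] by simp
next
  have "Phi T \<sigma> \<in> topspace (gtop \<U>)" if "\<sigma> \<in> arrows S" for \<sigma>
    using arrow_filter_ultrafilter[OF that] arrows_ultrafilter_groupoid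
    unfolding Phi_eq_arrow_filter[OF that] arrows_def by blast
  then show "Phi T ` topspace (gtop S) \<subseteq> \<Union> ((\<lambda>n. {U \<in> ultrafilters T. n \<in> U}) ` N)"
    unfolding gtop_ultrafilter_groupoid topology_generated_by_topspace arrows_def by blast
qed

lemma open_map_Phi: "open_map (gtop S) (gtop \<U>) (Phi T)"
  unfolding open_map_def
proof (intro allI impI)
  fix W assume W: "openin (gtop S) W"
  show "openin (gtop \<U>) (Phi T ` W)"
  proof (subst openin_subopen, intro ballI)
    fix U assume "U \<in> Phi T ` W"
    then obtain \<sigma> where \<sigma>: "\<sigma> \<in> W" "U = Phi T \<sigma>" by blast
    obtain X where X: "compact_open_bisection S X" "\<sigma> \<in> X" "X \<subseteq> W"
      using compact_open_bisection_basis[OF W \<sigma>(1)] by blast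
    have "Phi T ` X = arrow_filter ` X"
      using Phi_eq_arrow_filter compact_open_bisectionD(4)[OF X(1)] by (intro image_cong) auto
    moreover have "openin (gtop \<U>) {U \<in> ultrafilters T. tilde_one T X \<in> U}"
      unfolding gtop_ultrafilter_groupoid
      by (rule topology_generated_by_Basis) (use tilde_one_N[OF X(1)] in blast)
    ultimately have "openin (gtop \<U>) (Phi T ` X)" using ultrafilters_of_bisection[OF X(1)] by simp
    then show "\<exists>V. openin (gtop \<U>) V \<and> U \<in> V \<and> V \<subseteq> Phi T ` W"
      using X(2,3) \<sigma>(2) by (intro exI[of _ "Phi T ` X"]) blast
  qed
qed

lemma inj_on_Phi: "inj_on (Phi T) (arrows S)"
proof (rule inj_onI)
  fix \<sigma> \<tau> assume h: "\<sigma> \<in> arrows S" "\<tau> \<in> arrows S" "Phi T \<sigma> = Phi T \<tau>"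
  then have "arrow_filter \<sigma> = arrow_filter \<tau>" using Phi_eq_arrow_filter by metis
  then show "\<sigma> = \<tau>" using inj_onD[OF inj_on_arrow_filter] h(1,2) by blast
qed

lemma groupoid_embedding_Phi: "groupoid_embedding S \<U> (Phi T)"
  unfolding groupoid_embedding_def groupoid_hom_def
proof (intro conjI ballI impI)
  have comps_iff: "(U, V) \<in> comps \<U> \<longleftrightarrow> U \<in> ultrafilters T \<and> V \<in> ultrafilters T \<and>
      (\<forall>m\<in>U. \<forall>n\<in>V. m \<star> n \<noteq> (\<lambda>_. 0))" for U V
    unfolding ultrafilter_groupoid_def by simp
  show "Phi T \<in> arrows S \<rightarrow> arrows \<U>"
    using Phi_eq_arrow_filter arrow_filter_ultrafilter arrows_ultrafilter_groupoid by auto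
  show "inj_on (Phi T) (arrows S)" by (rule inj_on_Phi)
  show "case p of (a, b) \<Rightarrow> (Phi T a, Phi T b) \<in> comps \<U> \<and>
      Phi T (a \<odot> b) = gmult \<U> (Phi T a) (Phi T b)" if "p \<in> comps S" for p
  proof -
    obtain \<sigma> \<tau> where p: "p = (\<sigma>, \<tau>)" by (cases p)
    then have st: "\<sigma> \<in> arrows S" "\<tau> \<in> arrows S" "ss \<sigma> = rr \<tau>" using \<open>p \<in> comps S\<close> S.comps_iff by blast+
    then have \<sigma>\<tau>: "\<sigma> \<odot> \<tau> \<in> arrows S" by simp
    have "m \<star> n \<noteq> (\<lambda>_. 0)" if m: "m \<in> arrow_filter \<sigma>" and n: "n \<in> arrow_filter \<tau>" for m n
    proof
      assume "m \<star> n = (\<lambda>_. 0)"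
      moreover have "delta_at (m \<star> n) (\<sigma> \<odot> \<tau>)"
        using delta_at_conv[OF arrow_filterD(3)[OF m] arrow_filterD(2)[OF m]
            arrow_filterD(3)[OF n] arrow_filterD(2)[OF n] st(3)] .
      ultimately show False using delta_at_one[of "m \<star> n" "\<sigma> \<odot> \<tau>"] one_neq_zero by simp
    qed
    then have "(arrow_filter \<sigma>, arrow_filter \<tau>) \<in> comps \<U>"
      unfolding comps_iff using arrow_filter_ultrafilter st(1,2) by blast
    moreover have "gmult \<U> (arrow_filter \<sigma>) (arrow_filter \<tau>) = arrow_filter (\<sigma> \<odot> \<tau>)"
      using arrow_filter_mult[OF st] by (simp add: ultrafilter_groupoid_def)
    ultimately show ?thesis
      unfolding p using Phi_eq_arrow_filter st(1,2) \<sigma>\<tau> by simp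
  qed
  show "(\<sigma>, \<tau>) \<in> comps S"
    if "\<sigma> \<in> arrows S" "\<tau> \<in> arrows S" "(Phi T \<sigma>, Phi T \<tau>) \<in> comps \<U>" for \<sigma> \<tau>
  proof -
    have "m \<star> n \<noteq> (\<lambda>_. 0)" if "m \<in> arrow_filter \<sigma>" "n \<in> arrow_filter \<tau>" for m n
      using \<open>(Phi T \<sigma>, Phi T \<tau>) \<in> comps \<U>\<close> that
      unfolding comps_iff Phi_eq_arrow_filter[OF \<open>\<sigma> \<in> arrows S\<close>] Phi_eq_arrow_filter[OF \<open>\<tau> \<in> arrows S\<close>]
      by blast
    then have "ss \<sigma> = rr \<tau>" using arrow_filter_composable_imp that(1,2) by blast
    then show ?thesis unfolding S.comps_iff using that(1,2) by blast
  qed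
  show "Phi T (iv \<sigma>) = ginv \<U> (Phi T \<sigma>)" if "\<sigma> \<in> arrows S" for \<sigma>
    using arrow_filter_inv[OF that] Phi_eq_arrow_filter[OF that] Phi_eq_arrow_filter[of "iv \<sigma>"] that
    by (simp add: ultrafilter_groupoid_def)
qed

end

theorem proposition8p4:
  fixes T :: "('r::comm_ring_1, 'g, 'a) twist"
  assumes "indecomposable_ring TYPE('r)"
    and "discrete_twist T"
    and "ample (base T)"
    and "Hausdorff_space (gtop (base T))"
  shows "(\<forall>\<sigma>\<in>arrows (tot T). \<exists>X. compact_open_bisection (tot T) X \<and> \<sigma> \<in> X)
    \<and> (\<forall>\<sigma>\<in>arrows (tot T). \<forall>X. compact_open_bisection (tot T) X \<and> \<sigma> \<in> X \<longrightarrow>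
         Phi T \<sigma> = Phi_at T X \<sigma>)
    \<and> Phi T \<in> arrows (tot T) \<rightarrow> ultrafilters T
    \<and> (\<forall>t\<in>runits. \<forall>\<sigma>\<in>arrows (tot T). Phi T (act T t \<sigma>) = uact t (Phi T \<sigma>))
    \<and> continuous_open_groupoid_embedding (tot T) (ultrafilter_groupoid T) (Phi T)
    \<and> Phi T ` units (tot T) = ultrafilter_units T"
proof -
  interpret ample_twist T
    using assms by (simp add: ample_twist_def ample_twist_axioms_def)
  show ?thesis
  proof (intro conjI ballI allI impI)
    show "\<exists>X. compact_open_bisection (tot T) X \<and> \<sigma> \<in> X" if "\<sigma> \<in> arrows (tot T)" for \<sigma>
      using arrow_basis[OF that] by blast
    show "Phi T \<sigma> = Phi_at T X \<sigma>"
      if "\<sigma> \<in> arrows (tot T)" "compact_open_bisection (tot T) X \<and> \<sigma> \<in> X" for \<sigma> X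
      using Phi_eq_arrow_filter[OF that(1)] Phi_at_eq_arrow_filter[of X \<sigma>] that(2) by simp
    show "Phi T \<in> arrows (tot T) \<rightarrow> ultrafilters T"
      using Phi_eq_arrow_filter arrow_filter_ultrafilter by auto
    show "Phi T (act T t \<sigma>) = uact t (Phi T \<sigma>)" if "t \<in> runits" "\<sigma> \<in> arrows (tot T)" for t \<sigma>
      using arrow_filter_act[OF that] Phi_eq_arrow_filter[OF that(2)]
        Phi_eq_arrow_filter[OF act_arrow[OF that]] by simp
    show "continuous_open_groupoid_embedding (tot T) (ultrafilter_groupoid T) (Phi T)"
      unfolding continuous_open_groupoid_embedding_def
      using groupoid_embedding_Phi continuous_Phi open_map_Phi inj_on_Phi
        injective_open_imp_embedding_map[OF continuous_Phi open_map_Phi]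
      by (simp add: arrows_def)
    have "Phi T ` units (tot T) = arrow_filter ` units (tot T)"
      using Phi_eq_arrow_filter S.units_arrow by (intro image_cong) auto
    then show "Phi T ` units (tot T) = ultrafilter_units T" using arrow_filter_units by simp
  qed
qed

end
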